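(* Let $\nu,\eta,\kappa,g>0$, let $\alpha$ be a constant, fix $\epsilon>0$, and let $\zeta^\epsilon$ be a calming function. Let $T>0$ be arbitrary and let $(u_0,b_0,\theta_0)\in(H^2\cap V)\times(H^2\cap V)\times H^2(\mathbb{T}^2)$. Then strong solutions on $[0,T]$ with initial data $(u_0,b_0,\theta_0)$ of the calmed 2D MHD-Boussinesq system $$\begin{cases}\partial_t u-\nu\Delta u+(u\cdot\nabla)u+\nabla p=(b\cdot\nabla)b+g\theta\vec e_2,\\ \partial_t b-\eta\Delta b+(u\cdot\nabla)b=(b\cdot\nabla)u,\\ \partial_t\theta-\kappa\Delta\theta+(u\cdot\nabla)\theta=\alpha\eta\,\zeta^\epsilon(|\nabla\times b|)\,|\nabla\times b|,\\ \nabla\cdot u=0=\nabla\cdot b\end{cases}$$ are unique: if $(u_1,b_1,\theta_1)$ and $(u_2,b_2,\theta_2)$ are two strong solutions on $[0,T]$ with the same initial data $(u_0,b_0,\theta_0)$, then $u_1=u_2$, $b_1=b_2$ and $\theta_1=\theta_2$.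
   Context: **Domain and spaces.** $\mathbb{T}^2=\mathbb{R}^2/\mathbb{Z}^2=[0,1]^2$ with periodic boundary conditions; $x=(x_1,x_2)$, $\vec e_2=(0,1)^T$. The unknowns are $u=(u_1,u_2)$, $b=(b_1,b_2)$ (vector fields on $\mathbb{T}^2\times[0,T]$), and the scalars $p,\theta$; $\nabla\times b=\partial_{x_1}b_2-\partial_{x_2}b_1$. (In the claim, the subscripts in $(u_1,b_1,\theta_1)$, $(u_2,b_2,\theta_2)$ label the two solutions, not components.) $L^p$ and $H^s=W^{s,2}$ denote the usual Lebesgue and Sobolev spaces on $\mathbb{T}^2$ (and $H^{-1}$ is the dual of $H^1$). Let $\mathcal V$ be the set of periodic $\mathbb{R}^2$-valued trigonometric polynomials on $\mathbb{T}^2$ that are divergence free with zero average. $H$ and $V$ are the closures of $\mathcal V$ in $L^2(\mathbb{T}^2)^2$ and $H^1(\mathbb{T}^2)^2$ respectively. $P_\sigma$ is the orthogonal (Leray–Helmholtz) projector from $L^2$ onto $H$, and $A=-P_\sigma\Delta$ is the Stokes operator with domain $H^2\cap V$. **Calming function.** $\zeta^\epsilon$ is a bounded, smooth, globally Lipschitz real-valued function of a real variable, with Lipschitz constant $L_\epsilon>0$, belonging to a family indexed by $\epsilon>0$ such that $|\zeta^\epsilon(x)|+|\nabla\zeta^\epsilon(x)|\le M_\epsilon$ for all $x$, for some $M_\epsilon>0$ with $\lim_{\epsilon\to0^+}M_\epsilon=\infty$, and $|x-\zeta^\epsilon(x)|\le C\epsilon^\gamma|x|^\beta$ for all $x$,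 for some constants $C>0$, $\gamma>0$, $\beta\ge1$ not depending on $\epsilon$. **Semi-strong solution.** For $T>0$ and $(u_0,b_0,\theta_0)\in V\times V\times L^2$, $(u,b,\theta)$ is a semi-strong solution on $[0,T]$ if - $u,b\in C([0,T];V)\cap L^2(0,T;H^2\cap V)$ with $\partial_tu,\partial_tb\in L^2(0,T;H)$; - $\theta\in C([0,T];L^2)\cap L^2(0,T;H^1)$ with $\partial_t\theta\in L^2(0,T;H^{-1})$; - the system holds in the functional sense in $L^2(0,T;H)\times L^2(0,T;H)\times L^2(0,T;H^{-1})$, that is, $\partial_tu+\nu Au+P_\sigma((u\cdot\nabla)u)=P_\sigma((b\cdot\nabla)b)+gP_\sigma(\theta\vec e_2)$ and $\partial_tb+\eta Ab+P_\sigma((u\cdot\nabla)b)=P_\sigma((b\cdot\nabla)u)$ in $L^2(0,T;H)$, and $\partial_t\theta-\kappa\Delta\theta+(u\cdot\nabla)\theta=\alpha\eta\,\zeta^\epsilon(|\nabla\times b|)|\nabla\times b|$ in $L^2(0,T;H^{-1})$; - the initial data are attained, $u(0)=u_0$, $b(0)=b_0$, $\theta(0)=\theta_0$, in the sense of $C([0,T];V)\times C([0,T];V)\times C([0,T];L^2)$. **Strong solution.** For $T>0$ and $(u_0,b_0,\theta_0)\in(H^2\cap V)\times(H^2\cap V)\times H^2$, $(u,b,\theta)$ is a strong solution on $[0,T]$ if it is a semi-strong solution with this initial data and in addition $u,b\in C([0,T];H^2\cap V)\cap L^2(0,T;H^3\cap V)$ and $\theta\in L^\infty(0,T;H^2)\cap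 L^2(0,T;H^3)$, where the initial data are attained in the sense of $C([0,T];H^2\cap V)$ for $u_0,b_0$ and in the sense of $C([0,T];L^2)$ for $\theta_0$. *)

theory Defs
  imports "HOL-Analysis.Analysis"
begin

section \<open>Function spaces on the two-dimensional torus\<close>

text \<open>
  The torus is the unit cell with periodic boundary conditions.  A function on the torus is
  represented by a function on the plane of which only the values on the unit cell matter, and
  these only up to null sets.  Periodicity enters through the test functions in the weak
  derivative and through the trigonometric polynomials, which are periodic on the whole plane.
\<close>

definition torus :: "(real^2) measure" where
  "torus = lebesgue_on (cbox 0 1)"

definition L2 :: "(real^2 \<Rightarrow> 'a::euclidean_space) set" where
  "L2 = {f. f \<in> borel_measurable torus \<and> integrable torus (\<lambda>x. (norm (f x))\<^sup>2)}"

definition L2_inner :: "(real^2 \<Rightarrow> 'a::euclidean_space) \<Rightarrow> (real^2 \<Rightarrow> 'a) \<Rightarrow> real" where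
  "L2_inner f h = (\<integral>x. f x \<bullet> h x \<partial>torus)"

definition L2_norm :: "(real^2 \<Rightarrow> 'a::euclidean_space) \<Rightarrow> real" where
  "L2_norm f = sqrt (\<integral>x. (norm (f x))\<^sup>2 \<partial>torus)"

definition dir_deriv :: "'a \<Rightarrow> ('a::euclidean_space \<Rightarrow> 'b::real_normed_vector) \<Rightarrow> 'a \<Rightarrow> 'b" where
  "dir_deriv v f = (\<lambda>x. frechet_derivative f (at x) v)"

text \<open>All iterated partial derivatives exist and are (Frechet) differentiable.\<close>

definition smooth :: "('a::euclidean_space \<Rightarrow> 'b::real_normed_vector) \<Rightarrow> bool" where
  "smooth f \<longleftrightarrow> (\<forall>vs. set vs \<subseteq> Basis \<longrightarrow> foldr dir_deriv vs f differentiable_on UNIV)"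

definition periodic :: "(real^2 \<Rightarrow> 'b) \<Rightarrow> bool" where
  "periodic f \<longleftrightarrow> (\<forall>x i. f (x + axis i 1) = f x)"

text \<open>A multi-index is a pair of naturals: the orders in \<open>x\<^sub>1\<close> and in \<open>x\<^sub>2\<close>.\<close>

definition multi_deriv :: "nat \<times> nat \<Rightarrow> (real^2 \<Rightarrow> real) \<Rightarrow> real^2 \<Rightarrow> real" where
  "multi_deriv m \<phi> = (dir_deriv (axis 1 1) ^^ fst m) ((dir_deriv (axis 2 1) ^^ snd m) \<phi>)"

definition has_weak_deriv ::
  "nat \<times> nat \<Rightarrow> (real^2 \<Rightarrow> 'a::euclidean_space) \<Rightarrow> (real^2 \<Rightarrow> 'a) \<Rightarrow> bool" where
  "has_weak_deriv m f h \<longleftrightarrow> h \<in> L2 \<and>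
     (\<forall>\<phi>. smooth \<phi> \<and> periodic \<phi> \<longrightarrow>
        (\<integral>x. multi_deriv m \<phi> x *\<^sub>R f x \<partial>torus)
          = (-1) ^ (fst m + snd m) *\<^sub>R (\<integral>x. \<phi> x *\<^sub>R h x \<partial>torus))"

text \<open>The weak derivative is unique up to null sets; this picks a representative.\<close>

definition weak_deriv ::
  "nat \<times> nat \<Rightarrow> (real^2 \<Rightarrow> 'a::euclidean_space) \<Rightarrow> real^2 \<Rightarrow> 'a" where
  "weak_deriv m f = (SOME h. has_weak_deriv m f h)"

abbreviation D1 :: "(real^2 \<Rightarrow> 'a::euclidean_space) \<Rightarrow> real^2 \<Rightarrow> 'a" where
  "D1 \<equiv> weak_deriv (1, 0)"

abbreviation D2 :: "(real^2 \<Rightarrow> 'a::euclidean_space) \<Rightarrow> real^2 \<Rightarrow> 'a" where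
  "D2 \<equiv> weak_deriv (0, 1)"

definition sobolev :: "nat \<Rightarrow> (real^2 \<Rightarrow> 'a::euclidean_space) set" where
  "sobolev s = {f \<in> L2. \<forall>m. fst m + snd m \<le> s \<longrightarrow> (\<exists>h. has_weak_deriv m f h)}"

definition sobolev_norm :: "nat \<Rightarrow> (real^2 \<Rightarrow> 'a::euclidean_space) \<Rightarrow> real" where
  "sobolev_norm s f = sqrt (\<Sum>m | fst m + snd m \<le> s. (L2_norm (weak_deriv m f))\<^sup>2)"

text \<open>The dual of \<open>H\<^sup>1\<close>: functionals, of which only the values on \<open>sobolev 1\<close> matter.  Bounded
  linear functionals automatically respect equality almost everywhere.\<close>

definition H_minus1 :: "((real^2 \<Rightarrow> real) \<Rightarrow> real) set" where
  "H_minus1 = {F.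
     (\<forall>\<phi>\<in>sobolev 1. \<forall>\<psi>\<in>sobolev 1. \<forall>r s.
        F (\<lambda>x. r * \<phi> x + s * \<psi> x) = r * F \<phi> + s * F \<psi>) \<and>
     (\<exists>C. \<forall>\<psi>\<in>sobolev 1. \<bar>F \<psi>\<bar> \<le> C * sobolev_norm 1 \<psi>)}"

definition H_minus1_norm :: "((real^2 \<Rightarrow> real) \<Rightarrow> real) \<Rightarrow> real" where
  "H_minus1_norm F = Sup {\<bar>F \<psi>\<bar> | \<psi>. \<psi> \<in> sobolev 1 \<and> sobolev_norm 1 \<psi> \<le> 1}"

text \<open>The embedding of \<open>L\<^sup>2\<close> into the dual of \<open>H\<^sup>1\<close>, and the Laplacian from \<open>H\<^sup>1\<close> to its dual.\<close>

definition L2_to_dual :: "(real^2 \<Rightarrow> real) \<Rightarrow> (real^2 \<Rightarrow> real) \<Rightarrow> real" where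
  "L2_to_dual f = (\<lambda>\<psi>. L2_inner f \<psi>)"

definition dual_laplacian :: "(real^2 \<Rightarrow> real) \<Rightarrow> (real^2 \<Rightarrow> real) \<Rightarrow> real" where
  "dual_laplacian f = (\<lambda>\<psi>. - (L2_inner (D1 f) (D1 \<psi>) + L2_inner (D2 f) (D2 \<psi>)))"


section \<open>Divergence-free fields, Leray projector, Stokes operator\<close>

definition trig_poly :: "(real^2 \<Rightarrow> real^2) \<Rightarrow> bool" where
  "trig_poly f \<longleftrightarrow> (\<exists>(K :: (int \<times> int) set) a c. finite K \<and>
     f = (\<lambda>x. \<Sum>k\<in>K.
            cos (2 * pi * (of_int (fst k) * x$1 + of_int (snd k) * x$2)) *\<^sub>R a k
          + sin (2 * pi * (of_int (fst k) * x$1 + of_int (snd k) * x$2)) *\<^sub>R c k))"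

definition div_free_trig :: "(real^2 \<Rightarrow> real^2) set" where
  "div_free_trig = {f. trig_poly f \<and>
     (\<forall>x. dir_deriv (axis 1 1) (\<lambda>y. f y $ 1) x + dir_deriv (axis 2 1) (\<lambda>y. f y $ 2) x = 0) \<and>
     (\<integral>x. f x \<partial>torus) = 0}"

definition H_space :: "(real^2 \<Rightarrow> real^2) set" where
  "H_space = {f \<in> L2. \<forall>e>0. \<exists>v\<in>div_free_trig. L2_norm (\<lambda>x. f x - v x) < e}"

definition V_space :: "(real^2 \<Rightarrow> real^2) set" where
  "V_space = {f \<in> sobolev 1. \<forall>e>0. \<exists>v\<in>div_free_trig. sobolev_norm 1 (\<lambda>x. f x - v x) < e}"

definition leray :: "(real^2 \<Rightarrow> real^2) \<Rightarrow> real^2 \<Rightarrow> real^2" where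
  "leray f = (SOME h. h \<in> H_space \<and> (\<forall>v\<in>H_space. L2_inner (\<lambda>x. f x - h x) v = 0))"

definition stokes :: "(real^2 \<Rightarrow> real^2) \<Rightarrow> real^2 \<Rightarrow> real^2" where
  "stokes f = (\<lambda>x. - leray (\<lambda>y. weak_deriv (2, 0) f y + weak_deriv (0, 2) f y) x)"

text \<open>The transport term \<open>(v \<cdot> \<nabla>) f\<close>.\<close>

definition advect ::
  "(real^2 \<Rightarrow> real^2) \<Rightarrow> (real^2 \<Rightarrow> 'a::euclidean_space) \<Rightarrow> real^2 \<Rightarrow> 'a" where
  "advect v f = (\<lambda>x. (v x $ 1) *\<^sub>R D1 f x + (v x $ 2) *\<^sub>R D2 f x)"

definition curl :: "(real^2 \<Rightarrow> real^2) \<Rightarrow> real^2 \<Rightarrow> real" where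
  "curl f = (\<lambda>x. D1 f x $ 2 - D2 f x $ 1)"


section \<open>Functions of time with values in a function space\<close>

text \<open>
  All spaces above consist of functions \<open>'x \<Rightarrow> 'v\<close> with a seminorm \<open>N\<close> whose kernel is the equality
  in that space (equality almost everywhere, or equality on \<open>sobolev 1\<close> for functionals).  The
  following notions are the Bochner ones on the time interval from 0 to \<open>T\<close>, for a space \<open>X\<close>
  with seminorm \<open>N\<close>.
\<close>

definition time_interval :: "real \<Rightarrow> real measure" where
  "time_interval T = lebesgue_on {0..T}"

definition simple_in :: "real \<Rightarrow> 'b set \<Rightarrow> (real \<Rightarrow> 'b) \<Rightarrow> bool" where
  "simple_in T X s \<longleftrightarrow> simple_function (time_interval T) s \<and> (\<forall>t\<in>{0..T}. s t \<in> X)"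

definition strongly_measurable ::
  "real \<Rightarrow> ('x \<Rightarrow> 'v::euclidean_space) set \<Rightarrow> (('x \<Rightarrow> 'v) \<Rightarrow> real) \<Rightarrow> (real \<Rightarrow> 'x \<Rightarrow> 'v) \<Rightarrow> bool" where
  "strongly_measurable T X N f \<longleftrightarrow> (AE t in time_interval T. f t \<in> X) \<and>
     (\<exists>s. (\<forall>n::nat. simple_in T X (s n)) \<and>
        (AE t in time_interval T. (\<lambda>n. N (\<lambda>x. s n t x - f t x)) \<longlonglongrightarrow> 0))"

definition C_time ::
  "real \<Rightarrow> ('x \<Rightarrow> 'v::euclidean_space) set \<Rightarrow> (('x \<Rightarrow> 'v) \<Rightarrow> real) \<Rightarrow> (real \<Rightarrow> 'x \<Rightarrow> 'v) set" where
  "C_time T X N = {f. \<forall>t\<in>{0..T}. f t \<in> X \<and>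
     ((\<lambda>s. N (\<lambda>x. f s x - f t x)) \<longlongrightarrow> 0) (at t within {0..T})}"

definition L2_time ::
  "real \<Rightarrow> ('x \<Rightarrow> 'v::euclidean_space) set \<Rightarrow> (('x \<Rightarrow> 'v) \<Rightarrow> real) \<Rightarrow> (real \<Rightarrow> 'x \<Rightarrow> 'v) set" where
  "L2_time T X N = {f. strongly_measurable T X N f \<and>
     integrable (time_interval T) (\<lambda>t. (N (f t))\<^sup>2)}"

definition Linf_time ::
  "real \<Rightarrow> ('x \<Rightarrow> 'v::euclidean_space) set \<Rightarrow> (('x \<Rightarrow> 'v) \<Rightarrow> real) \<Rightarrow> (real \<Rightarrow> 'x \<Rightarrow> 'v) set" where
  "Linf_time T X N = {f. strongly_measurable T X N f \<and>
     (\<exists>C. AE t in time_interval T. N (f t) \<le> C)}"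

text \<open>The Bochner integral over the time interval: the limit of the integrals of approximating
  simple functions (for which the integral, a finite sum, may be taken pointwise in \<open>x\<close>).\<close>

definition has_time_integral ::
  "real \<Rightarrow> ('x \<Rightarrow> 'v::euclidean_space) set \<Rightarrow> (('x \<Rightarrow> 'v) \<Rightarrow> real) \<Rightarrow>
     (real \<Rightarrow> 'x \<Rightarrow> 'v) \<Rightarrow> ('x \<Rightarrow> 'v) \<Rightarrow> bool" where
  "has_time_integral T X N f J \<longleftrightarrow> strongly_measurable T X N f \<and> J \<in> X \<and>
     (\<exists>s. (\<forall>n::nat. simple_in T X (s n) \<and>
            integrable (time_interval T) (\<lambda>t. N (\<lambda>x. s n t x - f t x))) \<and>
        (\<lambda>n. \<integral>t. N (\<lambda>x. s n t x - f t x) \<partial>time_interval T) \<longlonglongrightarrow> 0 \<and>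
        (\<lambda>n. N (\<lambda>x. (\<integral>t. s n t x \<partial>time_interval T) - J x)) \<longlonglongrightarrow> 0)"

text \<open>Distributional time derivative on the open interval, with values in \<open>X\<close>.\<close>

definition has_time_deriv ::
  "real \<Rightarrow> ('x \<Rightarrow> 'v::euclidean_space) set \<Rightarrow> (('x \<Rightarrow> 'v) \<Rightarrow> real) \<Rightarrow>
     (real \<Rightarrow> 'x \<Rightarrow> 'v) \<Rightarrow> (real \<Rightarrow> 'x \<Rightarrow> 'v) \<Rightarrow> bool" where
  "has_time_deriv T X N f f' \<longleftrightarrow>
     (\<forall>\<phi>::real \<Rightarrow> real. smooth \<phi> \<and>
        (\<exists>a c. 0 < a \<and> c < T \<and> (\<forall>t. t \<notin> {a..c} \<longrightarrow> \<phi> t = 0)) \<longrightarrow>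
        (\<exists>J. has_time_integral T X N (\<lambda>t x. deriv \<phi> t *\<^sub>R f t x) J \<and>
             has_time_integral T X N (\<lambda>t x. \<phi> t *\<^sub>R f' t x) (\<lambda>x. - J x)))"


section \<open>The calmed system\<close>

text \<open>The argument \<open>\<zeta>\<close> is the whole family, indexed by \<open>\<epsilon> > 0\<close>.\<close>

definition calming_family :: "(real \<Rightarrow> real \<Rightarrow> real) \<Rightarrow> bool" where
  "calming_family \<zeta> \<longleftrightarrow>
     (\<forall>\<epsilon>>0. bounded (range (\<zeta> \<epsilon>)) \<and> smooth (\<zeta> \<epsilon>) \<and> (\<exists>L>0. L-lipschitz_on UNIV (\<zeta> \<epsilon>))) \<and>
     (\<exists>M :: real \<Rightarrow> real. (\<forall>\<epsilon>>0. M \<epsilon> > 0 \<and> (\<forall>x. \<bar>\<zeta> \<epsilon> x\<bar> + \<bar>deriv (\<zeta> \<epsilon>) x\<bar> \<le> M \<epsilon>)) \<and>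
        filterlim M at_top (at_right 0)) \<and>
     (\<exists>C>0. \<exists>\<gamma>>0. \<exists>\<beta>\<ge>1. \<forall>\<epsilon>>0. \<forall>x. \<bar>x - \<zeta> \<epsilon> x\<bar> \<le> C * \<epsilon> powr \<gamma> * \<bar>x\<bar> powr \<beta>)"

text \<open>Here \<open>\<zeta>\<close> is the single function with the fixed parameter.  The paths are continuous in
  time, so attaining the initial data means that the value at time 0 is the given element of the
  space, i.e. equality almost everywhere.\<close>

definition semi_strong_solution ::
  "real \<Rightarrow> real \<Rightarrow> real \<Rightarrow> real \<Rightarrow> real \<Rightarrow> (real \<Rightarrow> real) \<Rightarrow> real \<Rightarrow>
   (real^2 \<Rightarrow> real^2) \<Rightarrow> (real^2 \<Rightarrow> real^2) \<Rightarrow> (real^2 \<Rightarrow> real) \<Rightarrow>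
   (real \<Rightarrow> real^2 \<Rightarrow> real^2) \<Rightarrow> (real \<Rightarrow> real^2 \<Rightarrow> real^2) \<Rightarrow> (real \<Rightarrow> real^2 \<Rightarrow> real) \<Rightarrow> bool" where
  "semi_strong_solution \<nu> \<eta> \<kappa> g \<alpha> \<zeta> T u0 b0 \<theta>0 u b \<theta> \<longleftrightarrow>
     u0 \<in> V_space \<and> b0 \<in> V_space \<and> \<theta>0 \<in> L2 \<and>
     u \<in> C_time T V_space (sobolev_norm 1) \<inter> L2_time T (sobolev 2 \<inter> V_space) (sobolev_norm 2) \<and>
     b \<in> C_time T V_space (sobolev_norm 1) \<inter> L2_time T (sobolev 2 \<inter> V_space) (sobolev_norm 2) \<and>
     \<theta> \<in> C_time T L2 L2_norm \<inter> L2_time T (sobolev 1) (sobolev_norm 1) \<and>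
     (\<exists>u' b' \<theta>'.
        u' \<in> L2_time T H_space L2_norm \<and> has_time_deriv T H_space L2_norm u u' \<and>
        b' \<in> L2_time T H_space L2_norm \<and> has_time_deriv T H_space L2_norm b b' \<and>
        \<theta>' \<in> L2_time T H_minus1 H_minus1_norm \<and>
        has_time_deriv T H_minus1 H_minus1_norm (\<lambda>t. L2_to_dual (\<theta> t)) \<theta>' \<and>
        (AE t in time_interval T.
          (AE x in torus.
             u' t x + \<nu> *\<^sub>R stokes (u t) x + leray (advect (u t) (u t)) x
               = leray (advect (b t) (b t)) x + g *\<^sub>R leray (\<lambda>y. \<theta> t y *\<^sub>R axis 2 1) x) \<and>
          (AE x in torus.
             b' t x + \<eta> *\<^sub>R stokes (b t) x + leray (advect (u t) (b t)) x
               = leray (advect (b t) (u t)) x) \<and>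
          (\<forall>\<psi>\<in>sobolev 1.
             \<theta>' t \<psi> - \<kappa> * dual_laplacian (\<theta> t) \<psi> + L2_to_dual (advect (u t) (\<theta> t)) \<psi>
               = L2_to_dual (\<lambda>x. \<alpha> * \<eta> * \<zeta> \<bar>curl (b t) x\<bar> * \<bar>curl (b t) x\<bar>) \<psi>))) \<and>
     (AE x in torus. u 0 x = u0 x) \<and> (AE x in torus. b 0 x = b0 x) \<and>
     (AE x in torus. \<theta> 0 x = \<theta>0 x)"

definition strong_solution ::
  "real \<Rightarrow> real \<Rightarrow> real \<Rightarrow> real \<Rightarrow> real \<Rightarrow> (real \<Rightarrow> real) \<Rightarrow> real \<Rightarrow>
   (real^2 \<Rightarrow> real^2) \<Rightarrow> (real^2 \<Rightarrow> real^2) \<Rightarrow> (real^2 \<Rightarrow> real) \<Rightarrow>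
   (real \<Rightarrow> real^2 \<Rightarrow> real^2) \<Rightarrow> (real \<Rightarrow> real^2 \<Rightarrow> real^2) \<Rightarrow> (real \<Rightarrow> real^2 \<Rightarrow> real) \<Rightarrow> bool" where
  "strong_solution \<nu> \<eta> \<kappa> g \<alpha> \<zeta> T u0 b0 \<theta>0 u b \<theta> \<longleftrightarrow>
     u0 \<in> sobolev 2 \<inter> V_space \<and> b0 \<in> sobolev 2 \<inter> V_space \<and> \<theta>0 \<in> sobolev 2 \<and>
     semi_strong_solution \<nu> \<eta> \<kappa> g \<alpha> \<zeta> T u0 b0 \<theta>0 u b \<theta> \<and>
     u \<in> C_time T (sobolev 2 \<inter> V_space) (sobolev_norm 2) \<inter>
         L2_time T (sobolev 3 \<inter> V_space) (sobolev_norm 3) \<and>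
     b \<in> C_time T (sobolev 2 \<inter> V_space) (sobolev_norm 2) \<inter>
         L2_time T (sobolev 3 \<inter> V_space) (sobolev_norm 3) \<and>
     \<theta> \<in> Linf_time T (sobolev 2) (sobolev_norm 2) \<inter> L2_time T (sobolev 3) (sobolev_norm 3)"

end

theory Submission
  imports Defs "HOL-Computational_Algebra.Polynomial"
begin

text \<open>
  The difference of two solutions is tested with itself.  Every term that carries a gradient of the
  difference is bounded by the supremum of a coefficient times the square root of the dissipation
  times the energy, and is absorbed by Young's inequality; the remaining terms are bounded by the
  energy times the square of a supremum of the solutions or of their gradients.  On the
  two-dimensional torus these suprema are controlled by the \<open>H\<^sup>3\<close> norms, whose squares are
  integrable in time, so Gronwall's lemma applies.

  Both the supremum bound and the energy identity come from expansion in the trigonometric Parseval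
  frame \<open>cos (2 \<pi> k \<cdot> x - c) i\<close> with \<open>c \<in> {0, \<pi>/2}\<close> and \<open>i\<close> a basis vector, in which
  weak derivatives act on coefficients by multiplication with frequencies and a shift of the phase \<open>c\<close>.
  The weak time derivative yields the fundamental theorem of calculus for each coefficient; squaring,
  summing over finitely many modes and passing to the limit by dominated convergence gives the
  energy identity, also when the time derivative takes values only in \<open>H\<^sup>-\<^sup>1\<close>.
\<close>

section \<open>Square integrable functions on the torus\<close>

text \<open>Weak derivatives, the Leray projector and the time derivatives are fixed only up to null
  sets or by choice, and are known merely by how they pair with test functions. Frame coefficients
  are such pairings and determine a function almost everywhere, so identities between
  representatives are proved coefficient by coefficient. Cosines with a phase replace complex
  exponentials because weak derivatives are tested with real functions.

  A difference of products is split so that the gradient of the difference meets a bounded field of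
  the first solution, or the difference itself meets a bounded gradient of the second. Gradients of
  all three unknowns therefore need a supremum bound. In dimension two the expansion of a function
  with two more square integrable derivatives converges absolutely, and two derivatives beyond the
  gradient lead to \<open>H\<^sup>3\<close>. The calming function enters through its bound and its
  Lipschitz constant, which make the difference of the heating terms linear in the gradient of the
  magnetic difference.\<close>

lemma space_torus [simp]: "space torus = cbox 0 1"
  by (simp add: torus_def)

lemma torus_sets_borel: "S \<in> sets borel \<Longrightarrow> S \<subseteq> cbox 0 1 \<Longrightarrow> S \<in> sets torus"
  by (simp add: torus_def sets_restrict_space_iff)

lemma measure_torus: "measure torus (cbox 0 1) = 1"
  and emeasure_torus: "emeasure torus (cbox 0 1) = 1"
proof -
  have *: "emeasure lborel (cbox 0 1 :: (real^2) set) = 1"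
    by (subst emeasure_lborel_cbox_eq) (auto simp: Basis_vec_def inner_axis intro!: prod.neutral)
  show "emeasure torus (cbox 0 1) = 1"
    unfolding torus_def by (subst emeasure_restrict_space) (auto simp: *)
  then show "measure torus (cbox 0 1) = 1" by (simp add: measure_def)
qed

interpretation torus: finite_measure torus
  by standard (simp add: emeasure_torus)

lemma integral_torus_const [simp]: "(\<integral>x. (c :: 'a::euclidean_space) \<partial>torus) = c"
  using measure_torus by simp

lemma borel_measurable_torus:
  fixes f :: "real^2 \<Rightarrow> 'a::euclidean_space"
  assumes "f \<in> borel_measurable borel" shows "f \<in> borel_measurable torus"
proof -
  have "f \<in> borel_measurable lebesgue" 
    using assms by (intro measurable_completion) simp
  thus ?thesis unfolding torus_def by (rule measurable_restrict_space1)
qed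

lemma L2D: "f \<in> L2 \<Longrightarrow> f \<in> borel_measurable torus" "f \<in> L2 \<Longrightarrow> integrable torus (\<lambda>x. (norm (f x))\<^sup>2)"
  by (auto simp: L2_def)

lemma bounded_imp_L2:
  assumes "f \<in> borel_measurable torus" "\<And>x. x \<in> cbox 0 1 \<Longrightarrow> norm (f x) \<le> B" shows "f \<in> L2"
proof -
  have "integrable torus (\<lambda>x. (norm (f x))\<^sup>2)"
    using assms by (intro torus.integrable_const_bound[where B="B^2"] AE_I2) (auto simp: power_mono)
  with assms show ?thesis by (simp add: L2_def)
qed

lemma continuous_imp_L2:
  fixes f :: "real^2 \<Rightarrow> 'a::euclidean_space"
  assumes "continuous_on UNIV f" shows "f \<in> L2"
proof -
  have "bounded (f ` cbox 0 1)"
    using assms by (meson compact_cbox compact_continuous_image compact_imp_bounded continuous_on_subset subset_UNIV)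
  then obtain B where "\<And>x. x \<in> cbox 0 1 \<Longrightarrow> norm (f x) \<le> B"
    by (auto simp: bounded_iff)
  thus ?thesis using assms
    by (intro bounded_imp_L2 borel_measurable_torus borel_measurable_continuous_onI) auto
qed

lemma L2_scaleR [simp, intro]: "f \<in> L2 \<Longrightarrow> (\<lambda>x. c *\<^sub>R f x) \<in> L2"
  by (auto simp: L2_def power_mult_distrib)

lemma L2_inner_integrable:
  assumes "f \<in> L2" "h \<in> L2" shows "integrable torus (\<lambda>x. f x \<bullet> h x)"
proof (rule Bochner_Integration.integrable_bound)
  show "integrable torus (\<lambda>x. (norm (f x))\<^sup>2 + (norm (h x))\<^sup>2)"
    using assms by (auto simp: L2_def)
  show "(\<lambda>x. f x \<bullet> h x) \<in> borel_measurable torus" using assms[THEN L2D(1)] by simp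
  have "norm (f x \<bullet> h x) \<le> norm ((norm (f x))\<^sup>2 + (norm (h x))\<^sup>2)" for x
  proof -
    have "norm (f x \<bullet> h x) \<le> norm (f x) * norm (h x)" by (simp add: Cauchy_Schwarz_ineq2)
    also have "\<dots> \<le> (norm (f x))\<^sup>2 + (norm (h x))\<^sup>2"
      using sum_squares_bound[of "norm (f x)" "norm (h x)"]
        mult_nonneg_nonneg[OF norm_ge_zero[of "f x"] norm_ge_zero[of "h x"]] by linarith
    finally show ?thesis by simp
  qed
  thus "AE x in torus. norm (f x \<bullet> h x) \<le> norm ((norm (f x))\<^sup>2 + (norm (h x))\<^sup>2)" by simp
qed

lemma L2_add [simp, intro]:
  assumes "f \<in> L2" "h \<in> L2" shows "(\<lambda>x. f x + h x) \<in> L2"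
proof -
  have "integrable torus (\<lambda>x. (norm (f x))\<^sup>2 + (norm (h x))\<^sup>2 + 2 * (f x \<bullet> h x))"
    using assms[THEN L2D(2)] L2_inner_integrable[OF assms] by simp
  moreover have "(norm (f x + h x))\<^sup>2 = (norm (f x))\<^sup>2 + (norm (h x))\<^sup>2 + 2 * (f x \<bullet> h x)" for x
    by (simp add: power2_norm_eq_inner algebra_simps inner_commute)
  ultimately show ?thesis using assms[THEN L2D(1)] by (simp add: L2_def)
qed

lemma L2_uminus [simp, intro]: "f \<in> L2 \<Longrightarrow> (\<lambda>x. - f x) \<in> L2"
  using L2_scaleR[of f "-1"] by simp

lemma L2_diff [simp, intro]: "f \<in> L2 \<Longrightarrow> h \<in> L2 \<Longrightarrow> (\<lambda>x. f x - h x) \<in> L2"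
  using L2_add[of f "\<lambda>x. - h x"] by simp

lemma L2_const [simp, intro]: "(\<lambda>x. c) \<in> L2"
  by (rule continuous_imp_L2) simp

lemma L2_sum [intro]: "(\<And>i. i \<in> I \<Longrightarrow> f i \<in> L2) \<Longrightarrow> (\<lambda>x. \<Sum>i\<in>I. f i x) \<in> L2"
  by (induction I rule: infinite_finite_induct) auto

lemma L2_inner_add_left: "f \<in> L2 \<Longrightarrow> g \<in> L2 \<Longrightarrow> h \<in> L2 \<Longrightarrow> L2_inner (\<lambda>x. f x + g x) h = L2_inner f h + L2_inner g h"
  by (simp add: L2_inner_def inner_add_left L2_inner_integrable)

lemma L2_inner_diff_left: "f \<in> L2 \<Longrightarrow> g \<in> L2 \<Longrightarrow> h \<in> L2 \<Longrightarrow> L2_inner (\<lambda>x. f x - g x) h = L2_inner f h - L2_inner g h"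
  by (simp add: L2_inner_def inner_diff_left L2_inner_integrable)

lemma L2_inner_commute: "L2_inner f h = L2_inner h f"
  by (simp add: L2_inner_def inner_commute)

lemma L2_inner_scaleR_left: "L2_inner (\<lambda>x. c *\<^sub>R f x) h = c * L2_inner f h"
  by (simp add: L2_inner_def)

lemma L2_inner_minus_left: "L2_inner (\<lambda>x. - f x) h = - L2_inner f h"
  by (simp add: L2_inner_def)

lemma L2_inner_sum_left:
  "(\<And>i. i \<in> I \<Longrightarrow> f i \<in> L2) \<Longrightarrow> h \<in> L2 \<Longrightarrow> L2_inner (\<lambda>x. \<Sum>i\<in>I. f i x) h = (\<Sum>i\<in>I. L2_inner (f i) h)"
  by (simp add: L2_inner_def inner_sum_left L2_inner_integrable)

lemma L2_inner_add_right: "f \<in> L2 \<Longrightarrow> g \<in> L2 \<Longrightarrow> h \<in> L2 \<Longrightarrow> L2_inner h (\<lambda>x. f x + g x) = L2_inner h f + L2_inner h g"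
  using L2_inner_add_left[of f g h] by (simp add: L2_inner_commute[of h])

lemma L2_inner_diff_right: "f \<in> L2 \<Longrightarrow> g \<in> L2 \<Longrightarrow> h \<in> L2 \<Longrightarrow> L2_inner h (\<lambda>x. f x - g x) = L2_inner h f - L2_inner h g"
  using L2_inner_diff_left[of f g h] by (simp add: L2_inner_commute[of h])

lemma L2_inner_scaleR_right: "L2_inner h (\<lambda>x. c *\<^sub>R f x) = c * L2_inner h f"
  by (simp add: L2_inner_commute[of h] L2_inner_scaleR_left)

lemma L2_inner_cong_AE: 
  assumes "AE x in torus. f x = f' x" "AE x in torus. h x = h' x"
    "f \<in> borel_measurable torus" "f' \<in> borel_measurable torus" "h \<in> borel_measurable torus" "h' \<in> borel_measurable torus"
  shows "L2_inner f h = L2_inner f' h'"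
  unfolding L2_inner_def using assms by (intro integral_cong_AE) auto

lemma L2_norm_ge_0 [simp]: "0 \<le> L2_norm f"
  by (simp add: L2_norm_def)

lemma L2_norm_power2: "(L2_norm f)\<^sup>2 = L2_inner f f"
  by (simp add: L2_norm_def L2_inner_def power2_norm_eq_inner)

lemma L2_norm_eq_sqrt: "L2_norm f = sqrt (L2_inner f f)"
  by (simp add: L2_norm_def L2_inner_def power2_norm_eq_inner)

lemma L2_norm_scaleR: "L2_norm (\<lambda>x. c *\<^sub>R f x) = \<bar>c\<bar> * L2_norm f"
  by (simp add: L2_norm_def power_mult_distrib real_sqrt_mult)

lemma L2_norm_minus_commute: "L2_norm (\<lambda>x. f x - g x) = L2_norm (\<lambda>x. g x - f x)"
  by (simp add: L2_norm_def norm_minus_commute)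

lemma L2_norm_cong_AE: 
  assumes "AE x in torus. f x = h x" "f \<in> borel_measurable torus" "h \<in> borel_measurable torus" 
  shows "L2_norm f = L2_norm h"
  using assms by (simp add: L2_norm_eq_sqrt L2_inner_cong_AE[OF assms(1,1)])

lemma L2_norm_add_power2:
  "f \<in> L2 \<Longrightarrow> h \<in> L2 \<Longrightarrow> (L2_norm (\<lambda>x. f x + h x))\<^sup>2 = (L2_norm f)\<^sup>2 + 2 * L2_inner f h + (L2_norm h)\<^sup>2"
  unfolding L2_norm_power2
  by (simp add: L2_inner_add_left L2_inner_add_right L2_inner_commute[of h f])

lemma L2_norm_diff_power2:
  "f \<in> L2 \<Longrightarrow> h \<in> L2 \<Longrightarrow> (L2_norm (\<lambda>x. f x - h x))\<^sup>2 = (L2_norm f)\<^sup>2 - 2 * L2_inner f h + (L2_norm h)\<^sup>2"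
  unfolding L2_norm_power2
  by (simp add: L2_inner_diff_left L2_inner_diff_right L2_inner_commute[of h f])

text \<open>The squared norm of \<open>f + t h\<close> is a nonnegative polynomial of degree at most
  two in \<open>t\<close>. If the leading coefficient \<open>c\<close> vanishes, it is affine, which
  forces \<open>b = 0\<close>; otherwise its minimum gives the discriminant bound.\<close>

lemma L2_Cauchy_Schwarz:
  assumes "f \<in> L2" "h \<in> L2" shows "\<bar>L2_inner f h\<bar> \<le> L2_norm f * L2_norm h"
proof -
  define a b c where "a = (L2_norm f)\<^sup>2" and "b = L2_inner f h" and "c = (L2_norm h)\<^sup>2"
  have *: "0 \<le> a + 2 * t * b + t\<^sup>2 * c" for t
    using L2_norm_add_power2[of f "\<lambda>x. t *\<^sub>R h x"] assms 
      zero_le_power2[of "L2_norm (\<lambda>x. f x + t *\<^sub>R h x)"]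
    by (simp add: a_def b_def c_def L2_inner_scaleR_right L2_norm_scaleR power_mult_distrib algebra_simps)
  have c0: "c \<ge> 0" "a \<ge> 0" by (auto simp: c_def a_def)
  have "b\<^sup>2 \<le> a * c"
  proof (cases "c = 0")
    case True
    have "b = 0"
    proof (rule ccontr)
      assume "b \<noteq> 0"
      \<comment> \<open>At this argument the affine function would take the value
        \<open>-1\<close>.\<close>
      then show False using *[of "- (a + 1) / (2 * b)"] True by (simp add: field_simps)
    qed
    thus ?thesis using True by simp
  next
    case False
    then have "c > 0" using c0 by simp
    then show ?thesis using *[of "- b / c"] by (simp add: field_simps power2_eq_square)
  qed
  then have "\<bar>b\<bar> \<le> sqrt (a * c)" by (metis real_sqrt_abs real_sqrt_le_mono)
  thus ?thesis by (simp add: a_def b_def c_def real_sqrt_mult)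
qed

lemma L2_norm_triangle:
  assumes "f \<in> L2" "h \<in> L2" shows "L2_norm (\<lambda>x. f x + h x) \<le> L2_norm f + L2_norm h"
proof (rule power2_le_imp_le)
  show "(L2_norm (\<lambda>x. f x + h x))\<^sup>2 \<le> (L2_norm f + L2_norm h)\<^sup>2"
    using L2_Cauchy_Schwarz[OF assms] by (simp add: L2_norm_add_power2 assms power2_sum)
qed simp

lemma L2_norm_triangle_diff:
  assumes "f \<in> L2" "g \<in> L2" "h \<in> L2"
  shows "L2_norm (\<lambda>x. f x - h x) \<le> L2_norm (\<lambda>x. f x - g x) + L2_norm (\<lambda>x. g x - h x)"
  using L2_norm_triangle[of "\<lambda>x. f x - g x" "\<lambda>x. g x - h x"] assms by simp

lemma L2_norm_mono:
  assumes "AE x in torus. norm (f x) \<le> norm (h x)" "f \<in> borel_measurable torus" "h \<in> L2"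
  shows "f \<in> L2" "L2_norm f \<le> L2_norm h"
proof -
  have "integrable torus (\<lambda>x. (norm (f x))\<^sup>2)"
    by (rule Bochner_Integration.integrable_bound[OF L2D(2)[OF assms(3)]]) (use assms in \<open>auto simp: power_mono\<close>)
  then show f: "f \<in> L2" using assms by (simp add: L2_def)
  show "L2_norm f \<le> L2_norm h" unfolding L2_norm_def
    by (rule real_sqrt_le_mono, rule integral_mono_AE)
      (use assms f[THEN L2D(2)] L2D(2) in \<open>auto simp: power_mono\<close>)
qed

lemma L2_norm_eq_0:
  assumes "f \<in> L2" "L2_norm f = 0" shows "AE x in torus. f x = 0"
  using assms integral_nonneg_eq_0_iff_AE[OF L2D(2)[OF assms(1)]] by (simp add: L2_norm_def)

text \<open>Cauchy--Schwarz against the constant \<open>1\<close>, which has norm one since the cell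
  has measure one.\<close>

lemma integral_norm_le_L2_norm:
  assumes "f \<in> L2" shows "integrable torus f" "integrable torus (\<lambda>x. norm (f x))" "(\<integral>x. norm (f x) \<partial>torus) \<le> L2_norm f"
proof -
  let ?n = "\<lambda>x. norm (f x)" and ?o = "\<lambda>x::real^2. 1::real"
  have n: "?n \<in> L2" using assms by (auto simp: L2_def)
  show i: "integrable torus ?n" using L2_inner_integrable[OF n, of ?o] by simp
  then show "integrable torus f" using L2D(1)[OF assms] integrable_norm_cancel by blast
  have "\<bar>L2_inner ?n ?o\<bar> \<le> L2_norm ?n * L2_norm ?o"
    by (rule L2_Cauchy_Schwarz[OF n]) simp
  also have "\<dots> = L2_norm f" by (simp add: L2_norm_def measure_torus)
  finally show "(\<integral>x. ?n x \<partial>torus) \<le> L2_norm f" by (simp add: L2_inner_def)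
qed

text \<open>Riesz--Fischer. The L2 norm dominates the L1 norm here, so a subsequence is Cauchy
  almost everywhere and \<open>f\<close> is its pointwise limit. Fatou's lemma along the subsequence
  passes the bound on \<open>s n - s i\<close> to \<open>s n - f\<close>, for every large
  \<open>n\<close> and not only for indices of the subsequence.\<close>

lemma L2_complete:
  fixes s :: "nat \<Rightarrow> real^2 \<Rightarrow> 'a::euclidean_space"
  assumes s: "\<And>n. s n \<in> L2"
    and Cau: "\<And>e. e > 0 \<Longrightarrow> \<exists>N. \<forall>i\<ge>N. \<forall>j\<ge>N. L2_norm (\<lambda>x. s i x - s j x) < e"
  obtains f where "f \<in> L2" "(\<lambda>n. L2_norm (\<lambda>x. s n x - f x)) \<longlonglongrightarrow> 0"
proof -
  have "\<exists>N. \<forall>i\<ge>N. \<forall>j\<ge>N. (LINT x|torus. norm (s i x - s j x)) < e" if "e > 0" for e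
    using Cau[OF that] integral_norm_le_L2_norm(3)[OF L2_diff[OF s s]] by (meson le_less_trans)
  then obtain r where r: "strict_mono r" and AEr: "AE x in torus. Cauchy (\<lambda>i. s (r i) x)"
    using cauchy_L1_AE_cauchy_subseq[of torus s] integral_norm_le_L2_norm(1)[OF s] by blast
  define f where "f x = lim (\<lambda>i. s (r i) x)" for x
  have fm: "f \<in> borel_measurable torus"
    unfolding f_def using L2D(1)[OF s] by measurable
  have conv: "AE x in torus. (\<lambda>i. s (r i) x) \<longlonglongrightarrow> f x"
    using AEr by eventually_elim (simp add: f_def Cauchy_convergent convergent_LIMSEQ_iff[symmetric])
  have key: "integrable torus (\<lambda>x. (norm (s n x - f x))\<^sup>2) \<and> L2_norm (\<lambda>x. s n x - f x) \<le> e"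
    if "e > 0" and N: "\<And>i. i \<ge> N \<Longrightarrow> L2_norm (\<lambda>x. s n x - s i x) < e" for e n N
  proof -
    have "(\<integral>\<^sup>+x. ennreal ((norm (s n x - f x))\<^sup>2) \<partial>torus)
        = (\<integral>\<^sup>+x. liminf (\<lambda>i. ennreal ((norm (s n x - s (r i) x))\<^sup>2)) \<partial>torus)"
    proof (rule nn_integral_cong_AE, use conv in eventually_elim)
      fix x assume "(\<lambda>i. s (r i) x) \<longlonglongrightarrow> f x"
      then have "(\<lambda>i. ennreal ((norm (s n x - s (r i) x))\<^sup>2)) \<longlonglongrightarrow> ennreal ((norm (s n x - f x))\<^sup>2)"
        by (intro tendsto_intros tendsto_ennrealI)
      then show "ennreal ((norm (s n x - f x))\<^sup>2) = liminf (\<lambda>i. ennreal ((norm (s n x - s (r i) x))\<^sup>2))"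
        by (intro lim_imp_Liminf[symmetric]) auto
    qed
    also have "\<dots> \<le> liminf (\<lambda>i. \<integral>\<^sup>+x. ennreal ((norm (s n x - s (r i) x))\<^sup>2) \<partial>torus)"
      using L2D(1)[OF s] by (intro nn_integral_liminf) simp
    also have "\<dots> \<le> ennreal (e\<^sup>2)"
    proof (rule Liminf_le)
      show "\<forall>\<^sub>F i in sequentially. (\<integral>\<^sup>+x. ennreal ((norm (s n x - s (r i) x))\<^sup>2) \<partial>torus) \<le> ennreal (e\<^sup>2)"
      proof (rule eventually_sequentiallyI[of N])
        fix i assume "i \<ge> N"
        then have "r i \<ge> N" using seq_suble[OF r, of i] by linarith
        then have "(L2_norm (\<lambda>x. s n x - s (r i) x))\<^sup>2 \<le> e\<^sup>2" by (intro power_mono) (auto dest: N)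
        then show "(\<integral>\<^sup>+x. ennreal ((norm (s n x - s (r i) x))\<^sup>2) \<partial>torus) \<le> ennreal (e\<^sup>2)"
          by (subst nn_integral_eq_integral) (use L2D(2)[OF L2_diff[OF s s]] in \<open>auto simp: L2_norm_def\<close>)
      qed
    qed simp
    finally have le: "(\<integral>\<^sup>+x. ennreal ((norm (s n x - f x))\<^sup>2) \<partial>torus) \<le> ennreal (e\<^sup>2)" .
    have i: "integrable torus (\<lambda>x. (norm (s n x - f x))\<^sup>2)"
      using le fm L2D(1)[OF s] by (intro integrableI_bounded) (auto simp: le_less_trans)
    then have "(\<integral>x. (norm (s n x - f x))\<^sup>2 \<partial>torus) \<le> e\<^sup>2"
      using le by (subst (asm) nn_integral_eq_integral) (auto simp: integral_nonneg_AE)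
    then have "L2_norm (\<lambda>x. s n x - f x) \<le> e"
      unfolding L2_norm_def using \<open>e > 0\<close> real_le_lsqrt by (simp add: real_sqrt_le_iff' )
    with i show ?thesis by simp
  qed
  have f: "f \<in> L2"
  proof -
    obtain N where N: "\<forall>i\<ge>N. \<forall>j\<ge>N. L2_norm (\<lambda>x. s i x - s j x) < 1" using Cau[of 1] by auto
    have "(\<lambda>x. s N x - f x) \<in> L2" using key[of 1 N N] N fm L2D(1)[OF s] by (auto simp: L2_def)
    from L2_diff[OF s[of N] this] show ?thesis by simp
  qed
  moreover have "(\<lambda>n. L2_norm (\<lambda>x. s n x - f x)) \<longlonglongrightarrow> 0"
  proof (rule LIMSEQ_I)
    fix e :: real assume "e > 0"
    then obtain N where N: "\<forall>i\<ge>N. \<forall>j\<ge>N. L2_norm (\<lambda>x. s i x - s j x) < e/2" using Cau[of "e/2"] by auto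
    have "L2_norm (\<lambda>x. s n x - f x) \<le> e/2" if "n \<ge> N" for n
      using key[of "e/2" N n] N that \<open>e > 0\<close> by auto
    then show "\<exists>no. \<forall>n\<ge>no. norm (L2_norm (\<lambda>x. s n x - f x) - 0) < e"
      using \<open>e > 0\<close> by (intro exI[of _ N]) force
  qed
  ultimately show ?thesis using that by blast
qed

section \<open>Integration of partial derivatives over the torus\<close>

text \<open>The second component runs along \<open>axis i\<close>, the direction of differentiation,
  so that it is the inner variable of the iterated integral.\<close>

definition plane :: "2 \<Rightarrow> 2 \<Rightarrow> real \<times> real \<Rightarrow> real^2" where
  "plane i j p = fst p *\<^sub>R axis j 1 + snd p *\<^sub>R axis i 1"

lemma plane_nth: "i \<noteq> j \<Longrightarrow> plane i j p $ i = snd p" "i \<noteq> j \<Longrightarrow> plane i j p $ j = fst p"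
  by (auto simp: plane_def axis_def)

lemma two_cases: "i \<noteq> j \<Longrightarrow> P i \<Longrightarrow> P j \<Longrightarrow> P (k :: 2)"
  using exhaust_2[of i] exhaust_2[of j] exhaust_2[of k] by auto

lemma all_two: "i \<noteq> j \<Longrightarrow> (\<forall>k::2. P k) \<longleftrightarrow> P i \<and> P j"
  using two_cases[of i j P] by blast

lemma plane_bounded_linear: "bounded_linear (plane i j)"
  unfolding plane_def by (intro bounded_linear_intros)

lemma plane_continuous: "continuous_on S (plane i j)"
  using plane_bounded_linear linear_continuous_on by blast

text \<open>Lebesgue measure is determined by its values on boxes, and the preimage of a box is a
  box with the same side lengths. Either coordinate can thus be made the inner one.\<close>

lemma lborel_plane:
  assumes "i \<noteq> j" shows "lborel = distr lborel borel (plane i j)"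
proof (rule lborel_eqI)
  have m: "plane i j \<in> borel_measurable borel"
    by (rule borel_measurable_continuous_onI, rule plane_continuous)
  have U: "UNIV = {i, j}" using two_cases[OF assms, of "\<lambda>k. k \<in> {i, j}"] by auto
  have B: "(Basis :: (real^2) set) = {axis i 1, axis j 1}" "axis i (1::real) \<noteq> axis j 1"
    using assms by (auto simp: Basis_vec_def U axis_eq_axis)
  fix l u :: "real^2" assume le: "\<And>b. b \<in> Basis \<Longrightarrow> l \<bullet> b \<le> u \<bullet> b"
  have "plane i j -` box l u = box (l $ j, l $ i) (u $ j, u $ i)"
    using assms by (auto simp: mem_box_cart plane_nth all_two[OF assms] mem_box Basis_prod_def)
  then have "emeasure (distr lborel borel (plane i j)) (box l u) = emeasure lborel (box (l $ j, l $ i) (u $ j, u $ i))"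
    using m by (subst emeasure_distr) auto
  also have "\<dots> = ennreal ((u $ j - l $ j) * (u $ i - l $ i))"
    using le[of "axis i 1"] le[of "axis j 1"] B
    by (subst emeasure_lborel_box_eq) (auto simp: Basis_prod_def inner_axis)
  also have "\<dots> = ennreal (\<Prod>b\<in>Basis. (u - l) \<bullet> b)"
    unfolding B(1) using B(2) by (simp add: inner_axis mult.commute)
  finally show "emeasure (distr lborel borel (plane i j)) (box l u) = ennreal (\<Prod>b\<in>Basis. (u - l) \<bullet> b)" .
qed simp

text \<open>The chain passes from \<open>lebesgue\<close> to \<open>lborel\<close>, by
  \<open>plane\<close> to the product of two lines, and finally to the gauge integral, where
  iterated integrals of continuous functions and the fundamental theorem of calculus are at
  hand.\<close>

lemma integral_torus_plane:
  fixes G :: "real^2 \<Rightarrow> real"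
  assumes "i \<noteq> j" and G: "continuous_on UNIV G"
  shows "(\<integral>x. G x \<partial>torus) = integral {0..1} (\<lambda>t. integral {0..1} (\<lambda>s. G (plane i j (t, s))))"
proof -
  have ind: "indicator (cbox 0 1) (plane i j p) = (indicator (cbox (0,0) (1,1)) p :: real)" for p
    using assms(1) by (cases p) (auto simp: indicator_def mem_box_cart plane_nth cbox_Pair_eq all_two[OF assms(1)])
  have Gm: "G \<in> borel_measurable borel" using G by (rule borel_measurable_continuous_onI)
  have cont: "continuous_on S (\<lambda>p. G (plane i j p))" for S
    using continuous_on_compose2[OF G plane_continuous] by auto
  have int: "integrable lborel (\<lambda>p. indicator (cbox (0,0) (1,1)) p *\<^sub>R G (plane i j p))"
    by (rule borel_integrable_compact) (auto intro: cont)
  have "(\<integral>x. G x \<partial>torus) = (\<integral>x. indicator (cbox 0 1) x *\<^sub>R G x \<partial>lebesgue)"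
    unfolding torus_def by (subst integral_restrict_space) auto
  also have "\<dots> = (\<integral>x. indicator (cbox 0 1) x *\<^sub>R G x \<partial>lborel)"
    using Gm by (intro integral_completion) simp
  also have "\<dots> = (\<integral>p. indicator (cbox (0,0) (1,1)) p *\<^sub>R G (plane i j p) \<partial>lborel)"
    using Gm by (subst lborel_plane[OF assms(1)], subst integral_distr)
      (auto simp: ind intro!: borel_measurable_continuous_onI plane_continuous)
  also have "\<dots> = integral (cbox (0,0) (1,1)) (\<lambda>p. G (plane i j p))"
    using set_borel_integral_eq_integral(2)[of "cbox (0,0) (1,1)" "\<lambda>p. G (plane i j p)"] int
    by (simp add: set_lebesgue_integral_def set_integrable_def)
  also have "\<dots> = integral {0..1} (\<lambda>t. integral {0..1} (\<lambda>s. G (plane i j (t, s))))"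
    by (subst integral_prod_continuous[OF cont]) simp
  finally show ?thesis .
qed

text \<open>On every line in direction \<open>i\<close> the derivative integrates to the difference
  of the values on two opposite faces, which periodicity makes zero. The orthogonality of the waves
  and their integration by parts rest on this.\<close>

lemma integral_torus_dir_deriv:
  fixes F :: "real^2 \<Rightarrow> real"
  assumes F: "\<And>x. F differentiable (at x)" and per: "periodic F"
    and cont: "continuous_on UNIV (dir_deriv (axis i 1) F)"
  shows "(\<integral>x. dir_deriv (axis i 1) F x \<partial>torus) = 0"
proof -
  obtain j where ij: "i \<noteq> j" using exhaust_2[of i] by (metis zero_neq_one)
  have "integral {0..1} (\<lambda>s. dir_deriv (axis i 1) F (plane i j (t, s))) = 0" for t
  proof -
    have "((\<lambda>s. F (plane i j (t, s))) has_vector_derivative dir_deriv (axis i 1) F (plane i j (t, s))) (at s within {0..1})" for s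
    proof -
      have 1: "(F has_derivative frechet_derivative F (at x)) (at x)" for x
        using F frechet_derivative_works by blast
      then have lin: "linear (frechet_derivative F (at x))" for x using has_derivative_linear by blast
      have line: "((\<lambda>s. plane i j (t, s)) has_derivative (\<lambda>h. h *\<^sub>R axis i 1)) (at s within {0..1})"
        unfolding plane_def by (auto intro!: derivative_eq_intros)
      have "((\<lambda>s. F (plane i j (t, s))) has_derivative (\<lambda>h. frechet_derivative F (at (plane i j (t, s))) (h *\<^sub>R axis i 1))) (at s within {0..1})"
        by (rule has_derivative_compose[OF line 1])
      then show ?thesis
        by (simp add: has_vector_derivative_def dir_deriv_def plane_def linear_scale[OF lin])
    qed
    then have "((\<lambda>s. dir_deriv (axis i 1) F (plane i j (t, s))) has_integral F (plane i j (t, 1)) - F (plane i j (t, 0))) {0..1}"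
      by (intro fundamental_theorem_of_calculus) auto
    moreover have "plane i j (t, 1) = plane i j (t, 0) + axis i 1" by (simp add: plane_def)
    ultimately show ?thesis using per by (simp add: periodic_def integral_unique)
  qed
  then show ?thesis by (simp add: integral_torus_plane[OF ij cont])
qed

section \<open>A trigonometric Parseval frame\<close>

definition freq :: "int \<times> int \<Rightarrow> 2 \<Rightarrow> real" where
  "freq k i = 2 * pi * of_int (if i = 1 then fst k else snd k)"

text \<open>Phase \<open>0\<close> is the cosine and phase \<open>pi/2\<close> the sine. A
  derivative lowers the phase by \<open>pi/2\<close>, so one formula serves for both.\<close>

definition wave :: "int \<times> int \<Rightarrow> real \<Rightarrow> real^2 \<Rightarrow> real" where
  "wave k c x = cos (freq k 1 * x $ 1 + freq k 2 * x $ 2 - c)"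

lemma freq_add: "freq (k + l) i = freq k i + freq l i" and freq_diff: "freq (k - l) i = freq k i - freq l i"
  and freq_uminus: "freq (- k) i = - freq k i"
  by (simp_all add: freq_def distrib_left right_diff_distrib)

lemma freq_eq_0: "freq k 1 = 0 \<Longrightarrow> freq k 2 = 0 \<Longrightarrow> k = 0"
  by (cases k) (auto simp: freq_def zero_prod_def)

lemma freq_0 [simp]: "freq 0 i = 0"
  by (simp add: freq_def)

lemma abs_wave_le_1: "\<bar>wave k c x\<bar> \<le> 1"
  by (simp add: wave_def)

lemma wave_uminus: "wave (- k) c = wave k (- c)"
proof
  fix x :: "real^2"
  have "cos (- freq k 1 * x $ 1 + - freq k 2 * x $ 2 - c) = cos (- (freq k 1 * x $ 1 + freq k 2 * x $ 2 - - c))"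
    by (intro arg_cong[of _ _ cos]) simp
  also have "\<dots> = cos (freq k 1 * x $ 1 + freq k 2 * x $ 2 - - c)" by (rule cos_minus)
  finally show "wave (- k) c x = wave k (- c) x" by (simp add: wave_def freq_uminus)
qed

lemma wave_decompose: "wave k c x = cos c * wave k 0 x + sin c * wave k (pi/2) x"
  by (simp add: wave_def cos_diff)

lemma wave_add_pi: "wave k (c + pi) x = - wave k c x" "wave k (c - pi) x = - wave k c x"
  by (simp_all add: wave_def cos_diff sin_diff cos_add sin_add algebra_simps)

lemma wave_times: "wave k c x * wave l d x = (wave (k + l) (c + d) x + wave (k - l) (c - d) x) / 2"
proof -
  define A B where "A = freq k 1 * x $ 1 + freq k 2 * x $ 2 - c" and "B = freq l 1 * x $ 1 + freq l 2 * x $ 2 - d"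
  have "wave (k + l) (c + d) x = cos (A + B)" "wave (k - l) (c - d) x = cos (A - B)"
    by (simp_all add: wave_def A_def B_def freq_add freq_diff algebra_simps)
  then show ?thesis unfolding A_def[symmetric] B_def[symmetric] by (simp add: wave_def A_def[symmetric] B_def[symmetric] cos_times_cos)
qed

lemma wave_has_derivative:
  "(wave k c has_derivative (\<lambda>h. (freq k 1 * h $ 1 + freq k 2 * h $ 2) * wave k (c - pi/2) x)) (at x)"
proof -
  have s: "- sin (t - c) = cos (t - (c - pi/2))" for t
    by (simp add: cos_diff sin_diff)
  show ?thesis unfolding wave_def s[symmetric]
    by (auto intro!: derivative_eq_intros bounded_linear_vec_nth[THEN bounded_linear.has_derivative] simp: fun_eq_iff algebra_simps)
qed

lemma wave_differentiable: "wave k c differentiable (at x)"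
  using wave_has_derivative differentiable_def by blast

lemma wave_continuous: "continuous_on S (wave k c)"
  unfolding wave_def by (intro continuous_intros)

lemma dir_deriv_wave: "dir_deriv (axis i 1) (wave k c) = (\<lambda>x. freq k i * wave k (c - pi/2) x)"
  using exhaust_2[of i] by (auto simp: dir_deriv_def fun_eq_iff frechet_derivative_at[OF wave_has_derivative, symmetric] axis_def)

lemma dir_deriv_cmult_wave: "dir_deriv (axis i 1) (\<lambda>x. a * wave k c x) = (\<lambda>x. a * freq k i * wave k (c - pi/2) x)"
proof -
  have "((\<lambda>x. a * wave k c x) has_derivative (\<lambda>h. a * ((freq k 1 * h $ 1 + freq k 2 * h $ 2) * wave k (c - pi/2) x))) (at x)" for x
    by (intro derivative_intros wave_has_derivative)
  note * = frechet_derivative_at[OF this, symmetric]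
  show ?thesis
    using exhaust_2[of i] by (auto simp: dir_deriv_def fun_eq_iff axis_def *)
qed

lemma wave_periodic: "periodic (wave k c)"
proof -
  have "wave k c (x + axis i 1) = wave k c x" for x i
  proof -
    have "cos (y + 2 * pi * of_int m) = cos y" for y m
      by (simp only: cos_add cos_int_2pin sin_int_2pin mult_1_right mult_zero_right diff_zero)
    from this[of "freq k 1 * x $ 1 + freq k 2 * x $ 2 - c"] exhaust_2[of i] show ?thesis
      by (auto simp: wave_def axis_def freq_def algebra_simps)
  qed
  then show ?thesis by (simp add: periodic_def)
qed

lemma smooth_wave: "smooth (wave k c)"
proof -
  have "\<exists>a d. foldr dir_deriv vs (wave k c) = (\<lambda>x. a * wave k d x)" if "set vs \<subseteq> (Basis :: (real^2) set)" for vs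
    using that
  proof (induction vs)
    case Nil
    show ?case by (intro exI[of _ 1] exI[of _ c]) simp
  next
    case (Cons v vs)
    then obtain a d where eq: "foldr dir_deriv vs (wave k c) = (\<lambda>x. a * wave k d x)" by auto
    obtain i where "v = axis i 1" using Cons.prems by (auto simp: Basis_vec_def)
    then show ?case by (simp add: eq dir_deriv_cmult_wave) (intro exI[of _ "a * freq k i"] exI[of _ "d - pi/2"] refl)
  qed
  moreover have "(\<lambda>x. a * wave k d x) differentiable_on UNIV" for a d
    by (auto simp: differentiable_on_def intro!: differentiable_mult wave_differentiable)
  ultimately show ?thesis unfolding smooth_def by metis
qed

lemma integral_wave: "(\<integral>x. wave k c x \<partial>torus) = (if k = 0 then cos c else 0)"
proof (cases "k = 0")
  case True
  then show ?thesis by (simp add: wave_def measure_torus)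
next
  case False
  then obtain i where i: "freq k i \<noteq> 0" using freq_eq_0 by blast
  \<comment> \<open>Differentiation lowers the phase by \<open>pi/2\<close>; starting at
    \<open>c + pi/2\<close> exhibits the wave of phase \<open>c\<close> as a derivative divided by a
    nonzero frequency.\<close>
  have "(\<integral>x. dir_deriv (axis i 1) (wave k (c + pi/2)) x \<partial>torus) = 0"
    by (rule integral_torus_dir_deriv)
      (auto simp: wave_differentiable wave_periodic dir_deriv_wave intro!: continuous_intros wave_continuous)
  then show ?thesis using i False by (simp add: dir_deriv_wave)
qed

lemma integrable_wave [simp]: "integrable torus (wave k c)"
  using integral_norm_le_L2_norm(1)[OF continuous_imp_L2[OF wave_continuous]] .

text \<open>The product formula has one wave of frequency \<open>k + l\<close> and one of frequency
  \<open>k - l\<close>. The two cases stay separate summands because both hold when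
  \<open>k = l = 0\<close>.\<close>

lemma integral_wave_times: 
  "(\<integral>x. wave k c x * wave l d x \<partial>torus) = ((if k = - l then cos (c + d) else 0) + (if k = l then cos (c - d) else 0)) / 2"
  by (simp add: wave_times integral_wave eq_neg_iff_add_eq_0)

text \<open>
  The index \<open>(k, c, i)\<close> consists of a frequency, a phase and a direction.  Both \<open>k\<close> and \<open>-k\<close> occur,
  so the modes are redundant and have norm less than one: they form a Parseval frame, not a basis.
\<close>

type_synonym 'a mode = "(int \<times> int) \<times> real \<times> 'a"

definition mode_fun :: "'a::euclidean_space mode \<Rightarrow> real^2 \<Rightarrow> 'a" where
  "mode_fun j = (\<lambda>x. wave (fst j) (fst (snd j)) x *\<^sub>R snd (snd j))"

text \<open>A square symmetric about the origin: it must contain \<open>- k\<close> along with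
  \<open>k\<close>, since the two frequencies share the weight of one mode.\<close>

definition freqs :: "nat \<Rightarrow> (int \<times> int) set" where
  "freqs n = {- int n..int n} \<times> {- int n..int n}"

definition modes :: "nat \<Rightarrow> 'a::euclidean_space mode set" where
  "modes n = freqs n \<times> {0, pi/2} \<times> Basis"

definition coef :: "(real^2 \<Rightarrow> 'a::euclidean_space) \<Rightarrow> 'a mode \<Rightarrow> real" where
  "coef f j = L2_inner f (mode_fun j)"

text \<open>Redundant as the modes are, this is the orthogonal projection onto their span: by
  \<open>coef_proj\<close> it has the coefficients of \<open>f\<close> on
  \<open>modes n\<close>.\<close>

definition proj :: "nat \<Rightarrow> (real^2 \<Rightarrow> 'a::euclidean_space) \<Rightarrow> real^2 \<Rightarrow> 'a" where
  "proj n f = (\<lambda>x. \<Sum>j\<in>modes n. coef f j *\<^sub>R mode_fun j x)"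

lemma finite_freqs [simp]: "finite (freqs n)" and finite_modes [simp]: "finite (modes n)"
  by (simp_all add: modes_def freqs_def)

lemma freqs_uminus: "- k \<in> freqs n \<longleftrightarrow> k \<in> freqs n"
  by (cases k) (auto simp: freqs_def)

lemma modes_mono: "m \<le> n \<Longrightarrow> modes m \<subseteq> modes n"
  by (auto simp: modes_def freqs_def)

lemma modes_exhaust: "c \<in> {0, pi/2} \<Longrightarrow> i \<in> Basis \<Longrightarrow> \<exists>n. (k, c, i) \<in> modes n"
  by (intro exI[of _ "nat (max \<bar>fst k\<bar> \<bar>snd k\<bar>)"], cases k) (auto simp: modes_def freqs_def)

lemma mode_fun_continuous: "continuous_on S (mode_fun j)"
  unfolding mode_fun_def by (intro continuous_intros wave_continuous)

lemma mode_fun_L2 [simp]: "mode_fun j \<in> L2"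
  by (rule continuous_imp_L2, rule mode_fun_continuous)

lemma proj_L2 [simp]: "proj n f \<in> L2"
  unfolding proj_def by auto

lemma mode_fun_inner:
  "L2_inner (mode_fun (k, c, i)) (mode_fun (l, d, b))
     = (i \<bullet> b) * (((if k = - l then cos (c + d) else 0) + (if k = l then cos (c - d) else 0)) / 2)"
proof -
  have "L2_inner (mode_fun (k, c, i)) (mode_fun (l, d, b)) = (\<integral>x. (i \<bullet> b) * (wave k c x * wave l d x) \<partial>torus)"
    by (simp add: L2_inner_def mode_fun_def algebra_simps)
  then show ?thesis by (simp add: integral_wave_times)
qed

lemma coef_uminus_0: "coef f (- l, 0, b) = coef f (l, 0, b)"
  and coef_uminus_pi2: "coef f (- l, pi/2, b) = - coef f (l, pi/2, b)"
  using wave_add_pi(2)[of l "pi/2"]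
  by (auto simp: coef_def mode_fun_def wave_uminus L2_inner_def)

text \<open>A mode of frequency \<open>l\<close> pairs with the modes at \<open>l\<close> and at
  \<open>- l\<close> of the same phase and direction with weight one half each, up to a sign, and
  different phases are orthogonal. The sign is that of \<open>coef f (- l, d, b)\<close> relative to
  \<open>coef f (l, d, b)\<close>, so the two halves add up to one full coefficient.\<close>

lemma coef_proj:
  assumes "d \<in> {0, pi/2}" "b \<in> Basis"
  shows "coef (proj n f) (l, d, b) = (if (l, d, b) \<in> modes n then coef f (l, d, b) else 0)"
proof -
  let ?E = "\<lambda>k c. ((if k = - l then cos (c + d) else 0) + (if k = l then cos (c - d) else 0)) / 2"
  have ne: "pi \<noteq> 0" by simp
  have "coef (proj n f) (l, d, b) = (\<Sum>j\<in>modes n. coef f j * L2_inner (mode_fun j) (mode_fun (l, d, b)))"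
    by (simp add: coef_def proj_def L2_inner_sum_left L2_inner_scaleR_left)
  also have "\<dots> = (\<Sum>k\<in>freqs n. \<Sum>c\<in>{0,pi/2}. \<Sum>i\<in>Basis. coef f (k, c, i) * ((i \<bullet> b) * ?E k c))"
    unfolding modes_def by (subst sum.cartesian_product)+ (auto intro!: sum.cong simp: mode_fun_inner)
  also have "\<dots> = (\<Sum>k\<in>freqs n. \<Sum>c\<in>{0,pi/2}. coef f (k, c, b) * ?E k c)"
  proof (intro sum.cong refl)
    fix k c
    have "(\<Sum>i\<in>Basis. coef f (k, c, i) * ((i \<bullet> b) * ?E k c)) = (\<Sum>i\<in>Basis. if i = b then coef f (k, c, i) * ?E k c else 0)"
      using assms by (intro sum.cong refl) (auto simp: inner_Basis)
    then show "(\<Sum>i\<in>Basis. coef f (k, c, i) * ((i \<bullet> b) * ?E k c)) = coef f (k, c, b) * ?E k c"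
      using assms by (simp add: sum.delta)
  qed
  also have "\<dots> = (\<Sum>k\<in>freqs n. (if k = - l then (coef f (k, 0, b) * cos d + coef f (k, pi/2, b) * cos (pi/2 + d)) / 2 else 0)
      + (if k = l then (coef f (k, 0, b) * cos (- d) + coef f (k, pi/2, b) * cos (pi/2 - d)) / 2 else 0))"
    by (intro sum.cong refl) (auto simp: field_simps)
  also have "\<dots> = (if l \<in> freqs n then coef f (l, d, b) else 0)"
  proof -
    consider "d = 0" | "d = pi/2" using assms by auto
    then show ?thesis
    proof cases
      case 1
      show ?thesis unfolding 1 by (simp add: sum.distrib sum.delta freqs_uminus coef_uminus_0)
    next
      case 2
      show ?thesis unfolding 2 by (simp add: sum.distrib sum.delta freqs_uminus coef_uminus_pi2)
    qed
  qed
  finally show ?thesis using assms by (auto simp: modes_def)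
qed

lemma coef_proj_mode:
  assumes "j \<in> modes m" shows "coef (proj n f) j = (if j \<in> modes n then coef f j else 0)"
proof -
  obtain l d b where "j = (l, d, b)" by (cases j)
  with assms show ?thesis using coef_proj[of d b n f l] by (simp add: modes_def)
qed

lemma proj_inner: "h \<in> L2 \<Longrightarrow> L2_inner (proj n f) h = (\<Sum>j\<in>modes n. coef f j * coef h j)"
  by (simp add: proj_def coef_def L2_inner_sum_left L2_inner_scaleR_left L2_inner_commute[of h])

lemma proj_norm: "(L2_norm (proj n f))\<^sup>2 = (\<Sum>j\<in>modes n. (coef f j)\<^sup>2)"
  unfolding L2_norm_power2 proj_inner[OF proj_L2] by (auto intro!: sum.cong simp: power2_eq_square coef_proj_mode)

lemma Bessel: assumes "f \<in> L2" shows "(\<Sum>j\<in>modes n. (coef f j)\<^sup>2) \<le> (L2_norm f)\<^sup>2"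
proof -
  have "0 \<le> (L2_norm (\<lambda>x. proj n f x - f x))\<^sup>2" by simp
  also have "\<dots> = (L2_norm f)\<^sup>2 - (\<Sum>j\<in>modes n. (coef f j)\<^sup>2)"
    using assms by (simp add: L2_norm_diff_power2 proj_norm proj_inner flip: power2_eq_square)
  finally show ?thesis by simp
qed

lemma proj_norm_le: "f \<in> L2 \<Longrightarrow> L2_norm (proj n f) \<le> L2_norm f"
  using Bessel[of f n] by (auto simp: proj_norm[symmetric] intro: power2_le_imp_le)

section \<open>Completeness of the trigonometric system\<close>

inductive_set trigs :: "(real^2 \<Rightarrow> real) set" where
  wave: "(\<lambda>x. a * wave k c x) \<in> trigs"
| add: "p \<in> trigs \<Longrightarrow> q \<in> trigs \<Longrightarrow> (\<lambda>x. p x + q x) \<in> trigs"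

text \<open>The product formula produces sums and differences of phases, which is why
  \<open>trigs\<close> admits every real phase rather than the two of the frame.\<close>

lemma trigs_mult: assumes "p \<in> trigs" "q \<in> trigs" shows "(\<lambda>x. p x * q x) \<in> trigs"
  using assms
proof (induction arbitrary: q)
  case (wave a k c)
  from wave.prems show ?case
  proof induction
    case (wave a' l d)
    have "(\<lambda>x. (a * a'/2) * wave (k + l) (c + d) x + (a * a'/2) * wave (k - l) (c - d) x) \<in> trigs"
      by (intro trigs.intros)
    moreover have "a * wave k c x * (a' * wave l d x) = (a * a'/2) * wave (k + l) (c + d) x + (a * a'/2) * wave (k - l) (c - d) x" for x
      using wave_times[of k c x l d] by (simp add: field_simps)
    ultimately show ?case by simp
  qed (auto simp: algebra_simps intro!: trigs.add)
qed (auto simp: algebra_simps intro!: trigs.add)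

lemma trigs_const: "(\<lambda>x. c) \<in> trigs"
  using trigs.wave[of c 0 0] by (simp add: wave_def)

lemma trigs_continuous: "p \<in> trigs \<Longrightarrow> continuous_on S p"
  by (induction rule: trigs.induct) (auto intro!: continuous_intros wave_continuous)

text \<open>
  This map embeds the open unit cell into a product of circles, on which polynomials are dense by
  Stone--Weierstrass; their pullbacks are trigonometric sums.
\<close>

definition circles :: "real^2 \<Rightarrow> complex \<times> complex" where
  "circles x = (cis (2 * pi * x $ 1), cis (2 * pi * x $ 2))"

lemma circles_continuous: "continuous_on S circles"
  unfolding circles_def by (intro continuous_intros)

lemma trigs_polynomial: "real_polynomial_function p \<Longrightarrow> (\<lambda>x. p (circles x)) \<in> trigs"
proof (induction rule: real_polynomial_function.induct)
  case (linear f)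
  interpret f: bounded_linear f by fact
  \<comment> \<open>\<open>f\<close> is only real linear, so it is determined by its values at four
    vectors: \<open>1\<close> and the imaginary unit in either component.\<close>
  have "f (circles x) = f (1, 0) * wave (1, 0) 0 x + f (\<i>, 0) * wave (1, 0) (pi/2) x
      + (f (0, 1) * wave (0, 1) 0 x + f (0, \<i>) * wave (0, 1) (pi/2) x)" for x
  proof -
    have "circles x = cos (2 * pi * x $ 1) *\<^sub>R (1, 0) + sin (2 * pi * x $ 1) *\<^sub>R (\<i>, 0)
        + cos (2 * pi * x $ 2) *\<^sub>R (0, 1) + sin (2 * pi * x $ 2) *\<^sub>R (0, \<i>)"
      by (simp add: circles_def cis.code scaleR_conv_of_real complex_eq_iff)
    then show ?thesis by (simp only: f.add f.scaleR) (simp add: wave_def freq_def cos_diff)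
  qed
  then show ?case by (auto intro!: trigs.intros)
qed (auto intro: trigs_const trigs.add trigs_mult)

text \<open>Opposite faces of the cell have the same image, so one point has to be interior: the
  integer by which a coordinate differs then lies strictly between \<open>-1\<close> and
  \<open>1\<close>.\<close>

lemma circles_inj:
  assumes "x \<in> cbox 0 1" "y \<in> box 0 1" "circles x = circles y" shows "x = y"
proof -
  have "x $ i = y $ i" for i
  proof -
    have "cis (2 * pi * x $ i) = cis (2 * pi * y $ i)"
      using assms(3) exhaust_2[of i] by (auto simp: circles_def)
    then obtain m :: int where "2 * pi * x $ i = 2 * pi * y $ i + 2 * pi * of_int m"
      using sin_cos_eq_iff[of "2 * pi * x $ i" "2 * pi * y $ i"] by (auto simp: complex_eq_iff algebra_simps)
    then have "2 * pi * (x $ i) = 2 * pi * (y $ i + of_int m)" by (simp add: algebra_simps)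
    then have m: "x $ i = y $ i + of_int m" by simp
    have "0 \<le> x $ i" "x $ i \<le> 1" "0 < y $ i" "y $ i < 1" using assms by (auto simp: mem_box_cart)
    then have "m = 0" using m by linarith
    with m show ?thesis by simp
  qed
  then show ?thesis by (simp add: vec_eq_iff)
qed

text \<open>Orthogonality to waves extends to all trigonometric sums. The indicator of
  \<open>K\<close> is a pointwise limit of continuous functions of the distance to the image of
  \<open>K\<close>; each of these is uniformly close to a polynomial on the product of circles,
  hence to a trigonometric sum, and dominated convergence applies. \<open>K\<close> avoids the
  boundary so that points outside \<open>K\<close> have images off the image of
  \<open>K\<close>.\<close>

lemma orthogonal_compact:
  fixes f :: "real^2 \<Rightarrow> real"
  assumes f: "f \<in> L2" and orth: "\<And>k c. c \<in> {0, pi/2} \<Longrightarrow> L2_inner f (wave k c) = 0"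
    and K: "compact K" "K \<subseteq> box 0 1"
  shows "(\<integral>x. f x * indicator K x \<partial>torus) = 0"
proof (cases "K = {}")
  case False
  have wL: "wave k c \<in> L2" for k c by (rule continuous_imp_L2, rule wave_continuous)
  have fi: "integrable torus f" by (rule integral_norm_le_L2_norm(1)[OF f])
  have pL: "p \<in> L2" if "p \<in> trigs" for p using that continuous_imp_L2 trigs_continuous by blast
  have tr: "L2_inner f p = 0" if "p \<in> trigs" for p
    using that
  proof induction
    case (wave a k c)
    have "wave k c = (\<lambda>x. cos c *\<^sub>R wave k 0 x + sin c *\<^sub>R wave k (pi/2) x)"
      by (simp add: fun_eq_iff wave_decompose[of k c])
    then have "L2_inner f (wave k c) = L2_inner f (\<lambda>x. cos c *\<^sub>R wave k 0 x + sin c *\<^sub>R wave k (pi/2) x)"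
      by (rule arg_cong)
    also have "\<dots> = cos c * L2_inner f (wave k 0) + sin c * L2_inner f (wave k (pi/2))"
      by (subst L2_inner_add_right[OF L2_scaleR[OF wL] L2_scaleR[OF wL] f]) (simp only: L2_inner_scaleR_right)
    finally have "L2_inner f (wave k c) = 0" by (simp add: orth)
    then show ?case using L2_inner_scaleR_right[of f a "wave k c"] by simp
  qed (simp add: L2_inner_add_right f pL)
  define C where "C = circles ` K"
  have C: "closed C" "C \<noteq> {}"
    using K False by (auto simp: C_def intro!: compact_imp_closed compact_continuous_image circles_continuous)
  \<comment> \<open>Equal to one on \<open>C\<close> and, off the closed set \<open>C\<close>,
    eventually zero in \<open>m\<close>.\<close>
  define g where "g m z = max 0 (1 - real m * infdist z C)" for m z
  have gc: "continuous_on S (g m)" for m S unfolding g_def by (intro continuous_intros)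
  have cc: "compact (circles ` cbox 0 1)"
    by (intro compact_continuous_image circles_continuous compact_cbox)
  have "\<exists>p. real_polynomial_function p \<and> (\<forall>x \<in> cbox 0 1. \<bar>g m (circles x) - p (circles x)\<bar> < 1 / Suc m)" for m
  proof -
    have "0 < 1 / real (Suc m)" by simp
    from Stone_Weierstrass_real_polynomial_function[OF cc gc[of _ m] this]
    obtain p where "real_polynomial_function p" "\<And>z. z \<in> circles ` cbox 0 1 \<Longrightarrow> \<bar>g m z - p z\<bar> < 1 / Suc m" by metis
    then show ?thesis by blast
  qed
  then obtain p where p: "\<And>m. real_polynomial_function (p m)"
      "\<And>m x. x \<in> cbox 0 1 \<Longrightarrow> \<bar>g m (circles x) - p m (circles x)\<bar> < 1 / Suc m"
    by metis
  have "(\<lambda>m. \<integral>x. f x * p m (circles x) \<partial>torus) \<longlonglongrightarrow> (\<integral>x. f x * indicator K x \<partial>torus)"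
  proof (rule integral_dominated_convergence[where w="\<lambda>x. 2 * \<bar>f x\<bar>"])
    show "integrable torus (\<lambda>x. 2 * \<bar>f x\<bar>)" using fi by simp
    have "K \<in> sets torus" using K box_subset_cbox[of 0 "1::real^2"] by (intro torus_sets_borel borel_compact) auto
    then show "(\<lambda>x. f x * indicator K x) \<in> borel_measurable torus" using L2D(1)[OF f] by simp
    show "(\<lambda>x. f x * p m (circles x)) \<in> borel_measurable torus" for m
      using L2D(1)[OF f] L2D(1)[OF pL[OF trigs_polynomial[OF p(1)[of m]]]] by simp
    show "AE x in torus. (\<lambda>m. f x * p m (circles x)) \<longlonglongrightarrow> f x * indicator K x"
    proof (rule AE_I2)
      fix x assume "x \<in> space torus" then have x: "x \<in> cbox 0 1" by simp
      have "(\<lambda>m. g m (circles x)) \<longlonglongrightarrow> indicator K x"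
      proof (cases "x \<in> K")
        case True
        then have "infdist (circles x) C = 0" by (simp add: C_def)
        with True show ?thesis by (simp add: g_def)
      next
        case False
        have "circles x \<notin> C" using False circles_inj[OF x] K by (force simp: C_def)
        then have d: "infdist (circles x) C > 0" using C infdist_pos_not_in_closed by blast
        have "\<forall>\<^sub>F m in sequentially. g m (circles x) = 0"
          using filterlim_real_sequentially[unfolded filterlim_at_top, rule_format, of "1 / infdist (circles x) C"]
        proof eventually_elim
          case (elim m) 
          with d show ?case by (simp add: g_def field_simps)
        qed
        with False show ?thesis by (simp add: tendsto_eventually)
      qed
      moreover have "(\<lambda>m. g m (circles x) - p m (circles x)) \<longlonglongrightarrow> 0"
        by (rule tendsto_rabs_zero_cancel, rule tendsto_sandwich[OF _ _ tendsto_const lim_inverse_n'[THEN LIMSEQ_Suc]])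
          (use p(2)[OF x] less_imp_le in \<open>auto intro!: always_eventually\<close>)
      ultimately have "(\<lambda>m. g m (circles x) - (g m (circles x) - p m (circles x))) \<longlonglongrightarrow> indicator K x - 0"
        by (rule tendsto_diff)
      then show "(\<lambda>m. f x * p m (circles x)) \<longlonglongrightarrow> f x * indicator K x"
        by (intro tendsto_intros) simp
    qed
    show "AE x in torus. norm (f x * p m (circles x)) \<le> 2 * \<bar>f x\<bar>" for m
    proof (rule AE_I2)
      fix x assume "x \<in> space torus" then have x: "x \<in> cbox 0 1" by simp
      \<comment> \<open>The approximated function is at most one and so is the error, whence the
        factor \<open>2\<close> in the dominating function.\<close>
      have "g m (circles x) \<le> 1" "g m (circles x) \<ge> 0" by (auto simp: g_def infdist_nonneg)
      moreover have "1 / real (Suc m) \<le> 1" by simp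
      ultimately have "\<bar>p m (circles x)\<bar> \<le> 2" using p(2)[OF x, of m] by linarith
      then show "norm (f x * p m (circles x)) \<le> 2 * \<bar>f x\<bar>" 
        using mult_right_mono[of _ 2 "\<bar>f x\<bar>"] by (simp add: abs_mult mult.commute[of "f x"])
    qed
  qed
  moreover have "(\<integral>x. f x * p m (circles x) \<partial>torus) = 0" for m
    using tr[OF trigs_polynomial[OF p(1)[of m]]] by (simp add: L2_inner_def)
  ultimately show ?thesis by (simp add: LIMSEQ_const_iff)
qed simp

text \<open>The form of the bound comes from the L2 norm of the indicator of a set of measure
  \<open>e\<close>, which is \<open>sqrt e\<close>; this runs through all positive numbers.\<close>

lemma le_zero_of_le_sqrt:
  fixes N x :: real
  assumes "0 \<le> N" "\<And>e. 0 < e \<Longrightarrow> x \<le> N * sqrt e" shows "x \<le> 0"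
proof (rule field_le_epsilon)
  fix d :: real assume "0 < d"
  with \<open>0 \<le> N\<close> have "x \<le> N * sqrt ((d / (N + 1))\<^sup>2)" by (intro assms(2)) simp
  also have "\<dots> = N * (d / (N + 1))" using assms(1) \<open>0 < d\<close> by simp
  also have "\<dots> \<le> d" using assms(1) \<open>0 < d\<close> by (simp add: field_simps)
  finally show "x \<le> 0 + d" by simp
qed

text \<open>Lebesgue measure is inner regular: \<open>A\<close> exceeds a compact subset by a set of
  measure below \<open>e\<close>, and Cauchy--Schwarz bounds the integral over the excess by
  \<open>L2_norm f * sqrt e\<close>.\<close>

lemma orthogonal_measurable:
  fixes f :: "real^2 \<Rightarrow> real"
  assumes f: "f \<in> L2" and orth: "\<And>k c. c \<in> {0, pi/2} \<Longrightarrow> L2_inner f (wave k c) = 0"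
    and A: "A \<in> sets lebesgue" "A \<subseteq> box 0 1"
  shows "(\<integral>x. f x * indicator A x \<partial>torus) = 0"
proof -
  have fi: "integrable torus f" by (rule integral_norm_le_L2_norm(1)[OF f])
  have sub: "box 0 1 \<subseteq> cbox 0 (1::real^2)" by (rule box_subset_cbox)
  have ts: "B \<in> sets torus" if "B \<in> sets lebesgue" "B \<subseteq> box 0 1" for B
    using that sub by (auto simp: torus_def sets_restrict_space_iff)
  have int: "integrable torus (\<lambda>x. f x * indicator B x)" if "B \<in> sets torus" for B
    using integrable_mult_indicator[OF that fi] by (simp add: mult.commute)
  have "\<bar>\<integral>x. f x * indicator A x \<partial>torus\<bar> \<le> L2_norm f * sqrt e" if "e > 0" for e
  proof -
    obtain K where K: "closed K" "K \<subseteq> A" "A - K \<in> lmeasurable" "emeasure lebesgue (A - K) < ennreal e"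
      using sets_lebesgue_inner_closed[OF A(1) \<open>e > 0\<close>] by blast
    have "bounded K" using K(2) A(2) bounded_box bounded_subset by blast
    then have Kc: "compact K" "K \<subseteq> box 0 1" using K A by (auto simp: compact_eq_bounded_closed)
    have AK: "A - K \<in> sets torus" using K A by (intro ts) (auto simp: fmeasurable_def)
    have mA: "A \<in> sets torus" "K \<in> sets torus" using A K Kc by (auto intro!: ts)
    have "emeasure torus (A - K) = emeasure lebesgue (A - K)"
      unfolding torus_def using K A sub by (subst emeasure_restrict_space) (auto simp: fmeasurable_def)
    with K(4) \<open>e > 0\<close> have m: "measure torus (A - K) \<le> e"
      by (simp add: measure_def enn2real_leI less_imp_le)
    have ind: "indicator (A - K) \<in> (L2 :: (real^2 \<Rightarrow> real) set)"
      using AK by (intro bounded_imp_L2[where B=1]) auto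
    have "(\<integral>x. f x * indicator A x \<partial>torus) = (\<integral>x. f x * indicator K x \<partial>torus) + (\<integral>x. f x * indicator (A - K) x \<partial>torus)"
    proof -
      have "(\<lambda>x. f x * indicator A x) = (\<lambda>x. f x * indicator K x + f x * indicator (A - K) x)"
        using K(2) by (auto simp: indicator_def fun_eq_iff)
      then show ?thesis using Bochner_Integration.integral_add[OF int[OF mA(2)] int[OF AK]] by simp
    qed
    also have "\<dots> = L2_inner f (indicator (A - K))"
      using orthogonal_compact[OF f orth Kc] by (simp add: L2_inner_def)
    finally have "\<bar>\<integral>x. f x * indicator A x \<partial>torus\<bar> \<le> L2_norm f * L2_norm (indicator (A - K) :: real^2 \<Rightarrow> real)"
      using L2_Cauchy_Schwarz[OF f ind] by simp
    also have "L2_norm (indicator (A - K) :: real^2 \<Rightarrow> real) = sqrt (measure torus (A - K))"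
    proof -
      have "(norm (indicator (A - K) x :: real))\<^sup>2 = indicator (A - K) x" for x :: "real^2" by (simp add: indicator_def)
      moreover have "(A - K) \<inter> cbox 0 1 = A - K" using A sub by blast
      ultimately show ?thesis using AK by (simp add: L2_norm_def)
    qed
    also have "L2_norm f * sqrt (measure torus (A - K)) \<le> L2_norm f * sqrt e"
      using m by (intro mult_left_mono) auto
    finally show ?thesis .
  qed
  then have "\<bar>\<integral>x. f x * indicator A x \<partial>torus\<bar> \<le> 0" by (rule le_zero_of_le_sqrt[OF L2_norm_ge_0])
  then show ?thesis by simp
qed

lemma box_sub_torus_null: "AE x in torus. x \<in> box 0 1"
proof -
  have "negligible (cbox 0 1 - box 0 (1::real^2))" using negligible_frontier_interval by blast
  then have "AE x in lebesgue. x \<notin> cbox 0 1 - box 0 (1::real^2)"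
    by (simp add: AE_iff_null_sets negligible_iff_null_sets AE_not_in)
  then show ?thesis unfolding torus_def by (subst AE_restrict_space_iff) auto
qed

text \<open>The integral over the set where \<open>f\<close> is positive vanishes, although the
  integrand is positive there, so that set is null. The boundary of the cell, excluded so far, is a
  null set as well.\<close>

lemma orthogonal_imp_nonpos:
  fixes f :: "real^2 \<Rightarrow> real"
  assumes f: "f \<in> L2" and orth: "\<And>k c. c \<in> {0, pi/2} \<Longrightarrow> L2_inner f (wave k c) = 0"
  shows "AE x in torus. f x \<le> 0"
proof -
  define A where "A = {x \<in> space torus. f x > 0} \<inter> box 0 1"
  have At: "{x \<in> space torus. f x > 0} \<in> sets torus" using L2D(1)[OF f] by measurable
  then have "{x \<in> space torus. f x > 0} \<in> sets lebesgue"
    unfolding torus_def by (subst (asm) sets_restrict_space_iff) auto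
  then have A: "A \<in> sets lebesgue" "A \<subseteq> box 0 1" by (auto simp: A_def)
  have A': "A \<in> sets torus" using sets.Int[OF At torus_sets_borel[of "box 0 1"]] by (simp add: A_def box_subset_cbox)
  have i: "integrable torus (\<lambda>x. f x * indicator A x)"
    using integrable_mult_indicator[OF A' integral_norm_le_L2_norm(1)[OF f]] by (simp add: mult.commute)
  have "AE x in torus. 0 \<le> f x * indicator A x" by (rule AE_I2) (auto simp: A_def indicator_def)
  from integral_nonneg_eq_0_iff_AE[OF i this] orthogonal_measurable[OF f orth A]
  have "AE x in torus. f x * indicator A x = 0" by simp
  with box_sub_torus_null AE_space show ?thesis
    by eventually_elim (auto simp: A_def indicator_def split: if_splits)
qed

lemma orthogonal_imp_zero:
  fixes f :: "real^2 \<Rightarrow> 'a::euclidean_space"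
  assumes f: "f \<in> L2" and orth: "\<And>n j. j \<in> modes n \<Longrightarrow> coef f j = 0"
  shows "AE x in torus. f x = 0"
proof -
  have "AE x in torus. f x \<bullet> i = 0" if i: "i \<in> Basis" for i
  proof -
    let ?f = "\<lambda>x. f x \<bullet> i"
    have fi: "?f \<in> L2"
      by (rule L2_norm_mono(1)[OF _ _ f]) (use L2D(1)[OF f] Basis_le_norm[OF i] in auto)
    have o: "L2_inner ?f (wave k c) = 0" if "c \<in> {0, pi/2}" for k c
    proof -
      obtain n where "(k, c, i) \<in> modes n" using modes_exhaust[OF \<open>c \<in> {0, pi/2}\<close> i] by blast
      from orth[OF this] show ?thesis by (simp add: coef_def L2_inner_def mode_fun_def mult.commute)
    qed
    have "L2_inner (\<lambda>x. - ?f x) (wave k c) = 0" if "c \<in> {0, pi/2}" for k c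
      using o[OF that] L2_inner_minus_left[of ?f] by simp
    then have "AE x in torus. - ?f x \<le> 0" by (rule orthogonal_imp_nonpos[OF L2_uminus[OF fi]])
    moreover have "AE x in torus. ?f x \<le> 0" by (rule orthogonal_imp_nonpos[OF fi]) (rule o)
    ultimately show ?thesis by eventually_elim auto
  qed
  then have "AE x in torus. \<forall>i\<in>Basis. f x \<bullet> i = 0"
    by (intro AE_finite_allI) auto
  then show ?thesis by eventually_elim (simp add: euclidean_all_zero_iff)
qed

lemma coef_unique:
  fixes f :: "real^2 \<Rightarrow> 'a::euclidean_space"
  assumes "f \<in> L2" "h \<in> L2" "\<And>n j. j \<in> modes n \<Longrightarrow> coef f j = coef h j"
  shows "AE x in torus. f x = h x"
proof -
  have "AE x in torus. f x - h x = 0"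
    using assms by (intro orthogonal_imp_zero) (auto simp: coef_def L2_inner_diff_left)
  then show ?thesis by simp
qed

text \<open>The projections are nested, so squared distances between them are differences of the
  bounded increasing sequence \<open>S\<close>, and they form a Cauchy sequence. The limit has the
  coefficients of \<open>f\<close>, because each coefficient of \<open>proj n f\<close> is constant
  from some \<open>n\<close> on, and completeness of the system identifies it with
  \<open>f\<close>.\<close>

lemma proj_converges:
  fixes f :: "real^2 \<Rightarrow> 'a::euclidean_space"
  assumes f: "f \<in> L2"
  shows "(\<lambda>n. L2_norm (\<lambda>x. proj n f x - f x)) \<longlonglongrightarrow> 0"
proof -
  define S where "S n = (\<Sum>j\<in>modes n. (coef f j)\<^sup>2)" for n
  have mono: "incseq S" unfolding S_def
    by (intro monoI sum_mono2 modes_mono) auto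
  have "convergent S"
    by (rule incseq_convergent[OF mono, of "(L2_norm f)\<^sup>2"]) (use Bessel[OF f] in \<open>auto simp: S_def convergent_def\<close>)
  then have Cau: "Cauchy S" by (rule convergent_Cauchy)
  have inner_le: "L2_inner (proj n f) (proj m f) = S m" if "m \<le> n" for m n
  proof -
    have "L2_inner (proj n f) (proj m f) = (\<Sum>j\<in>modes m. coef f j * coef (proj n f) j)"
      by (subst L2_inner_commute) (simp add: proj_inner)
    also have "\<dots> = S m" unfolding S_def
      using modes_mono[OF that] by (intro sum.cong) (auto simp: coef_proj_mode power2_eq_square)
    finally show ?thesis .
  qed
  have diff: "(L2_norm (\<lambda>x. proj n f x - proj m f x))\<^sup>2 = \<bar>S n - S m\<bar>" for m n
  proof (cases "m \<le> n")
    case True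
    then show ?thesis using inner_le[OF True] monoD[OF mono True]
      by (simp add: L2_norm_diff_power2 proj_norm S_def[symmetric])
  next
    case False
    then have "n \<le> m" by simp
    then show ?thesis using inner_le[of n m] monoD[OF mono, of n m]
      by (simp add: L2_norm_diff_power2 proj_norm S_def[symmetric] L2_inner_commute[of "proj n f"])
  qed
  have "\<exists>N. \<forall>i\<ge>N. \<forall>j\<ge>N. L2_norm (\<lambda>x. proj i f x - proj j f x) < e" if "e > 0" for e
  proof -
    obtain N where "\<forall>i\<ge>N. \<forall>j\<ge>N. \<bar>S i - S j\<bar> < e\<^sup>2"
      using Cau \<open>e > 0\<close> by (metis Cauchy_def dist_real_def zero_less_power)
    then have "\<forall>i\<ge>N. \<forall>j\<ge>N. (L2_norm (\<lambda>x. proj i f x - proj j f x))\<^sup>2 < e\<^sup>2" by (simp add: diff)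
    then show ?thesis using \<open>e > 0\<close> by (meson power2_less_imp_less less_imp_le)
  qed
  from L2_complete[OF proj_L2 this] obtain h where h: "h \<in> L2" "(\<lambda>n. L2_norm (\<lambda>x. proj n f x - h x)) \<longlonglongrightarrow> 0" by blast
  have "AE x in torus. h x = f x"
  proof (rule coef_unique[OF h(1) f])
    fix m and j :: "'a mode" assume j: "j \<in> modes m"
    have "\<bar>coef f j - coef h j\<bar> \<le> L2_norm (\<lambda>x. proj n f x - h x) * L2_norm (mode_fun j)" if "n \<ge> m" for n
    proof -
      have "coef f j = coef (proj n f) j" using coef_proj_mode[OF j, of n f] modes_mono[OF that] j by auto
      then have "coef f j - coef h j = L2_inner (\<lambda>x. proj n f x - h x) (mode_fun j)"
        by (simp add: coef_def L2_inner_diff_left h)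
      then show ?thesis using L2_Cauchy_Schwarz[of "\<lambda>x. proj n f x - h x" "mode_fun j"] h by simp
    qed
    then have "\<bar>coef f j - coef h j\<bar> \<le> 0"
      by (intro tendsto_le[OF _ tendsto_mult_left_zero[OF h(2)] tendsto_const])
        (auto intro: eventually_sequentiallyI[of m])
    then show "coef h j = coef f j" by simp
  qed
  then have "L2_norm (\<lambda>x. proj n f x - h x) = L2_norm (\<lambda>x. proj n f x - f x)" for n
    using f h(1) by (intro L2_norm_cong_AE) (auto intro!: L2D(1) L2_diff elim: eventually_mono)
  with h(2) show ?thesis by simp
qed

lemma Parseval:
  assumes f: "f \<in> L2" and h: "h \<in> L2"
  shows "(\<lambda>n. \<Sum>j\<in>modes n. coef f j * coef h j) \<longlonglongrightarrow> L2_inner f h"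
proof -
  have "(\<lambda>n. L2_inner (proj n f) h - L2_inner f h) \<longlonglongrightarrow> 0"
  proof (rule tendsto_rabs_zero_cancel, rule tendsto_sandwich[OF _ _ tendsto_const tendsto_mult_left_zero[OF proj_converges[OF f]]])
    show "\<forall>\<^sub>F n in sequentially. \<bar>L2_inner (proj n f) h - L2_inner f h\<bar> \<le> L2_norm (\<lambda>x. proj n f x - f x) * L2_norm h"
      using L2_Cauchy_Schwarz[OF L2_diff[OF proj_L2 f] h] by (simp add: L2_inner_diff_left f h)
  qed auto
  then show ?thesis by (simp add: proj_inner[OF h] LIM_zero_iff)
qed

section \<open>Weak derivatives in terms of the frame coefficients\<close>

lemma multi_deriv_cmult_wave:
  "(dir_deriv (axis i 1) ^^ n) (\<lambda>x. a * wave k c x) = (\<lambda>x. a * freq k i ^ n * wave k (c - real n * (pi/2)) x)"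
proof (induction n)
  case (Suc n)
  have "c - real n * (pi/2) - pi/2 = c - real (Suc n) * (pi/2)" by (simp add: algebra_simps)
  note eq = this
  show ?case unfolding funpow.simps o_apply Suc dir_deriv_cmult_wave eq by (simp add: mult_ac)
qed simp

lemma multi_deriv_wave:
  "multi_deriv m (wave k c) = (\<lambda>x. freq k 2 ^ snd m * freq k 1 ^ fst m * wave k (c - real (fst m + snd m) * (pi/2)) x)"
proof -
  have 1: "(dir_deriv (axis 2 1) ^^ snd m) (wave k c) = (\<lambda>x. freq k 2 ^ snd m * wave k (c - real (snd m) * (pi/2)) x)"
    using multi_deriv_cmult_wave[where i=2 and n="snd m" and a=1] by (simp only: mult_1_left)
  have 2: "c - real (snd m) * (pi/2) - real (fst m) * (pi/2) = c - real (fst m + snd m) * (pi/2)"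
    by (simp add: algebra_simps)
  show ?thesis unfolding multi_deriv_def 1 multi_deriv_cmult_wave 2 ..
qed

lemma foldr_replicate: "foldr f (replicate n v) x = (f v ^^ n) x"
  by (induction n) auto

lemma multi_deriv_foldr:
  "multi_deriv m \<phi> = foldr dir_deriv (replicate (fst m) (axis 1 1) @ replicate (snd m) (axis 2 1)) \<phi>"
  by (simp add: multi_deriv_def foldr_replicate)

lemma smooth_multi_deriv: 
  assumes "smooth \<phi>" shows "continuous_on S (multi_deriv m \<phi>)"
proof -
  have "set (replicate (fst m) (axis 1 1 :: real^2) @ replicate (snd m) (axis 2 1)) \<subseteq> Basis"
    by (auto simp: axis_in_Basis_iff)
  then have "multi_deriv m \<phi> differentiable_on UNIV"
    using assms unfolding smooth_def multi_deriv_foldr by blast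
  then show ?thesis using differentiable_imp_continuous_on continuous_on_subset by blast
qed

lemma smooth_continuous: "smooth (\<phi> :: real^2 \<Rightarrow> real) \<Longrightarrow> continuous_on S \<phi>"
  using smooth_multi_deriv[of \<phi> S "(0,0)"] by (simp add: multi_deriv_def)

lemma integrable_continuous_scaleR:
  fixes f :: "real^2 \<Rightarrow> 'a::euclidean_space" and p :: "real^2 \<Rightarrow> real"
  assumes p: "continuous_on UNIV p" and f: "f \<in> L2"
  shows "integrable torus (\<lambda>x. p x *\<^sub>R f x)"
proof -
  have "bounded (p ` cbox 0 1)"
    using p by (meson compact_cbox compact_continuous_image compact_imp_bounded continuous_on_subset subset_UNIV)
  then obtain B where B: "\<And>x. x \<in> cbox 0 1 \<Longrightarrow> norm (p x) \<le> B" by (auto simp: bounded_iff)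
  show ?thesis
  proof (rule Bochner_Integration.integrable_bound)
    show "integrable torus (\<lambda>x. B *\<^sub>R f x)" using integral_norm_le_L2_norm(1)[OF f] by simp
    show "(\<lambda>x. p x *\<^sub>R f x) \<in> borel_measurable torus"
      using L2D(1)[OF f] L2D(1)[OF continuous_imp_L2[OF p]] by simp
    show "AE x in torus. norm (p x *\<^sub>R f x) \<le> norm (B *\<^sub>R f x)"
    proof (rule AE_I2)
      fix x assume "x \<in> space torus" then have "\<bar>p x\<bar> \<le> \<bar>B\<bar>" using B[of x] by auto
      then show "norm (p x *\<^sub>R f x) \<le> norm (B *\<^sub>R f x)" by (simp add: mult_right_mono)
    qed
  qed
qed

lemma coef_eq_integral:
  assumes "f \<in> L2" shows "coef f (k, c, i) = (\<integral>x. wave k c x *\<^sub>R f x \<partial>torus) \<bullet> i"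
proof -
  have "(\<integral>x. wave k c x *\<^sub>R f x \<partial>torus) \<bullet> i = (\<integral>x. (wave k c x *\<^sub>R f x) \<bullet> i \<partial>torus)"
    by (rule integral_inner_left[symmetric]) (intro integrable_continuous_scaleR wave_continuous assms)
  then show ?thesis by (simp add: coef_def L2_inner_def mode_fun_def)
qed

lemma has_weak_deriv_L2: "has_weak_deriv m f h \<Longrightarrow> h \<in> L2"
  by (simp add: has_weak_deriv_def)

text \<open>The definition of the weak derivative, tested with a wave. The shifted phase may leave
  \<open>{0, pi/2}\<close>; \<open>coef_shift_pi\<close> and \<open>sum_coef_shift\<close> lead
  back.\<close>

lemma coef_weak_deriv:
  assumes f: "f \<in> L2" and w: "has_weak_deriv m f h"
  shows "coef h (k, c, i) = (-1) ^ (fst m + snd m) * freq k 1 ^ fst m * freq k 2 ^ snd m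
           * coef f (k, c - real (fst m + snd m) * (pi/2), i)"
proof -
  let ?c = "c - real (fst m + snd m) * (pi/2)"
  have "(\<integral>x. multi_deriv m (wave k c) x *\<^sub>R f x \<partial>torus) = (-1) ^ (fst m + snd m) *\<^sub>R (\<integral>x. wave k c x *\<^sub>R h x \<partial>torus)"
    using w smooth_wave wave_periodic unfolding has_weak_deriv_def by blast
  moreover have "(\<integral>x. multi_deriv m (wave k c) x *\<^sub>R f x \<partial>torus) = (freq k 2 ^ snd m * freq k 1 ^ fst m) *\<^sub>R (\<integral>x. wave k ?c x *\<^sub>R f x \<partial>torus)"
  proof -
    have "integrable torus (\<lambda>x. wave k ?c x *\<^sub>R f x)" by (intro integrable_continuous_scaleR wave_continuous f)
    then show ?thesis by (simp only: multi_deriv_wave scaleR_scaleR[symmetric] integral_scaleR_right)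
  qed
  ultimately have "(freq k 2 ^ snd m * freq k 1 ^ fst m) *\<^sub>R (\<integral>x. wave k ?c x *\<^sub>R f x \<partial>torus) = (-1) ^ (fst m + snd m) *\<^sub>R (\<integral>x. wave k c x *\<^sub>R h x \<partial>torus)"
    by (simp only:)
  from arg_cong[OF this, of "\<lambda>z. (-1) ^ (fst m + snd m) * (z \<bullet> i)"] show ?thesis
    by (simp add: coef_eq_integral f has_weak_deriv_L2[OF w] flip: power_add mult.assoc) 
      (simp add: algebra_simps)
qed

lemma has_weak_deriv_unique:
  assumes "has_weak_deriv m f h" "has_weak_deriv m f h'"
  shows "AE x in torus. h x = h' x"
proof (rule coef_unique)
  fix n and j :: "'a mode"
  obtain k c i where j: "j = (k, c, i)" by (cases j)
  have "(-1) ^ (fst m + snd m) *\<^sub>R (\<integral>x. wave k c x *\<^sub>R h x \<partial>torus) = (-1) ^ (fst m + snd m) *\<^sub>R (\<integral>x. wave k c x *\<^sub>R h' x \<partial>torus)"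
    using assms smooth_wave[of k c] wave_periodic[of k c] unfolding has_weak_deriv_def by metis
  then show "coef h j = coef h' j" using assms by (simp add: j coef_eq_integral has_weak_deriv_L2)
qed (use assms in \<open>auto simp: has_weak_deriv_L2\<close>)

lemma has_weak_deriv_lincomb:
  assumes "f \<in> L2" "f' \<in> L2" "has_weak_deriv m f h" "has_weak_deriv m f' h'"
  shows "has_weak_deriv m (\<lambda>x. r *\<^sub>R f x + s *\<^sub>R f' x) (\<lambda>x. r *\<^sub>R h x + s *\<^sub>R h' x)"
proof -
  have hL: "h \<in> L2" "h' \<in> L2" using assms by (auto intro: has_weak_deriv_L2)
  have lin: "(\<integral>x. p x *\<^sub>R (r *\<^sub>R F x + s *\<^sub>R G x) \<partial>torus) = r *\<^sub>R (\<integral>x. p x *\<^sub>R F x \<partial>torus) + s *\<^sub>R (\<integral>x. p x *\<^sub>R G x \<partial>torus)"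
    if "continuous_on UNIV p" "F \<in> L2" "G \<in> L2" for p :: "real^2 \<Rightarrow> real" and F G :: "real^2 \<Rightarrow> 'a"
  proof -
    have "(\<integral>x. p x *\<^sub>R (r *\<^sub>R F x + s *\<^sub>R G x) \<partial>torus) = (\<integral>x. r *\<^sub>R (p x *\<^sub>R F x) + s *\<^sub>R (p x *\<^sub>R G x) \<partial>torus)"
      by (simp add: scaleR_add_right mult.commute)
    also have "\<dots> = r *\<^sub>R (\<integral>x. p x *\<^sub>R F x \<partial>torus) + s *\<^sub>R (\<integral>x. p x *\<^sub>R G x \<partial>torus)"
    proof -
      have i: "integrable torus (\<lambda>x. p x *\<^sub>R F x)" "integrable torus (\<lambda>x. p x *\<^sub>R G x)"
        by (intro integrable_continuous_scaleR that)+
      show ?thesis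
        by (simp only: Bochner_Integration.integral_add[OF integrable_scaleR_right[OF i(1)] integrable_scaleR_right[OF i(2)]] integral_scaleR_right i)
    qed
    finally show ?thesis .
  qed
  show ?thesis
    unfolding has_weak_deriv_def
  proof (intro conjI allI impI)
    fix \<phi> :: "real^2 \<Rightarrow> real" assume \<phi>: "smooth \<phi> \<and> periodic \<phi>"
    then have eq: "(\<integral>x. multi_deriv m \<phi> x *\<^sub>R f x \<partial>torus) = (-1) ^ (fst m + snd m) *\<^sub>R (\<integral>x. \<phi> x *\<^sub>R h x \<partial>torus)"
      "(\<integral>x. multi_deriv m \<phi> x *\<^sub>R f' x \<partial>torus) = (-1) ^ (fst m + snd m) *\<^sub>R (\<integral>x. \<phi> x *\<^sub>R h' x \<partial>torus)"
      using assms unfolding has_weak_deriv_def by blast+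
    then show "(\<integral>x. multi_deriv m \<phi> x *\<^sub>R (r *\<^sub>R f x + s *\<^sub>R f' x) \<partial>torus) = (-1) ^ (fst m + snd m) *\<^sub>R (\<integral>x. \<phi> x *\<^sub>R (r *\<^sub>R h x + s *\<^sub>R h' x) \<partial>torus)"
      unfolding lin[OF smooth_multi_deriv[OF conjunct1[OF \<phi>]] assms(1,2)] lin[OF smooth_continuous[OF conjunct1[OF \<phi>]] hL] eq
      by (simp only: scaleR_add_right scaleR_left_commute)
  qed (use hL in auto)
qed

lemma sobolev_L2: "f \<in> sobolev s \<Longrightarrow> f \<in> L2"
  by (simp add: sobolev_def)

lemma sobolev_weak_deriv:
  assumes "f \<in> sobolev s" "fst m + snd m \<le> s" shows "has_weak_deriv m f (weak_deriv m f)"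
proof -
  have "\<exists>h. has_weak_deriv m f h" using assms unfolding sobolev_def by blast
  then show ?thesis unfolding weak_deriv_def by (rule someI_ex)
qed

lemma sobolev_weak_deriv_L2: "f \<in> sobolev s \<Longrightarrow> fst m + snd m \<le> s \<Longrightarrow> weak_deriv m f \<in> L2"
  using sobolev_weak_deriv has_weak_deriv_L2 by blast

lemma has_weak_deriv_imp_AE: "has_weak_deriv m f h \<Longrightarrow> AE x in torus. weak_deriv m f x = h x"
  using has_weak_deriv_unique someI[of "has_weak_deriv m f" h] unfolding weak_deriv_def by blast

lemma sobolev_mono: "s \<le> t \<Longrightarrow> sobolev t \<subseteq> sobolev s"
  by (auto simp: sobolev_def)

lemma sobolev_lincomb:
  assumes "f \<in> sobolev s" "h \<in> sobolev s" shows "(\<lambda>x. a *\<^sub>R f x + b *\<^sub>R h x) \<in> sobolev s"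
proof -
  have L: "f \<in> L2" "h \<in> L2" using assms by (auto intro: sobolev_L2)
  have "\<exists>k. has_weak_deriv m (\<lambda>x. a *\<^sub>R f x + b *\<^sub>R h x) k" if "fst m + snd m \<le> s" for m
    using has_weak_deriv_lincomb[OF L sobolev_weak_deriv[OF assms(1) that] sobolev_weak_deriv[OF assms(2) that]] by blast
  then show ?thesis using L by (auto simp: sobolev_def)
qed

lemma sobolev_diff: "f \<in> sobolev s \<Longrightarrow> h \<in> sobolev s \<Longrightarrow> (\<lambda>x. f x - h x) \<in> sobolev s"
  using sobolev_lincomb[of f s h 1 "-1"] by simp

lemma weak_deriv_lincomb:
  assumes "f \<in> sobolev s" "h \<in> sobolev s" "fst m + snd m \<le> s" 
  shows "AE x in torus. weak_deriv m (\<lambda>x. a *\<^sub>R f x + b *\<^sub>R h x) x = a *\<^sub>R weak_deriv m f x + b *\<^sub>R weak_deriv m h x"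
  using assms by (intro has_weak_deriv_imp_AE has_weak_deriv_lincomb sobolev_weak_deriv sobolev_L2)

lemma weak_deriv_diff:
  assumes "f \<in> sobolev s" "h \<in> sobolev s" "fst m + snd m \<le> s" 
  shows "AE x in torus. weak_deriv m (\<lambda>x. f x - h x) x = weak_deriv m f x - weak_deriv m h x"
  using weak_deriv_lincomb[OF assms, of 1 "-1"] by simp

lemma has_weak_deriv_0: "f \<in> L2 \<Longrightarrow> has_weak_deriv (0, 0) f f"
  by (simp add: has_weak_deriv_def multi_deriv_def)

lemma weak_deriv_0: "f \<in> L2 \<Longrightarrow> AE x in torus. weak_deriv (0, 0) f x = f x"
  by (rule has_weak_deriv_imp_AE[OF has_weak_deriv_0])

lemma finite_orders: "finite {m :: nat \<times> nat. fst m + snd m \<le> s}"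
  by (rule finite_subset[of _ "{..s} \<times> {..s}"]) auto

lemma L2_norm_le_sobolev_norm: "fst m + snd m \<le> s \<Longrightarrow> L2_norm (weak_deriv m f) \<le> sobolev_norm s f"
  unfolding sobolev_norm_def by (intro real_le_rsqrt member_le_sum finite_orders) auto

lemma sobolev_norm_ge_0 [simp]: "0 \<le> sobolev_norm s f"
  by (simp add: sobolev_norm_def sum_nonneg)

lemma L2_norm_weak_deriv_0: "f \<in> L2 \<Longrightarrow> L2_norm (weak_deriv (0, 0) f) = L2_norm f"
  using has_weak_deriv_L2[OF someI[of "has_weak_deriv (0,0) f", OF has_weak_deriv_0]]
  by (intro L2_norm_cong_AE weak_deriv_0) (auto simp: weak_deriv_def L2D)

lemma L2_norm_le_sobolev_norm_0: "f \<in> L2 \<Longrightarrow> L2_norm f \<le> sobolev_norm s f"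
  using L2_norm_le_sobolev_norm[of "(0,0)" s f] L2_norm_weak_deriv_0[of f] by simp

lemma coef_shift_pi: "coef f (k, c + pi, i) = - coef f (k, c, i)" "coef f (k, c - pi, i) = - coef f (k, c, i)"
  by (auto simp: coef_def mode_fun_def wave_add_pi L2_inner_def)

lemma coef_neg_pi2: "coef f (k, - (pi/2), i) = - coef f (k, pi/2, i)"
  using coef_shift_pi(2)[of f k "pi/2" i] by simp

text \<open>A quarter turn exchanges cosine and sine up to a sign. In a product of two coefficients
  with the same phase the sign disappears, so the sum over the two phases is invariant.\<close>

lemma sum_coef_shift:
  "(\<Sum>c\<in>{0,pi/2}. coef f (k, c - real n * (pi/2), i) * coef h (k, c - real n * (pi/2), i))
     = (\<Sum>c\<in>{0,pi/2}. coef f (k, c, i) * coef h (k, c, i))"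
proof (induction n)
  case (Suc n)
  have "coef f (k, c - real (Suc n) * (pi/2), i) = coef f (k, c - pi/2 - real n * (pi/2), i)" for c and f :: "real^2 \<Rightarrow> 'a"
  proof -
    have "c - real (Suc n) * (pi/2) = c - pi/2 - real n * (pi/2)" by (simp add: field_simps)
    then show ?thesis by (simp only:)
  qed
  moreover have "coef f (k, 0 - pi/2 - real n * (pi/2), i) = - coef f (k, pi/2 - real n * (pi/2), i)" for f :: "real^2 \<Rightarrow> 'a"
  proof -
    have "0 - pi/2 - real n * (pi/2) = pi/2 - real n * (pi/2) - pi" by (simp add: field_simps)
    then show ?thesis by (simp only: coef_shift_pi)
  qed
  ultimately show ?case using Suc by simp
qed simp

lemma sum_modes: "(\<Sum>j\<in>modes n. F j) = (\<Sum>k\<in>freqs n. \<Sum>i\<in>Basis. \<Sum>c\<in>{0,pi/2}. F (k, c, i))"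
proof -
  have "(\<Sum>j\<in>modes n. F j) = (\<Sum>k\<in>freqs n. \<Sum>c\<in>{0,pi/2}. \<Sum>i\<in>Basis. F (k, c, i))"
    unfolding modes_def by (subst sum.cartesian_product)+ (auto intro!: sum.cong)
  also have "\<dots> = (\<Sum>k\<in>freqs n. \<Sum>i\<in>Basis. \<Sum>c\<in>{0,pi/2}. F (k, c, i))"
    by (intro sum.cong refl) (rule sum.swap)
  finally show ?thesis .
qed

text \<open>Here \<open>h\<close> is not a smooth test function, so the definition of the weak
  derivative does not apply directly. Both sides are expanded instead: the second derivative
  multiplies the coefficients by minus the squared frequency, while the two first derivatives
  contribute one factor each and a common phase shift.\<close>

lemma weak_deriv_2_parts:
  assumes f: "f \<in> sobolev 2" and h: "h \<in> sobolev 1" and m: "m = (1,0) \<or> m = (0,1)"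
  shows "L2_inner (weak_deriv (2 * fst m, 2 * snd m) f) h = - L2_inner (weak_deriv m f) (weak_deriv m h)"
proof -
  let ?F = "weak_deriv (2 * fst m, 2 * snd m) f"
  have m1: "fst m + snd m = 1" using m by auto
  have L: "f \<in> L2" "h \<in> L2" using f h by (auto intro: sobolev_L2)
  have F: "has_weak_deriv (2 * fst m, 2 * snd m) f ?F" using m by (intro sobolev_weak_deriv[OF f]) auto
  have f1: "has_weak_deriv m f (weak_deriv m f)" using m by (intro sobolev_weak_deriv[OF f]) auto
  have h1: "has_weak_deriv m h (weak_deriv m h)" using m by (intro sobolev_weak_deriv[OF h]) auto
  have "(\<Sum>j\<in>modes n. coef ?F j * coef h j) = - (\<Sum>j\<in>modes n. coef (weak_deriv m f) j * coef (weak_deriv m h) j)" for n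
    unfolding sum_modes sum_negf[symmetric]
  proof (rule sum.cong[OF refl], rule sum.cong[OF refl])
    fix k and i :: 'a
    let ?q = "freq k 1 ^ fst m * freq k 2 ^ snd m"
    have F': "coef ?F (k, c, i) = - (?q * ?q) * coef f (k, c, i)" for c
    proof -
      have "c - real (2 * (fst m + snd m)) * (pi/2) = c - pi" using m1 by simp
      then show ?thesis unfolding coef_weak_deriv[OF L(1) F] using m1 coef_shift_pi(2)[of f k c i]
        by (simp add: power_mult power2_eq_square power_mult_distrib mult.assoc flip: distrib_left)
    qed
    have "(\<Sum>c\<in>{0,pi/2}. coef ?F (k, c, i) * coef h (k, c, i)) = - (?q * ?q) * (\<Sum>c\<in>{0,pi/2}. coef f (k, c, i) * coef h (k, c, i))"
      by (simp only: F' sum_distrib_left mult.assoc)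
    also have "\<dots> = - (?q * ?q) * (\<Sum>c\<in>{0,pi/2}. coef f (k, c - real 1 * (pi/2), i) * coef h (k, c - real 1 * (pi/2), i))"
      by (simp only: sum_coef_shift)
    also have "\<dots> = - (\<Sum>c\<in>{0,pi/2}. coef (weak_deriv m f) (k, c, i) * coef (weak_deriv m h) (k, c, i))"
      by (simp only: coef_weak_deriv[OF L(1) f1] coef_weak_deriv[OF L(2) h1] m1) (simp add: algebra_simps)
    finally show "(\<Sum>c\<in>{0,pi/2}. coef ?F (k, c, i) * coef h (k, c, i)) = (\<Sum>c\<in>{0,pi/2}. - (coef (weak_deriv m f) (k, c, i) * coef (weak_deriv m h) (k, c, i)))"
      by (simp only: sum_negf)
  qed
  with Parseval[OF has_weak_deriv_L2[OF F] L(2)] 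
  have "(\<lambda>n. - (\<Sum>j\<in>modes n. coef (weak_deriv m f) j * coef (weak_deriv m h) j)) \<longlonglongrightarrow> L2_inner ?F h" by simp
  from tendsto_unique[OF _ this tendsto_minus[OF Parseval[OF has_weak_deriv_L2[OF f1] has_weak_deriv_L2[OF h1]]]]
  show ?thesis by simp
qed

subsection \<open>Embedding into bounded functions\<close>

text \<open>The sum over both phases is insensitive to the phase shift caused by a derivative; only
  the factor of squared frequencies is left.\<close>

definition energy :: "(real^2 \<Rightarrow> 'a::euclidean_space) \<Rightarrow> int \<times> int \<Rightarrow> 'a \<Rightarrow> real" where
  "energy f k i = (\<Sum>c\<in>{0,pi/2}. (coef f (k, c, i))\<^sup>2)"

lemma energy_weak_deriv:
  assumes "f \<in> L2" "has_weak_deriv m f h"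
  shows "energy h k i = (freq k 1)\<^sup>2 ^ fst m * (freq k 2)\<^sup>2 ^ snd m * energy f k i"
proof -
  let ?q = "freq k 1 ^ fst m * freq k 2 ^ snd m"
  let ?c = "\<lambda>c. c - real (fst m + snd m) * (pi/2)"
  have "energy h k i = (\<Sum>c\<in>{0,pi/2}. ?q\<^sup>2 * (coef f (k, ?c c, i) * coef f (k, ?c c, i)))"
    unfolding energy_def coef_weak_deriv[OF assms]
    by (intro sum.cong refl) (simp add: power_mult_distrib power2_eq_square algebra_simps flip: power_mult_distrib)
  also have "\<dots> = ?q\<^sup>2 * energy f k i"
    unfolding energy_def power2_eq_square[of "coef _ _"] sum_distrib_left[symmetric] sum_coef_shift ..
  finally show ?thesis by (simp add: power_mult_distrib flip: power_mult) (simp add: mult.commute)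
qed

text \<open>Telescoping: for positive \<open>k\<close>, \<open>1 / (1 + k\<^sup>2)\<close> is below
  the difference of \<open>1 / (k - 1/2)\<close> and \<open>1 / (k + 1/2)\<close>, and
  \<open>k\<close> and \<open>- k\<close> contribute the factor \<open>2\<close>. The constant
  \<open>5\<close> makes the case \<open>n = 0\<close> an equality.\<close>

lemma sum_inverse_squares: "(\<Sum>k=- int n..int n. 1 / (1 + (real_of_int k)\<^sup>2)) \<le> 5 - 2 / (real n + 1/2)"
proof (induction n)
  case (Suc n)
  have "{- int (Suc n)..int (Suc n)} = insert (- int (Suc n)) (insert (int (Suc n)) {- int n..int n})"
    by auto
  then have "(\<Sum>k=- int (Suc n)..int (Suc n). 1 / (1 + (real_of_int k)\<^sup>2))
      = 2 / (1 + (real (Suc n))\<^sup>2) + (\<Sum>k=- int n..int n. 1 / (1 + (real_of_int k)\<^sup>2))"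
    by (simp add: power2_commute[of "-1"] power2_eq_square algebra_simps)
  also have "\<dots> \<le> 2 / (1 + (real (Suc n))\<^sup>2) + (5 - 2 / (real n + 1/2))" using Suc by simp
  also have "2 / (1 + (real (Suc n))\<^sup>2) \<le> 2 / (real n + 1/2) - 2 / (real (Suc n) + 1/2)"
  proof -
    have p: "0 < (real n + 1/2) * (real (Suc n) + 1/2)" by (intro mult_pos_pos) auto
    have "2 / (real n + 1/2) - 2 / (real (Suc n) + 1/2) = 2 / ((real n + 1/2) * (real (Suc n) + 1/2))"
      by (simp add: divide_simps)
    moreover have "(real n + 1/2) * (real (Suc n) + 1/2) \<le> 1 + (real (Suc n))\<^sup>2"
      by (simp add: power2_eq_square algebra_simps)
    then have "2 / (1 + (real (Suc n))\<^sup>2) \<le> 2 / ((real n + 1/2) * (real (Suc n) + 1/2))"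
      using p by (intro frac_le) auto
    ultimately show ?thesis by (simp only:)
  qed
  finally show ?case by simp
qed simp

text \<open>With \<open>a\<close> and \<open>b\<close> the squared components of \<open>k\<close>,
  this is \<open>(1 + a) * (1 + b) \<le> 2 * (1 + a\<^sup>2 + b\<^sup>2)\<close> together with
  \<open>1 \<le> 2 * pi\<close>. The product form on the right turns a sum over the lattice into a
  product of two sums.\<close>

lemma weight_bound:
  "1 / (1 + (freq k 1)^4 + (freq k 2)^4) \<le> 2 * (1 / (1 + (real_of_int (fst k))\<^sup>2) * (1 / (1 + (real_of_int (snd k))\<^sup>2)))"
proof -
  define a b where "a = (real_of_int (fst k))\<^sup>2" and "b = (real_of_int (snd k))\<^sup>2"
  have p: "(1::real) \<le> 2 * pi" using pi_ge_two by linarith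
  have "1 \<le> (2 * pi) ^ 4" using p by (rule one_le_power)
  then have "a\<^sup>2 \<le> (freq k 1)^4" "b\<^sup>2 \<le> (freq k 2)^4"
    by (auto simp: a_def b_def freq_def power_mult_distrib mult_le_cancel_right1 simp flip: power_mult)
  moreover have "(1 + a) * (1 + b) \<le> 2 * (1 + a\<^sup>2 + b\<^sup>2)"
  proof -
    have "(1 + a) * (1 + b) = 1 + a + b + a * b" by (simp add: algebra_simps)
    moreover have "2 * (a * b) \<le> a\<^sup>2 + b\<^sup>2" using sum_squares_bound[of a b] by (simp only: mult.assoc)
    ultimately show ?thesis
      using sum_squares_bound[of a 1, simplified] sum_squares_bound[of b 1, simplified]
        zero_le_power2[of a] zero_le_power2[of b] unfolding distrib_left[of 2] by linarith
  qed
  ultimately have le: "(1 + a) * (1 + b) \<le> 2 * (1 + (freq k 1)^4 + (freq k 2)^4)" unfolding distrib_left[of 2] by linarith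
  have pos: "0 < (1 + a) * (1 + b)" by (simp add: a_def b_def add_pos_nonneg)
  define W where "W = 1 + (freq k 1)^4 + (freq k 2)^4"
  have "1 / (2 * W) \<le> 1 / ((1 + a) * (1 + b))"
    using le pos unfolding W_def[symmetric] by (intro frac_le) auto
  then have "2 * (1 / (2 * W)) \<le> 2 * (1 / ((1 + a) * (1 + b)))" by (intro mult_left_mono) auto
  then show ?thesis unfolding W_def[symmetric] a_def[symmetric] b_def[symmetric] by simp
qed

text \<open>Reciprocals of fourth powers are summable over a two-dimensional lattice; the bound is
  \<open>2 * 5 * 5\<close>.\<close>

lemma sum_weights: "(\<Sum>k\<in>freqs n. 1 / (1 + (freq k 1)^4 + (freq k 2)^4)) \<le> 50"
proof -
  define S where "S = (\<Sum>k=- int n..int n. 1 / (1 + (real_of_int k)\<^sup>2))"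
  have S: "0 \<le> S" "S \<le> 5" 
    using sum_inverse_squares[of n] by (auto simp: S_def intro!: sum_nonneg elim!: order_trans)
  have "(\<Sum>k\<in>freqs n. 1 / (1 + (freq k 1)^4 + (freq k 2)^4)) 
      \<le> (\<Sum>k\<in>freqs n. 2 * (1 / (1 + (real_of_int (fst k))\<^sup>2) * (1 / (1 + (real_of_int (snd k))\<^sup>2))))"
    by (intro sum_mono weight_bound)
  also have "\<dots> = 2 * (S * S)"
  proof -
    have "(\<Sum>k\<in>A \<times> A. f (fst k) * f (snd k)) = (\<Sum>i\<in>A. f i) * (\<Sum>i\<in>A. f i)" for f :: "int \<Rightarrow> real" and A
      by (simp add: sum_product sum.cartesian_product case_prod_beta)
    from this[of "\<lambda>k. 1 / (1 + (real_of_int k)\<^sup>2)" "{- int n..int n}"] show ?thesis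
      unfolding sum_distrib_left[symmetric] S_def freqs_def by (simp only:)
  qed
  also have "\<dots> \<le> 2 * (5 * 5)" using S by (intro mult_left_mono mult_mono) auto
  finally show ?thesis by simp
qed

text \<open>Cauchy--Schwarz with the weight \<open>w\<close>: the reciprocal weights sum to at most
  \<open>50\<close> for each phase and direction, hence \<open>100 * DIM('a)\<close>, and Bessel
  bounds the weighted squares by the three norms. \<open>h1\<close> and \<open>h2\<close> stand for
  the pure second derivatives of \<open>f\<close>; only their energies are prescribed, so that
  \<open>f\<close> may itself be a weak derivative without any composition of weak
  derivatives.\<close>

lemma proj_bound:
  fixes f :: "real^2 \<Rightarrow> 'a::euclidean_space"
  assumes L: "f \<in> L2" "h1 \<in> L2" "h2 \<in> L2"
    and h1: "\<And>k i. energy h1 k i = (freq k 1)^4 * energy f k i"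
    and h2: "\<And>k i. energy h2 k i = (freq k 2)^4 * energy f k i"
  shows "norm (proj n f x) \<le> sqrt (100 * DIM('a)) * sqrt ((L2_norm f)\<^sup>2 + (L2_norm h1)\<^sup>2 + (L2_norm h2)\<^sup>2)"
proof -
  define w where "w j = 1 + (freq (fst j) 1)^4 + (freq (fst j) 2)^4" for j :: "'a mode"
  have w: "w j > 0" for j by (simp add: w_def add_pos_nonneg)
  have "norm (proj n f x) \<le> (\<Sum>j\<in>modes n. \<bar>coef f j\<bar>)"
    unfolding proj_def
  proof (rule sum_norm_le)
    fix j :: "'a mode" assume "j \<in> modes n"
    then have "norm (mode_fun j x) \<le> 1"
      using abs_wave_le_1 by (auto simp: mode_fun_def modes_def)
    then show "norm (coef f j *\<^sub>R mode_fun j x) \<le> \<bar>coef f j\<bar>" by (simp add: mult_left_le)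
  qed
  also have "\<dots> = (\<Sum>j\<in>modes n. \<bar>sqrt (1 / w j)\<bar> * \<bar>sqrt (w j) * coef f j\<bar>)"
    using w by (intro sum.cong refl) (simp add: abs_mult real_sqrt_divide less_imp_neq[symmetric] less_imp_le)
  also have "\<dots> \<le> L2_set (\<lambda>j. sqrt (1 / w j)) (modes n) * L2_set (\<lambda>j. sqrt (w j) * coef f j) (modes n)"
    by (rule L2_set_mult_ineq)
  also have "\<dots> \<le> sqrt (100 * DIM('a)) * sqrt ((L2_norm f)\<^sup>2 + (L2_norm h1)\<^sup>2 + (L2_norm h2)\<^sup>2)"
  proof (rule mult_mono)
    have "(\<Sum>j\<in>modes n. 1 / w j) = real DIM('a) * (2 * (\<Sum>k\<in>freqs n. 1 / (1 + (freq k 1)^4 + (freq k 2)^4)))"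
      by (simp add: sum_modes w_def sum_distrib_left)
    also have "\<dots> \<le> real DIM('a) * (2 * 50)" using sum_weights by (intro mult_left_mono) auto
    finally show "L2_set (\<lambda>j. sqrt (1 / w j)) (modes n) \<le> sqrt (100 * DIM('a))"
      unfolding L2_set_def using w by (auto simp: less_imp_le)
    have "(\<Sum>j\<in>modes n. w j * (coef f j)\<^sup>2) = (\<Sum>k\<in>freqs n. \<Sum>i\<in>Basis. energy f k i + energy h1 k i + energy h2 k i)"
      unfolding h1 h2 sum_modes by (intro sum.cong refl) (simp add: energy_def w_def algebra_simps)
    also have "\<dots> = (\<Sum>j\<in>modes n. (coef f j)\<^sup>2) + (\<Sum>j\<in>modes n. (coef h1 j)\<^sup>2) + (\<Sum>j\<in>modes n. (coef h2 j)\<^sup>2)"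
      unfolding sum_modes energy_def by (simp only: sum.distrib)
    also have "\<dots> \<le> (L2_norm f)\<^sup>2 + (L2_norm h1)\<^sup>2 + (L2_norm h2)\<^sup>2"
      by (intro add_mono Bessel L)
    finally show "L2_set (\<lambda>j. sqrt (w j) * coef f j) (modes n) \<le> sqrt ((L2_norm f)\<^sup>2 + (L2_norm h1)\<^sup>2 + (L2_norm h2)\<^sup>2)"
      unfolding L2_set_def using w by (simp add: power_mult_distrib less_imp_le)
  qed (auto simp: L2_set_nonneg)
  finally show ?thesis .
qed

text \<open>The excess of \<open>norm (f x)\<close> over \<open>B\<close> is pointwise at most the
  distance of \<open>f\<close> from any of its projections, which tends to zero in mean
  square.\<close>

lemma AE_bounded_of_proj:
  fixes f :: "real^2 \<Rightarrow> 'a::euclidean_space"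
  assumes f: "f \<in> L2" and B: "\<And>n x. norm (proj n f x) \<le> B"
  shows "AE x in torus. norm (f x) \<le> B"
proof -
  define p where "p x = max 0 (norm (f x) - B)" for x
  have pm: "p \<in> borel_measurable torus" unfolding p_def using L2D(1)[OF f] by simp
  have le: "norm (p x) \<le> norm (proj n f x - f x)" for x n
  proof -
    have "norm (f x) \<le> norm (proj n f x) + norm (proj n f x - f x)"
      using norm_triangle_sub[of "f x" "proj n f x"] by (simp add: norm_minus_commute)
    then show ?thesis using B[of n x] by (auto simp: p_def)
  qed
  have p: "p \<in> L2" "L2_norm p \<le> L2_norm (\<lambda>x. proj n f x - f x)" for n
    using L2_norm_mono[OF AE_I2[OF le] pm L2_diff[OF proj_L2 f]] by auto
  have "L2_norm p \<le> 0"
    by (rule tendsto_le[OF _ proj_converges[OF f] tendsto_const]) (auto intro: p always_eventually)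
  then have "L2_norm p = 0" using L2_norm_ge_0[of p] by linarith
  from L2_norm_eq_0[OF p(1) this] show ?thesis
    by eventually_elim (auto simp: p_def max_def split: if_splits)
qed

text \<open>The two further derivatives have total order at most three, and three squared norms,
  each bounded by the squared \<open>H\<^sup>3\<close> norm, turn \<open>100\<close> into
  \<open>300\<close>.\<close>

lemma weak_deriv_bounded:
  fixes f :: "real^2 \<Rightarrow> 'a::euclidean_space"
  assumes f: "f \<in> sobolev 3" and m: "fst m + snd m \<le> 1"
  shows "AE x in torus. norm (weak_deriv m f x) \<le> sqrt (300 * DIM('a)) * sobolev_norm 3 f"
proof -
  let ?a = "(fst m + 2, snd m)" and ?b = "(fst m, snd m + 2)"
  note h = sobolev_weak_deriv[OF f] and N = L2_norm_le_sobolev_norm[of _ 3 f]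
  have L: "f \<in> L2" using f by (rule sobolev_L2)
  have h': "has_weak_deriv m f (weak_deriv m f)" "has_weak_deriv ?a f (weak_deriv ?a f)" "has_weak_deriv ?b f (weak_deriv ?b f)"
    using m by (auto intro!: h)
  have e: "energy (weak_deriv ?a f) k i = (freq k 1)^4 * energy (weak_deriv m f) k i"
     "energy (weak_deriv ?b f) k i = (freq k 2)^4 * energy (weak_deriv m f) k i" for k i
    unfolding energy_weak_deriv[OF L h'(1)] energy_weak_deriv[OF L h'(2)] energy_weak_deriv[OF L h'(3)] fst_conv snd_conv power_add
    by (simp_all add: power2_eq_square power4_eq_xxxx mult_ac)
  have "sqrt ((L2_norm (weak_deriv m f))\<^sup>2 + (L2_norm (weak_deriv ?a f))\<^sup>2 + (L2_norm (weak_deriv ?b f))\<^sup>2)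
      \<le> sqrt ((sobolev_norm 3 f)\<^sup>2 + (sobolev_norm 3 f)\<^sup>2 + (sobolev_norm 3 f)\<^sup>2)"
    using m by (intro real_sqrt_le_mono add_mono power_mono N) auto
  also have "\<dots> = sqrt 3 * sobolev_norm 3 f" by (simp add: real_sqrt_mult)
  finally have s: "sqrt ((L2_norm (weak_deriv m f))\<^sup>2 + (L2_norm (weak_deriv ?a f))\<^sup>2 + (L2_norm (weak_deriv ?b f))\<^sup>2) \<le> sqrt 3 * sobolev_norm 3 f" .
  show ?thesis
  proof (rule AE_bounded_of_proj)
    fix n x
    have "norm (proj n (weak_deriv m f) x) \<le> sqrt (100 * DIM('a)) * sqrt ((L2_norm (weak_deriv m f))\<^sup>2 + (L2_norm (weak_deriv ?a f))\<^sup>2 + (L2_norm (weak_deriv ?b f))\<^sup>2)"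
      by (intro proj_bound has_weak_deriv_L2[OF h'(1)] has_weak_deriv_L2[OF h'(2)] has_weak_deriv_L2[OF h'(3)] e)
    also have "\<dots> \<le> sqrt (100 * DIM('a)) * (sqrt 3 * sobolev_norm 3 f)" using s by (intro mult_left_mono) auto
    also have "\<dots> = sqrt (300 * DIM('a)) * sobolev_norm 3 f"
      by (simp add: mult.assoc[symmetric] flip: real_sqrt_mult)
    finally show "norm (proj n (weak_deriv m f) x) \<le> sqrt (300 * DIM('a)) * sobolev_norm 3 f" .
  qed (use h' has_weak_deriv_L2 in blast)
qed

lemma sobolev_bounded:
  fixes f :: "real^2 \<Rightarrow> 'a::euclidean_space"
  assumes f: "f \<in> sobolev 3"
  shows "AE x in torus. norm (f x) \<le> sqrt (300 * DIM('a)) * sobolev_norm 3 f"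
proof -
  have "AE x in torus. norm (weak_deriv (0,0) f x) \<le> sqrt (300 * DIM('a)) * sobolev_norm 3 f"
    by (rule weak_deriv_bounded[OF f]) simp
  with weak_deriv_0[OF sobolev_L2[OF f]] show ?thesis by eventually_elim simp
qed

subsection \<open>Projections of Sobolev functions\<close>

definition unit_order :: "2 \<Rightarrow> nat \<times> nat" where
  "unit_order i = (if i = 1 then (1, 0) else (0, 1))"

lemma unit_order_simps [simp]: "unit_order 1 = (1, 0)" "unit_order 2 = (0, 1)"
  by (auto simp: unit_order_def)

lemma multi_deriv_unit: "multi_deriv (unit_order i) \<phi> = dir_deriv (axis i 1) \<phi>"
  using exhaust_2[of i] by (auto simp: multi_deriv_def)

lemma smooth_differentiable: "smooth (\<phi> :: real^2 \<Rightarrow> real) \<Longrightarrow> \<phi> differentiable (at x)"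
  unfolding smooth_def by (drule spec[of _ "[]"]) (simp add: differentiable_on_def)

text \<open>The classical derivative is the weak one: the derivative of
  \<open>\<phi> x * wave k c x\<close> has integral zero, and the product rule splits it.\<close>

lemma has_weak_deriv_mode:
  assumes b: "b \<in> Basis"
  shows "has_weak_deriv (unit_order i) (mode_fun (k, c, b)) (\<lambda>x. freq k i *\<^sub>R mode_fun (k, c - pi/2, b) x)"
  unfolding has_weak_deriv_def
proof (intro conjI allI impI)
  show "(\<lambda>x. freq k i *\<^sub>R mode_fun (k, c - pi/2, b) x) \<in> L2" by simp
  fix \<phi> :: "real^2 \<Rightarrow> real" assume "smooth \<phi> \<and> periodic \<phi>"
  then have \<phi>: "smooth \<phi>" "periodic \<phi>" by auto
  have \<phi>c: "continuous_on UNIV (dir_deriv (axis i 1) \<phi>)" "continuous_on UNIV \<phi>"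
    using smooth_multi_deriv[OF \<phi>(1), of UNIV "unit_order i"] smooth_continuous[OF \<phi>(1)] by (auto simp: multi_deriv_unit)
  let ?F = "\<lambda>x. \<phi> x * wave k c x"
  have dF: "dir_deriv (axis i 1) ?F x = \<phi> x * (freq k i * wave k (c - pi/2) x) + dir_deriv (axis i 1) \<phi> x * wave k c x" for x
  proof -
    have "(?F has_derivative (\<lambda>h. \<phi> x * frechet_derivative (wave k c) (at x) h + frechet_derivative \<phi> (at x) h * wave k c x)) (at x)"
      using smooth_differentiable[OF \<phi>(1), of x] wave_differentiable[of k c x]
      by (intro has_derivative_mult) (auto simp: frechet_derivative_works)
    from frechet_derivative_at[OF this] have "dir_deriv (axis i 1) ?F x = \<phi> x * dir_deriv (axis i 1) (wave k c) x + dir_deriv (axis i 1) \<phi> x * wave k c x"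
      by (simp add: dir_deriv_def fun_eq_iff)
    then show ?thesis by (simp add: dir_deriv_wave)
  qed
  have i1: "integrable torus (\<lambda>x. dir_deriv (axis i 1) \<phi> x * wave k c x)"
    and i2: "integrable torus (\<lambda>x. \<phi> x * (freq k i * wave k (c - pi/2) x))"
    using integrable_continuous_scaleR[OF \<phi>c(1) continuous_imp_L2[OF wave_continuous]]
      integrable_continuous_scaleR[OF \<phi>c(2) L2_scaleR[OF continuous_imp_L2[OF wave_continuous]]] by auto
  have "(\<integral>x. dir_deriv (axis i 1) ?F x \<partial>torus) = 0"
  proof (rule integral_torus_dir_deriv)
    show "?F differentiable at x" for x
      using smooth_differentiable[OF \<phi>(1), of x] wave_differentiable[of k c x] by (rule differentiable_mult)
    show "periodic ?F" using \<phi>(2) wave_periodic[of k c] by (simp add: periodic_def)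
    show "continuous_on UNIV (dir_deriv (axis i 1) ?F)"
      unfolding dF by (intro continuous_intros \<phi>c wave_continuous)
  qed
  then have eq: "(\<integral>x. dir_deriv (axis i 1) \<phi> x * wave k c x \<partial>torus) = - (\<integral>x. \<phi> x * (freq k i * wave k (c - pi/2) x) \<partial>torus)"
    unfolding dF using i1 i2 by (subst (asm) Bochner_Integration.integral_add) auto
  have "(\<integral>x. multi_deriv (unit_order i) \<phi> x *\<^sub>R mode_fun (k, c, b) x \<partial>torus) = (\<integral>x. (dir_deriv (axis i 1) \<phi> x * wave k c x) *\<^sub>R b \<partial>torus)"
    by (simp add: multi_deriv_unit mode_fun_def)
  also have "\<dots> = (\<integral>x. dir_deriv (axis i 1) \<phi> x * wave k c x \<partial>torus) *\<^sub>R b"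
    using i1 by (intro integral_scaleR_left)
  also have "\<dots> = - ((\<integral>x. \<phi> x * (freq k i * wave k (c - pi/2) x) \<partial>torus) *\<^sub>R b)" unfolding eq by simp
  also have "(\<integral>x. \<phi> x * (freq k i * wave k (c - pi/2) x) \<partial>torus) *\<^sub>R b = (\<integral>x. (\<phi> x * (freq k i * wave k (c - pi/2) x)) *\<^sub>R b \<partial>torus)"
    using i2 by (intro integral_scaleR_left[symmetric])
  also have "\<dots> = (\<integral>x. \<phi> x *\<^sub>R freq k i *\<^sub>R mode_fun (k, c - pi/2, b) x \<partial>torus)"
    by (simp add: mode_fun_def mult.assoc)
  finally show "(\<integral>x. multi_deriv (unit_order i) \<phi> x *\<^sub>R mode_fun (k, c, b) x \<partial>torus) =
      (- 1) ^ (fst (unit_order i) + snd (unit_order i)) *\<^sub>R (\<integral>x. \<phi> x *\<^sub>R freq k i *\<^sub>R mode_fun (k, c - pi/2, b) x \<partial>torus)"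
    using exhaust_2[of i] by auto
qed

lemma order_le_1: "fst m + snd m \<le> (1::nat) \<longleftrightarrow> m = (0,0) \<or> m = unit_order 1 \<or> m = unit_order 2"
  by (cases m) (auto simp: le_Suc_eq)

lemma sobolev_1I:
  "f \<in> L2 \<Longrightarrow> (\<And>i. \<exists>h. has_weak_deriv (unit_order i) f h) \<Longrightarrow> f \<in> sobolev 1"
  unfolding sobolev_def order_le_1 using has_weak_deriv_0 by blast

lemma mode_sobolev: "j \<in> modes n \<Longrightarrow> mode_fun j \<in> sobolev 1"
  by (rule sobolev_1I) (auto simp: modes_def intro: has_weak_deriv_mode)

lemma sobolev_sum:
  assumes "\<And>j. j \<in> I \<Longrightarrow> f j \<in> sobolev s" shows "(\<lambda>x. \<Sum>j\<in>I. a j *\<^sub>R f j x) \<in> sobolev s"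
  using assms
proof (induction I rule: infinite_finite_induct)
  case (insert j I)
  then show ?case using sobolev_lincomb[of "f j" s "\<lambda>x. \<Sum>j\<in>I. a j *\<^sub>R f j x" "a j" 1] by simp
next
  case empty
  have "has_weak_deriv m (\<lambda>x. 0 :: 'b) (\<lambda>x. 0)" for m by (simp add: has_weak_deriv_def)
  then show ?case by (auto simp: sobolev_def)
next
  case (infinite I)
  have "has_weak_deriv m (\<lambda>x. 0 :: 'b) (\<lambda>x. 0)" for m by (simp add: has_weak_deriv_def)
  then show ?case using infinite by (auto simp: sobolev_def)
qed

lemma proj_sobolev: "proj n f \<in> sobolev 1"
  unfolding proj_def by (intro sobolev_sum mode_sobolev)

text \<open>Truncation keeps or drops a frequency together with both of its phases, and
  differentiation mixes phases only, so the two operations commute. The phase \<open>- pi/2\<close>,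
  which arises from \<open>c = 0\<close>, is traded for \<open>pi/2\<close> at the price of a
  sign.\<close>

lemma weak_deriv_proj:
  assumes f: "f \<in> sobolev 1" and m: "fst m + snd m \<le> 1"
  shows "AE x in torus. weak_deriv m (proj n f) x = proj n (weak_deriv m f) x"
proof (rule coef_unique)
  have P: "has_weak_deriv m (proj n f) (weak_deriv m (proj n f))" by (rule sobolev_weak_deriv[OF proj_sobolev m])
  have F: "has_weak_deriv m f (weak_deriv m f)" by (rule sobolev_weak_deriv[OF f m])
  show "weak_deriv m (proj n f) \<in> L2" using P by (rule has_weak_deriv_L2)
  fix N and i :: "'a mode" assume i: "i \<in> modes N"
  obtain k c b where i_eq: "i = (k, c, b)" by (cases i)
  with i have j: "i = (k, c, b)" "c \<in> {0, pi/2}" "b \<in> Basis" by (auto simp: modes_def)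
  have in_modes: "(k, c', b) \<in> modes n \<longleftrightarrow> k \<in> freqs n" if "c' \<in> {0, pi/2}" for c'
    using that j by (auto simp: modes_def)
  have *: "coef (proj n f) (k, c - real (fst m + snd m) * (pi/2), b) = (if k \<in> freqs n then coef f (k, c - real (fst m + snd m) * (pi/2), b) else 0)"
  proof -
    consider "fst m + snd m = 0" | "fst m + snd m = 1" using m by linarith
    then show ?thesis
    proof cases
      case 1
      then show ?thesis using coef_proj[OF j(2,3), of n f k] in_modes[OF j(2)] by simp
    next
      case 2
      show ?thesis
      proof (cases "c = 0")
        case True
        then show ?thesis using 2 coef_proj[of "pi/2" b n f k] j(3) in_modes[of "pi/2"] by (simp add: coef_neg_pi2)
      next
        case False
        then have c: "c = pi/2" using j by simp
        show ?thesis unfolding c using 2 coef_proj[of 0 b n f k] j(3) in_modes[of 0] by simp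
      qed
    qed
  qed
  have "coef (weak_deriv m (proj n f)) i = (if k \<in> freqs n then coef (weak_deriv m f) i else 0)"
    unfolding j(1) coef_weak_deriv[OF proj_L2 P] coef_weak_deriv[OF sobolev_L2[OF f] F] * by simp
  then show "coef (weak_deriv m (proj n f)) i = coef (proj n (weak_deriv m f)) i"
    using coef_proj[OF j(2,3)] in_modes[OF j(2)] by (simp add: j(1))
qed simp

lemma L2_norm_weak_deriv_proj:
  assumes f: "f \<in> sobolev 1" and m: "fst m + snd m \<le> 1"
  shows "L2_norm (weak_deriv m (proj n f)) \<le> L2_norm (weak_deriv m f)"
    and "L2_norm (weak_deriv m (\<lambda>x. proj n f x - f x)) = L2_norm (\<lambda>x. proj n (weak_deriv m f) x - weak_deriv m f x)"
proof -
  have F: "weak_deriv m f \<in> L2" "weak_deriv m (proj n f) \<in> L2" "weak_deriv m (\<lambda>x. proj n f x - f x) \<in> L2"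
    by (rule sobolev_weak_deriv_L2[OF _ m], intro f proj_sobolev sobolev_diff)+
  have "L2_norm (weak_deriv m (proj n f)) = L2_norm (proj n (weak_deriv m f))"
    by (rule L2_norm_cong_AE[OF weak_deriv_proj[OF f m]]) (use F proj_L2 in \<open>auto intro: L2D\<close>)
  also have "\<dots> \<le> L2_norm (weak_deriv m f)" by (rule proj_norm_le[OF F(1)])
  finally show "L2_norm (weak_deriv m (proj n f)) \<le> L2_norm (weak_deriv m f)" .
  have "AE x in torus. weak_deriv m (\<lambda>x. proj n f x - f x) x = proj n (weak_deriv m f) x - weak_deriv m f x"
    using weak_deriv_diff[OF proj_sobolev[of n f] f m] weak_deriv_proj[OF f m, of n] by eventually_elim simp
  then show "L2_norm (weak_deriv m (\<lambda>x. proj n f x - f x)) = L2_norm (\<lambda>x. proj n (weak_deriv m f) x - weak_deriv m f x)"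
    by (rule L2_norm_cong_AE) (use F proj_L2 in \<open>auto intro!: L2D L2_diff\<close>)
qed

text \<open>Being uniform in \<open>n\<close>, this bound provides the dominating function when an
  element of the dual of \<open>H\<^sup>1\<close> is applied to projections.\<close>

lemma sobolev_norm_proj:
  assumes f: "f \<in> sobolev 1" shows "sobolev_norm 1 (proj n f) \<le> sobolev_norm 1 f"
  unfolding sobolev_norm_def
  by (intro real_sqrt_le_mono sum_mono power_mono L2_norm_weak_deriv_proj(1)[OF f]) auto

lemma sobolev_norm_proj_converges:
  assumes f: "f \<in> sobolev 1" shows "(\<lambda>n. sobolev_norm 1 (\<lambda>x. proj n f x - f x)) \<longlonglongrightarrow> 0"
proof -
  have "(\<lambda>n. L2_norm (weak_deriv m (\<lambda>x. proj n f x - f x))) \<longlonglongrightarrow> 0" if m: "fst m + snd m \<le> 1" for m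
    unfolding L2_norm_weak_deriv_proj(2)[OF f m]
    by (rule proj_converges[OF sobolev_weak_deriv_L2[OF f m]])
  then have "(\<lambda>n. \<Sum>m | fst m + snd m \<le> 1. (L2_norm (weak_deriv m (\<lambda>x. proj n f x - f x)))\<^sup>2) \<longlonglongrightarrow> (\<Sum>m | fst m + snd m \<le> (1::nat). 0\<^sup>2)"
    by (intro tendsto_sum tendsto_power) auto
  from tendsto_real_sqrt[OF this] show ?thesis by (simp add: sobolev_norm_def)
qed

section \<open>The Leray projector\<close>

lemma trig_poly_lincomb:
  assumes "trig_poly f" "trig_poly h" shows "trig_poly (\<lambda>x. r *\<^sub>R f x + s *\<^sub>R h x)"
proof -
  obtain K a c where K: "finite (K :: (int \<times> int) set)" and f: "f = (\<lambda>x. \<Sum>k\<in>K.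
            cos (2 * pi * (of_int (fst k) * x$1 + of_int (snd k) * x$2)) *\<^sub>R a k
          + sin (2 * pi * (of_int (fst k) * x$1 + of_int (snd k) * x$2)) *\<^sub>R c k)"
    using assms(1) unfolding trig_poly_def by blast
  obtain K' a' c' where K': "finite (K' :: (int \<times> int) set)" and h: "h = (\<lambda>x. \<Sum>k\<in>K'.
            cos (2 * pi * (of_int (fst k) * x$1 + of_int (snd k) * x$2)) *\<^sub>R a' k
          + sin (2 * pi * (of_int (fst k) * x$1 + of_int (snd k) * x$2)) *\<^sub>R c' k)"
    using assms(2) unfolding trig_poly_def by blast
  let ?e = "\<lambda>A k. if k \<in> A then 1 else (0::real)"
  have ext: "(\<Sum>k\<in>A. F k) = (\<Sum>k\<in>K \<union> K'. ?e A k *\<^sub>R F k)" if "A \<subseteq> K \<union> K'" for A and F :: "int \<times> int \<Rightarrow> real^2"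
    using K K' that by (intro sum.mono_neutral_cong_left) auto
  show ?thesis unfolding trig_poly_def
  proof (intro exI conjI)
    show "finite (K \<union> K')" using K K' by simp
    show "(\<lambda>x. r *\<^sub>R f x + s *\<^sub>R h x) = (\<lambda>x. \<Sum>k\<in>K \<union> K'.
            cos (2 * pi * (of_int (fst k) * x$1 + of_int (snd k) * x$2)) *\<^sub>R ((r * ?e K k) *\<^sub>R a k + (s * ?e K' k) *\<^sub>R a' k)
          + sin (2 * pi * (of_int (fst k) * x$1 + of_int (snd k) * x$2)) *\<^sub>R ((r * ?e K k) *\<^sub>R c k + (s * ?e K' k) *\<^sub>R c' k))"
      unfolding f h
      by (subst ext[of K], simp, subst ext[of K'], simp)
        (auto simp: scaleR_sum_right sum.distrib[symmetric] scaleR_add_right fun_eq_iff mult_ac intro!: sum.cong)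
  qed
qed

lemma trig_poly_differentiable: 
  assumes "trig_poly f" shows "f differentiable (at x)"
proof -
  obtain K a c where K: "finite (K :: (int \<times> int) set)" and f: "f = (\<lambda>x. \<Sum>k\<in>K.
            cos (2 * pi * (of_int (fst k) * x$1 + of_int (snd k) * x$2)) *\<^sub>R a k
          + sin (2 * pi * (of_int (fst k) * x$1 + of_int (snd k) * x$2)) *\<^sub>R c k)"
    using assms unfolding trig_poly_def by blast
  have "f = (\<lambda>x. \<Sum>k\<in>K. wave k 0 x *\<^sub>R a k + wave k (pi/2) x *\<^sub>R c k)"
    unfolding f by (simp add: wave_def freq_def cos_diff algebra_simps)
  moreover have "(\<lambda>x. \<Sum>k\<in>K. wave k 0 x *\<^sub>R a k + wave k (pi/2) x *\<^sub>R c k) differentiable (at x)"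
    by (intro differentiable_sum K ballI differentiable_add differentiable_scaleR wave_differentiable differentiable_const)
  ultimately show ?thesis by simp
qed

lemma trig_poly_L2: "trig_poly f \<Longrightarrow> f \<in> L2"
  by (intro continuous_imp_L2 differentiable_imp_continuous_on)
    (auto simp: differentiable_on_def trig_poly_differentiable)

lemma div_free_trig_lincomb:
  assumes "f \<in> div_free_trig" "h \<in> div_free_trig" shows "(\<lambda>x. r *\<^sub>R f x + s *\<^sub>R h x) \<in> div_free_trig"
proof -
  have t: "trig_poly f" "trig_poly h" using assms by (auto simp: div_free_trig_def)
  have D: "dir_deriv v (\<lambda>y. (r *\<^sub>R f y + s *\<^sub>R h y) $ i) x = r * dir_deriv v (\<lambda>y. f y $ i) x + s * dir_deriv v (\<lambda>y. h y $ i) x" for v x i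
  proof -
    have d: "((\<lambda>y. F y $ i) has_derivative frechet_derivative (\<lambda>y. F y $ i) (at x)) (at x)" if "trig_poly F" for F
    proof -
      have "(F has_derivative frechet_derivative F (at x)) (at x)"
        using trig_poly_differentiable[OF that] frechet_derivative_works by blast
      from bounded_linear.has_derivative[OF bounded_linear_vec_nth this]
      have "(\<lambda>y. F y $ i) differentiable (at x)" unfolding differentiable_def by blast
      then show ?thesis using frechet_derivative_works by blast
    qed
    have "((\<lambda>y. (r *\<^sub>R f y + s *\<^sub>R h y) $ i) has_derivative (\<lambda>v. r * frechet_derivative (\<lambda>y. f y $ i) (at x) v + s * frechet_derivative (\<lambda>y. h y $ i) (at x) v)) (at x)"
      by (simp, intro derivative_intros d t)
    from frechet_derivative_at[OF this] show ?thesis by (simp add: dir_deriv_def fun_eq_iff)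
  qed
  have int: "(\<integral>x. r *\<^sub>R f x + s *\<^sub>R h x \<partial>torus) = r *\<^sub>R (\<integral>x. f x \<partial>torus) + s *\<^sub>R (\<integral>x. h x \<partial>torus)"
    using integral_norm_le_L2_norm(1)[OF trig_poly_L2[OF t(1)]] integral_norm_le_L2_norm(1)[OF trig_poly_L2[OF t(2)]]
    by (subst Bochner_Integration.integral_add) auto
  have *: "r * x1 + s * y1 + (r * x2 + s * y2) = 0" if "x1 + x2 = 0" "y1 + y2 = 0" for x1 x2 y1 y2
  proof -
    have "r * x1 + s * y1 + (r * x2 + s * y2) = r * (x1 + x2) + s * (y1 + y2)" by (simp add: algebra_simps)
    then show ?thesis using that by simp
  qed
  have "dir_deriv (axis 1 1) (\<lambda>y. (r *\<^sub>R f y + s *\<^sub>R h y) $ 1) x + dir_deriv (axis 2 1) (\<lambda>y. (r *\<^sub>R f y + s *\<^sub>R h y) $ 2) x = 0" for x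
    unfolding D by (rule *) (use assms in \<open>auto simp: div_free_trig_def\<close>)
  with int show ?thesis using assms trig_poly_lincomb[OF t] unfolding div_free_trig_def by simp
qed

lemma H_space_L2: "f \<in> H_space \<Longrightarrow> f \<in> L2"
  by (simp add: H_space_def)

lemma div_free_trig_L2: "f \<in> div_free_trig \<Longrightarrow> f \<in> L2"
  by (simp add: div_free_trig_def trig_poly_L2)

lemma L2_norm_lincomb_le:
  assumes "f \<in> L2" "h \<in> L2" shows "L2_norm (\<lambda>x. r *\<^sub>R f x + s *\<^sub>R h x) \<le> \<bar>r\<bar> * L2_norm f + \<bar>s\<bar> * L2_norm h"
  using L2_norm_triangle[of "\<lambda>x. r *\<^sub>R f x" "\<lambda>x. s *\<^sub>R h x"] assms by (simp add: L2_norm_scaleR)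

lemma H_space_lincomb:
  assumes f: "f \<in> H_space" and h: "h \<in> H_space" shows "(\<lambda>x. r *\<^sub>R f x + s *\<^sub>R h x) \<in> H_space"
  unfolding H_space_def
proof (intro CollectI conjI allI impI)
  show "(\<lambda>x. r *\<^sub>R f x + s *\<^sub>R h x) \<in> L2" by (intro L2_add L2_scaleR H_space_L2 f h)
  fix e :: real assume "e > 0"
  define d where "d = e / (\<bar>r\<bar> + \<bar>s\<bar> + 1)"
  have d: "d > 0" using \<open>e > 0\<close> by (simp add: d_def add_nonneg_pos)
  obtain v where v: "v \<in> div_free_trig" "L2_norm (\<lambda>x. f x - v x) < d" using f d by (auto simp: H_space_def)
  obtain w where w: "w \<in> div_free_trig" "L2_norm (\<lambda>x. h x - w x) < d" using h d by (auto simp: H_space_def)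
  have "L2_norm (\<lambda>x. r *\<^sub>R (f x - v x) + s *\<^sub>R (h x - w x)) \<le> \<bar>r\<bar> * L2_norm (\<lambda>x. f x - v x) + \<bar>s\<bar> * L2_norm (\<lambda>x. h x - w x)"
    using f h v w by (intro L2_norm_lincomb_le L2_diff) (auto intro: H_space_L2 div_free_trig_L2)
  also have "\<dots> \<le> \<bar>r\<bar> * d + \<bar>s\<bar> * d" using v w by (intro add_mono mult_left_mono) auto
  also have "\<dots> < (\<bar>r\<bar> + \<bar>s\<bar> + 1) * d" using d by (simp add: algebra_simps)
  also have "\<dots> = e" by (simp add: d_def)
  finally have "L2_norm (\<lambda>x. r *\<^sub>R (f x - v x) + s *\<^sub>R (h x - w x)) < e" .
  then have "L2_norm (\<lambda>x. (r *\<^sub>R f x + s *\<^sub>R h x) - (r *\<^sub>R v x + s *\<^sub>R w x)) < e" by (simp add: algebra_simps)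
  then show "\<exists>v\<in>div_free_trig. L2_norm (\<lambda>x. (r *\<^sub>R f x + s *\<^sub>R h x) - v x) < e"
    using div_free_trig_lincomb[OF v(1) w(1)] by (intro bexI[of _ "\<lambda>x. r *\<^sub>R v x + s *\<^sub>R w x"])
qed

lemma H_space_diff: "f \<in> H_space \<Longrightarrow> h \<in> H_space \<Longrightarrow> (\<lambda>x. f x - h x) \<in> H_space"
  using H_space_lincomb[of f h 1 "-1"] by simp

lemma zero_in_H_space: "(\<lambda>x. 0) \<in> H_space"
proof -
  have "(\<lambda>x. 0) \<in> div_free_trig"
    by (auto simp: div_free_trig_def trig_poly_def dir_deriv_def intro: exI[of _ "{}"])
  then show ?thesis unfolding H_space_def by (auto intro!: bexI[of _ "\<lambda>x. 0"] simp: L2_norm_def)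
qed

lemma H_space_closed:
  assumes s: "\<And>n. s n \<in> H_space" and h: "h \<in> L2" and lim: "(\<lambda>n. L2_norm (\<lambda>x. s n x - h x)) \<longlonglongrightarrow> 0"
  shows "h \<in> H_space"
  unfolding H_space_def
proof (intro CollectI conjI allI impI h)
  fix e :: real assume "e > 0"
  then obtain n where n: "L2_norm (\<lambda>x. s n x - h x) < e/2"
    using order_tendstoD(2)[OF lim, of "e/2"] by (auto simp: eventually_sequentially)
  obtain v where v: "v \<in> div_free_trig" "L2_norm (\<lambda>x. s n x - v x) < e/2"
    using s[of n] \<open>e > 0\<close> by (auto simp: H_space_def dest: spec[of _ "e/2"])
  have "L2_norm (\<lambda>x. h x - v x) \<le> L2_norm (\<lambda>x. h x - s n x) + L2_norm (\<lambda>x. s n x - v x)"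
    by (rule L2_norm_triangle_diff) (use h s v in \<open>auto intro: H_space_L2 div_free_trig_L2\<close>)
  also have "\<dots> < e" using n v by (simp add: L2_norm_minus_commute[of h])
  finally show "\<exists>v\<in>div_free_trig. L2_norm (\<lambda>x. h x - v x) < e" using v(1) by blast
qed

section \<open>Nearest points in \<open>H_space\<close> and the Leray projector\<close>

lemma orthogonal_of_minimal:
  fixes b c :: real
  assumes "\<And>t. 2 * t * b \<le> t\<^sup>2 * c" shows "b = 0"
proof (rule ccontr)
  assume b: "b \<noteq> 0"
  \<comment> \<open>For this multiple of \<open>b\<close> the quadratic term is at most half of the
    linear one; adding one keeps the denominator positive.\<close>
  define t where "t = b / (\<bar>c\<bar> + 1)"
  have pos: "\<bar>c\<bar> + 1 > 0" by simp
  have "2 * t * b = 2 * b\<^sup>2 / (\<bar>c\<bar> + 1)" by (simp add: t_def power2_eq_square)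
  moreover have "t\<^sup>2 * c \<le> t\<^sup>2 * (\<bar>c\<bar> + 1)" by (intro mult_left_mono) auto
  moreover have "t\<^sup>2 * (\<bar>c\<bar> + 1) = b\<^sup>2 / (\<bar>c\<bar> + 1)" using pos by (simp add: t_def power2_eq_square)
  ultimately have "2 * (b\<^sup>2 / (\<bar>c\<bar> + 1)) \<le> b\<^sup>2 / (\<bar>c\<bar> + 1)" using assms[of t] by simp
  moreover have "b\<^sup>2 / (\<bar>c\<bar> + 1) > 0" using b pos by simp
  ultimately show False by linarith
qed

lemma L2_parallelogram:
  assumes "p \<in> L2" "q \<in> L2"
  shows "(L2_norm (\<lambda>x. p x - q x))\<^sup>2 + (L2_norm (\<lambda>x. p x + q x))\<^sup>2 = 2 * (L2_norm p)\<^sup>2 + 2 * (L2_norm q)\<^sup>2"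
  using assms by (simp add: L2_norm_add_power2 L2_norm_diff_power2)

text \<open>\<open>leray\<close> is defined by choice, so its properties depend on existence. The
  parallelogram law makes a minimising sequence Cauchy because midpoints stay in
  \<open>H_space\<close>; the limit stays there by closedness, and the first variation at the
  minimiser is the orthogonality.\<close>

lemma H_projection_exists:
  assumes f: "f \<in> L2"
  shows "\<exists>h. h \<in> H_space \<and> (\<forall>v\<in>H_space. L2_inner (\<lambda>x. f x - h x) v = 0)"
proof -
  define S where "S = (\<lambda>v. (L2_norm (\<lambda>x. f x - v x))\<^sup>2) ` H_space"
  define d where "d = Inf S"
  have bb: "bdd_below S" unfolding S_def by (rule bdd_belowI2[of _ 0]) simp
  have ne: "S \<noteq> {}" using zero_in_H_space by (auto simp: S_def)
  have le: "d \<le> (L2_norm (\<lambda>x. f x - v x))\<^sup>2" if "v \<in> H_space" for v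
    unfolding d_def using bb that by (intro cInf_lower) (auto simp: S_def)
  have "\<exists>v\<in>H_space. (L2_norm (\<lambda>x. f x - v x))\<^sup>2 < d + 1 / real (Suc n)" for n
    using cInf_lessD[OF ne, of "d + 1 / real (Suc n)"] by (auto simp: d_def S_def)
  then obtain s where s: "\<And>n. s n \<in> H_space" "\<And>n. (L2_norm (\<lambda>x. f x - s n x))\<^sup>2 < d + 1 / real (Suc n)" by metis
  have sL: "s n \<in> L2" for n using s(1) by (rule H_space_L2)
  have par: "(L2_norm (\<lambda>x. s n x - s m x))\<^sup>2 \<le> 2 / real (Suc n) + 2 / real (Suc m)" for n m
  proof -
    let ?p = "\<lambda>x. f x - s n x" and ?q = "\<lambda>x. f x - s m x"
    have L: "?p \<in> L2" "?q \<in> L2" using f sL by auto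
    have 1: "(L2_norm (\<lambda>x. ?p x - ?q x))\<^sup>2 + (L2_norm (\<lambda>x. ?p x + ?q x))\<^sup>2 = 2 * (L2_norm ?p)\<^sup>2 + 2 * (L2_norm ?q)\<^sup>2"
      by (rule L2_parallelogram[OF L])
    have "(\<lambda>x. (1/2) *\<^sub>R s n x + (1/2) *\<^sub>R s m x) \<in> H_space" by (intro H_space_lincomb s)
    from le[OF this] have "4 * d \<le> 4 * (L2_norm (\<lambda>x. f x - ((1/2) *\<^sub>R s n x + (1/2) *\<^sub>R s m x)))\<^sup>2" by simp
    also have "\<dots> = (L2_norm (\<lambda>x. 2 *\<^sub>R (f x - ((1/2) *\<^sub>R s n x + (1/2) *\<^sub>R s m x))))\<^sup>2"
      by (simp only: L2_norm_scaleR) (simp add: power_mult_distrib)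
    also have "(\<lambda>x. 2 *\<^sub>R (f x - ((1/2) *\<^sub>R s n x + (1/2) *\<^sub>R s m x))) = (\<lambda>x. ?p x + ?q x)"
      by (simp add: scaleR_2 algebra_simps)
    finally have 2: "4 * d \<le> (L2_norm (\<lambda>x. ?p x + ?q x))\<^sup>2" .
    have 3: "(\<lambda>x. ?p x - ?q x) = (\<lambda>x. s m x - s n x)" by simp
    have "2 * (L2_norm ?p)\<^sup>2 + 2 * (L2_norm ?q)\<^sup>2 \<le> 2 * (d + 1 / real (Suc n)) + 2 * (d + 1 / real (Suc m))"
      using s(2)[of n] s(2)[of m] by (intro add_mono mult_left_mono) auto
    also have "\<dots> = 4 * d + (2 / real (Suc n) + 2 / real (Suc m))" by (simp add: distrib_left)
    finally show ?thesis using 1 2 unfolding 3 by (simp add: L2_norm_minus_commute[of "s m"])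
  qed
  have "\<exists>N. \<forall>i\<ge>N. \<forall>j\<ge>N. L2_norm (\<lambda>x. s i x - s j x) < e" if "e > 0" for e
  proof -
    obtain N where N: "1 / real (Suc N) < e\<^sup>2 / 4" using nat_approx_posE[of "e\<^sup>2/4"] \<open>e > 0\<close> by auto
    have "L2_norm (\<lambda>x. s i x - s j x) < e" if "i \<ge> N" "j \<ge> N" for i j
    proof (rule power2_less_imp_less)
      have "1 / real (Suc i) \<le> 1 / real (Suc N)" "1 / real (Suc j) \<le> 1 / real (Suc N)"
        using that by (auto intro!: divide_left_mono mult_pos_pos)
      then show "(L2_norm (\<lambda>x. s i x - s j x))\<^sup>2 < e\<^sup>2" using par[of i j] N by linarith
    qed (use \<open>e > 0\<close> in simp)
    then show ?thesis by blast
  qed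
  from L2_complete[OF sL this] obtain h where h: "h \<in> L2" "(\<lambda>n. L2_norm (\<lambda>x. s n x - h x)) \<longlonglongrightarrow> 0" by blast
  have hH: "h \<in> H_space" by (rule H_space_closed[OF s(1) h])
  have d0: "0 \<le> d" unfolding d_def by (intro cInf_greatest ne) (auto simp: S_def)
  have "L2_norm (\<lambda>x. f x - h x) \<le> sqrt d"
  proof (rule LIMSEQ_le_const)
    have "(\<lambda>n. sqrt (d + 1 / real (Suc n)) + L2_norm (\<lambda>x. s n x - h x)) \<longlonglongrightarrow> sqrt (d + 0) + 0"
      by (intro tendsto_intros h LIMSEQ_inverse_real_of_nat[unfolded inverse_eq_divide])
    then show "(\<lambda>n. sqrt (d + 1 / real (Suc n)) + L2_norm (\<lambda>x. s n x - h x)) \<longlonglongrightarrow> sqrt d" by simp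
    have "L2_norm (\<lambda>x. f x - h x) \<le> sqrt (d + 1 / real (Suc n)) + L2_norm (\<lambda>x. s n x - h x)" for n
    proof -
      have "L2_norm (\<lambda>x. f x - s n x) \<le> sqrt (d + 1 / real (Suc n))"
        using s(2)[of n] by (intro real_le_rsqrt) auto
      then show ?thesis using L2_norm_triangle_diff[OF f sL[of n] h(1)] by linarith
    qed
    then show "\<exists>N. \<forall>n\<ge>N. L2_norm (\<lambda>x. f x - h x) \<le> sqrt (d + 1 / real (Suc n)) + L2_norm (\<lambda>x. s n x - h x)" by blast
  qed
  then have "(L2_norm (\<lambda>x. f x - h x))\<^sup>2 \<le> (sqrt d)\<^sup>2" by (intro power_mono) auto
  then have fh: "(L2_norm (\<lambda>x. f x - h x))\<^sup>2 \<le> d" using d0 by simp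
  have "L2_inner (\<lambda>x. f x - h x) v = 0" if v: "v \<in> H_space" for v
  proof (rule orthogonal_of_minimal[where c="(L2_norm v)\<^sup>2"])
    fix t :: real
    have "(\<lambda>x. 1 *\<^sub>R h x + t *\<^sub>R v x) \<in> H_space" by (intro H_space_lincomb hH v)
    from le[OF this] have "d \<le> (L2_norm (\<lambda>x. (f x - h x) - t *\<^sub>R v x))\<^sup>2" by (simp add: algebra_simps)
    also have "\<dots> = (L2_norm (\<lambda>x. f x - h x))\<^sup>2 - 2 * t * L2_inner (\<lambda>x. f x - h x) v + t\<^sup>2 * (L2_norm v)\<^sup>2"
      using f h v by (subst L2_norm_diff_power2) (auto intro: H_space_L2 simp: L2_inner_scaleR_right L2_norm_scaleR power_mult_distrib)
    finally show "2 * t * L2_inner (\<lambda>x. f x - h x) v \<le> t\<^sup>2 * (L2_norm v)\<^sup>2" using fh by linarith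
  qed
  with hH show ?thesis by blast
qed

lemma leray_props:
  assumes f: "f \<in> L2"
  shows "leray f \<in> H_space" and "v \<in> H_space \<Longrightarrow> L2_inner (leray f) v = L2_inner f v"
proof -
  have *: "leray f \<in> H_space \<and> (\<forall>v\<in>H_space. L2_inner (\<lambda>x. f x - leray f x) v = 0)"
    unfolding leray_def by (rule someI_ex[OF H_projection_exists[OF f]])
  then show "leray f \<in> H_space" by blast
  assume v: "v \<in> H_space"
  then have "L2_inner f v - L2_inner (leray f) v = 0"
    using * f by (subst L2_inner_diff_left[symmetric]) (auto intro: H_space_L2)
  then show "L2_inner (leray f) v = L2_inner f v" by simp
qed

lemma leray_L2: "f \<in> L2 \<Longrightarrow> leray f \<in> L2"
  using leray_props(1) H_space_L2 by blast

lemma V_space_sobolev: "f \<in> V_space \<Longrightarrow> f \<in> sobolev 1"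
  by (simp add: V_space_def)

lemma V_space_H_space:
  assumes f: "f \<in> V_space" shows "f \<in> H_space"
  unfolding H_space_def
proof (intro CollectI conjI allI impI)
  show fL: "f \<in> L2" using f V_space_sobolev sobolev_L2 by blast
  fix e :: real assume "e > 0"
  then obtain v where v: "v \<in> div_free_trig" "sobolev_norm 1 (\<lambda>x. f x - v x) < e" using f by (auto simp: V_space_def)
  have "L2_norm (\<lambda>x. f x - v x) \<le> sobolev_norm 1 (\<lambda>x. f x - v x)"
    using fL div_free_trig_L2[OF v(1)] by (intro L2_norm_le_sobolev_norm_0) auto
  with v show "\<exists>v\<in>div_free_trig. L2_norm (\<lambda>x. f x - v x) < e" by force
qed

text \<open>Membership of \<open>v\<close> in \<open>H_space\<close> removes the projector; one weak
  derivative of \<open>v\<close> allows integration by parts of the two pure second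
  derivatives.\<close>

lemma stokes_inner:
  assumes u: "u \<in> sobolev 2" and v: "v \<in> H_space" "v \<in> sobolev 1"
  shows "stokes u \<in> L2" and "L2_inner (stokes u) v = L2_inner (D1 u) (D1 v) + L2_inner (D2 u) (D2 v)"
proof -
  have L: "weak_deriv (2,0) u \<in> L2" "weak_deriv (0,2) u \<in> L2"
    by (rule sobolev_weak_deriv_L2[OF u], simp)+
  show "stokes u \<in> L2" unfolding stokes_def using leray_L2[OF L2_add[OF L]] by auto
  have "L2_inner (stokes u) v = - (L2_inner (weak_deriv (2,0) u) v + L2_inner (weak_deriv (0,2) u) v)"
    unfolding stokes_def L2_inner_minus_left leray_props(2)[OF L2_add[OF L] v(1)]
    using L v by (simp add: L2_inner_add_left sobolev_L2)
  then show "L2_inner (stokes u) v = L2_inner (D1 u) (D1 v) + L2_inner (D2 u) (D2 v)"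
    using weak_deriv_2_parts[OF u v(2), of "(1,0)"] weak_deriv_2_parts[OF u v(2), of "(0,1)"] by simp
qed

section \<open>Smooth cut-off functions and the fundamental theorem for weak time derivatives\<close>

text \<open>A sequence in which each function differentiates to the next is a certificate of
  smoothness: on the real line the only basis direction is \<open>1\<close>, so iterated derivatives
  are counted by the length of the list.\<close>

lemma smoothI:
  fixes F :: "nat \<Rightarrow> real \<Rightarrow> real"
  assumes F: "\<And>k x. (F k has_real_derivative F (Suc k) x) (at x)"
  shows "smooth (F 0)" and "deriv (F 0) = F 1"
proof -
  have d: "dir_deriv 1 (F k) = F (Suc k)" for k
  proof
    fix x
    have "(F k has_derivative (*) (F (Suc k) x)) (at x)" using F[of k x] by (simp add: has_field_derivative_def)
    from fun_cong[OF frechet_derivative_at[OF this], of 1] show "dir_deriv 1 (F k) x = F (Suc k) x"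
      by (simp add: dir_deriv_def)
  qed
  have "foldr dir_deriv vs (F 0) = F (length vs)" if "set vs \<subseteq> Basis" for vs
    using that by (induction vs) (auto simp: d)
  moreover have "F k differentiable_on UNIV" for k
    unfolding differentiable_on_def real_differentiable_def using F by blast
  ultimately show "smooth (F 0)" unfolding smooth_def by metis
  show "deriv (F 0) = F 1" using F[of 0] by (auto simp: fun_eq_iff intro: DERIV_imp_deriv)
qed

text \<open>For \<open>p = 1\<close> and \<open>n = 0\<close> this is the standard compactly
  supported bump on the unit interval. The polynomial and the power make the family closed under
  differentiation.\<close>

definition bump :: "real poly \<Rightarrow> nat \<Rightarrow> real \<Rightarrow> real" where
  "bump p n x = (if 0 < x \<and> x < 1 then poly p x * inverse (x * (1 - x)) ^ n * exp (- inverse (x * (1 - x))) else 0)"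

lemma power_le_exp:
  fixes r :: real assumes "0 \<le> r" "0 < m" shows "r ^ m \<le> real m ^ m * exp r"
proof -
  have "(r / real m) ^ m \<le> (1 + r / real m) ^ m" using assms by (intro power_mono) auto
  also have "\<dots> \<le> exp r" using assms by (intro exp_ge_one_plus_x_over_n_power_n) auto
  finally show ?thesis using assms by (simp add: power_divide field_simps)
qed

text \<open>With \<open>q = x * (1 - x)\<close>, the exponential absorbs \<open>n + 2\<close> powers
  of \<open>inverse q\<close>, two more than are present, which leaves a factor
  \<open>q\<^sup>2\<close>. This quadratic flatness at both endpoints yields differentiability
  there.\<close>

lemma bump_bound: 
  obtains K where "\<And>x. \<bar>bump p n x\<bar> \<le> K * x\<^sup>2" "\<And>x. \<bar>bump p n x\<bar> \<le> K * (x - 1)\<^sup>2"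
proof -
  have "bounded (poly p ` {0..1})" by (intro compact_imp_bounded compact_continuous_image continuous_intros) auto
  then obtain P where "\<forall>x\<in>{0..1}. \<bar>poly p x\<bar> \<le> P" by (auto simp: bounded_iff)
  then have P: "\<And>x. x \<in> {0..1} \<Longrightarrow> \<bar>poly p x\<bar> \<le> P" by blast
  have P0: "0 \<le> P" using P[of 0] by auto
  define K where "K = P * real (n + 2) ^ (n + 2)"
  have K0: "0 \<le> K" using P0 by (simp add: K_def)
  have main: "\<bar>bump p n x\<bar> \<le> K * (x * (1 - x))\<^sup>2" if "0 < x" "x < 1" for x
  proof -
    define q where "q = x * (1 - x)"
    have q: "0 < q" using that by (simp add: q_def)
    have "inverse q ^ n * exp (- inverse q) = (inverse q ^ (n + 2) * exp (- inverse q)) * q\<^sup>2"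
      using q by (simp add: power_add field_simps power2_eq_square)
    also have "\<dots> \<le> real (n + 2) ^ (n + 2) * q\<^sup>2"
    proof (rule mult_right_mono)
      have "inverse q ^ (n + 2) \<le> real (n + 2) ^ (n + 2) * exp (inverse q)" using q by (intro power_le_exp) auto
      then have "inverse q ^ (n + 2) * exp (- inverse q) \<le> real (n + 2) ^ (n + 2) * exp (inverse q) * exp (- inverse q)"
        by (intro mult_right_mono) auto
      then show "inverse q ^ (n + 2) * exp (- inverse q) \<le> real (n + 2) ^ (n + 2)"
        by (simp add: mult.assoc flip: exp_add)
    qed simp
    finally have 1: "inverse q ^ n * exp (- inverse q) \<le> real (n + 2) ^ (n + 2) * q\<^sup>2" .
    have "\<bar>bump p n x\<bar> = \<bar>poly p x\<bar> * (inverse q ^ n * exp (- inverse q))"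
      using that q by (simp add: bump_def q_def abs_mult)
    also have "\<dots> \<le> P * (real (n + 2) ^ (n + 2) * q\<^sup>2)"
      using that q P0 by (intro mult_mono P 1) auto
    finally show ?thesis by (simp add: K_def q_def mult.assoc)
  qed
  have "\<bar>bump p n x\<bar> \<le> K * x\<^sup>2" "\<bar>bump p n x\<bar> \<le> K * (x - 1)\<^sup>2" for x
  proof -
    have "\<bar>bump p n x\<bar> \<le> K * x\<^sup>2 \<and> \<bar>bump p n x\<bar> \<le> K * (x - 1)\<^sup>2"
    proof (cases "0 < x \<and> x < 1")
      case True
      then have "(x * (1 - x))\<^sup>2 \<le> x\<^sup>2" "(x * (1 - x))\<^sup>2 \<le> (1 - x)\<^sup>2"
        by (auto intro!: power_mono simp: mult_left_le mult_left_le_one_le)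
      then show ?thesis using main[of x] True K0 mult_left_mono[of _ _ K] 
        by (metis order_trans power2_commute)
    next
      case False
      then show ?thesis using K0 by (auto simp: bump_def)
    qed
    then show "\<bar>bump p n x\<bar> \<le> K * x\<^sup>2" "\<bar>bump p n x\<bar> \<le> K * (x - 1)\<^sup>2" by auto
  qed
  then show ?thesis using that by blast
qed

lemma DERIV_quadratic_bound:
  fixes f :: "real \<Rightarrow> real"
  assumes "\<And>x. \<bar>f x\<bar> \<le> K * (x - a)\<^sup>2" shows "(f has_real_derivative 0) (at a)"
proof -
  have fa: "f a = 0" using assms[of a] by simp
  have "(\<lambda>h. (f (a + h) - f a) / h) \<midarrow>0\<rightarrow> 0"
  proof (rule tendsto_rabs_zero_cancel, rule tendsto_sandwich[OF _ _ tendsto_const])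
    show "((\<lambda>h. K * \<bar>h\<bar>) \<longlongrightarrow> 0) (at 0)" by (rule tendsto_eq_intros | simp)+
    have "\<bar>(f (a + h) - f a) / h\<bar> \<le> K * \<bar>h\<bar>" if "h \<noteq> 0" for h
      using assms[of "a + h"] that by (simp add: fa abs_divide divide_le_eq power2_eq_square abs_mult[symmetric] mult.assoc)
    then show "\<forall>\<^sub>F h in at 0. \<bar>(f (a + h) - f a) / h\<bar> \<le> K * \<bar>h\<bar>"
      by (simp add: eventually_at_filter)
  qed auto
  then show ?thesis by (simp add: DERIV_def)
qed

lemma bump_deriv: "\<exists>p'. \<forall>x. (bump p n has_real_derivative bump p' (n + 2) x) (at x)"
proof -
  define q where "q = ([:0, 1, -1:] :: real poly)"
  define q' where "q' = ([:1, -2:] :: real poly)"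
  \<comment> \<open>With \<open>r = inverse q\<close>, the derivative of \<open>r\<close> is
    \<open>- q' * r\<^sup>2\<close>. The three terms of the product rule carry \<open>r\<close> to
    the powers \<open>n\<close>, \<open>n + 1\<close> and \<open>n + 2\<close>; powers of
    \<open>q\<close> bring them all to \<open>n + 2\<close>.\<close>
  define p' where "p' = pderiv p * q\<^sup>2 - smult (real n) (p * q * q') + p * q'"
  have qx: "poly q x = x * (1 - x)" "poly q' x = 1 - 2 * x" for x by (auto simp: q_def q'_def algebra_simps)
  have "(bump p n has_real_derivative bump p' (n + 2) x) (at x)" for x
  proof -
    consider "x < 0 \<or> 1 < x" | "x = 0" | "x = 1" | "0 < x" "x < 1" by linarith
    then show ?thesis
    proof cases
      case 1
      have "((\<lambda>x. 0) has_real_derivative 0) (at x)" by simp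
      moreover have "open ({..<0} \<union> {1::real<..})" by auto
      ultimately have "(bump p n has_real_derivative 0) (at x)"
        by (rule has_field_derivative_transform_within_open) (use 1 in \<open>auto simp: bump_def\<close>)
      moreover have "bump p' (n + 2) x = 0" using 1 by (auto simp: bump_def)
      ultimately show ?thesis by (simp only:)
    next
      case 2
      obtain K where "\<And>x. \<bar>bump p n x\<bar> \<le> K * x\<^sup>2" using bump_bound by metis
      then have "(bump p n has_real_derivative 0) (at 0)" using DERIV_quadratic_bound[of "bump p n" K 0] by simp
      moreover have "bump p' (n + 2) 0 = 0" by (simp add: bump_def)
      ultimately show ?thesis unfolding 2 by (simp only:)
    next
      case 3
      obtain K where "\<And>x. \<bar>bump p n x\<bar> \<le> K * (x - 1)\<^sup>2" using bump_bound by metis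
      then have "(bump p n has_real_derivative 0) (at 1)" using DERIV_quadratic_bound[of "bump p n" K 1] by simp
      moreover have "bump p' (n + 2) 1 = 0" by (simp add: bump_def)
      ultimately show ?thesis unfolding 3 by (simp only:)
    next
      case 4
      define r where "r y = inverse (y * (1 - y))" for y :: real
      have q0: "x * (1 - x) \<noteq> 0" using 4 by simp
      have qr: "poly q x * r x = 1" using right_inverse[OF q0] by (simp only: qx r_def)
      have dr: "(r has_real_derivative - ((1 - 2 * x) * (r x)\<^sup>2)) (at x)"
        unfolding r_def using q0 by (auto intro!: derivative_eq_intros simp: power2_eq_square divide_simps) 
      have dn: "real n * r x ^ (n - 1) * (r x)\<^sup>2 = real n * poly q x * r x ^ (n + 2)"
      proof (cases n)
        case (Suc m)
        have "poly q x * r x ^ (n + 2) = (poly q x * r x) * r x ^ (n + 1)" by (simp add: mult_ac)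
        then have "poly q x * r x ^ (n + 2) = r x ^ (n + 1)" unfolding qr by simp
        then show ?thesis by (simp only: mult.assoc[of "real n"]) (simp add: Suc power2_eq_square)
      qed simp
      have dq: "r x ^ n = (poly q x)\<^sup>2 * r x ^ (n + 2)"
      proof -
        have "(poly q x)\<^sup>2 * r x ^ (n + 2) = (poly q x * r x)\<^sup>2 * r x ^ n" by (simp add: power2_eq_square)
        then show ?thesis by (simp add: qr)
      qed
      have "((\<lambda>y. poly p y * r y ^ n * exp (- r y)) has_real_derivative
          (poly (pderiv p) x * r x ^ n + poly p x * (real n * r x ^ (n - 1) * - ((1 - 2 * x) * (r x)\<^sup>2))) * exp (- r x)
          + poly p x * r x ^ n * (exp (- r x) * ((1 - 2 * x) * (r x)\<^sup>2))) (at x)"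
        by (rule derivative_eq_intros dr poly_DERIV refl | simp)+
      also have "(poly (pderiv p) x * r x ^ n + poly p x * (real n * r x ^ (n - 1) * - ((1 - 2 * x) * (r x)\<^sup>2))) * exp (- r x)
          + poly p x * r x ^ n * (exp (- r x) * ((1 - 2 * x) * (r x)\<^sup>2))
        = (poly (pderiv p) x * r x ^ n - poly p x * (1 - 2 * x) * (real n * r x ^ (n - 1) * (r x)\<^sup>2) + poly p x * (1 - 2 * x) * r x ^ (n + 2)) * exp (- r x)"
        by (simp add: algebra_simps power_add power2_eq_square)
      also have "\<dots> = poly p' x * r x ^ (n + 2) * exp (- r x)"
        unfolding dn by (subst dq) (simp add: p'_def qx(2) algebra_simps)
      finally have "((\<lambda>y. poly p y * r y ^ n * exp (- r y)) has_real_derivative bump p' (n + 2) x) (at x)"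
        using 4 by (simp add: bump_def r_def)
      then show ?thesis
        by (rule has_field_derivative_transform_within_open[of _ _ _ "{0<..<1}"]) (use 4 in \<open>auto simp: bump_def r_def\<close>)
    qed
  qed
  then show ?thesis by blast
qed

text \<open>The primitive of the standard bump, divided by its total mass. The whole sequence of
  derivatives is returned, as \<open>smoothI\<close> asks for it; from the first derivative on these
  are scaled bumps whose power grows by two per derivative.\<close>

lemma smooth_step:
  obtains F :: "nat \<Rightarrow> real \<Rightarrow> real" where
    "\<And>k x. (F k has_real_derivative F (Suc k) x) (at x)"
    "\<And>x. x \<le> 0 \<Longrightarrow> F 0 x = 0" "\<And>x. 1 \<le> x \<Longrightarrow> F 0 x = 1"
    "\<And>x. 0 \<le> F 1 x" "\<And>x. x \<notin> {0..1} \<Longrightarrow> F 1 x = 0"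
proof -
  obtain D where D: "\<And>p n x. (bump p n has_real_derivative bump (D p n) (n + 2) x) (at x)"
    using bump_deriv by metis
  define P where "P = rec_nat 1 (\<lambda>k p. D p (2 * k))"
  have P: "P 0 = 1" "P (Suc k) = D (P k) (2 * k)" for k by (auto simp: P_def)
  define \<beta> where "\<beta> = bump 1 0"
  have \<beta>: "0 \<le> \<beta> x" "x \<notin> {0..1} \<Longrightarrow> \<beta> x = 0" "0 < x \<Longrightarrow> x < 1 \<Longrightarrow> 0 < \<beta> x" "x \<le> 0 \<Longrightarrow> \<beta> x = 0" "1 \<le> x \<Longrightarrow> \<beta> x = 0" for x
    by (auto simp: \<beta>_def bump_def)
  have \<beta>c: "continuous_on A \<beta>" for A
    using D[of 1 0] unfolding \<beta>_def[symmetric] by (meson DERIV_continuous_on has_field_derivative_at_within)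
  \<comment> \<open>Starting the integral at \<open>-1\<close> makes every \<open>x \<ge> 0\<close>
    interior to the interval on which the primitive is differentiated.\<close>
  define S where "S x = integral {-1..x} \<beta>" for x
  have S0: "S x = 0" if "x \<le> 0" for x
    unfolding S_def using \<beta>(4) that by (intro integral_unique has_integral_is_0) auto
  have S: "(S has_real_derivative \<beta> x) (at x)" for x
  proof (cases "x < 0")
    case True
    have "((\<lambda>x. 0) has_real_derivative 0) (at x)" by simp
    then have "(S has_real_derivative 0) (at x)"
      by (rule has_field_derivative_transform_within_open[of _ _ _ "{..<0}"]) (use True S0 in auto)
    then show ?thesis using True \<beta>(4) by simp
  next
    case False
    have "(S has_real_derivative \<beta> x) (at x within {-1..x+1})"
      unfolding S_def using False by (intro integral_has_real_derivative \<beta>c) auto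
    then show ?thesis using False at_within_Icc_at[of "-1" x "x + 1"] by simp
  qed
  have S1: "0 < S 1"
  proof -
    have "S 0 < S 1"
      by (rule DERIV_pos_imp_increasing_open) (use S \<beta>(3) in \<open>auto intro!: DERIV_continuous_on[of _ _ \<beta>] intro: has_field_derivative_at_within\<close>)
    then show ?thesis using S0[of 0] by simp
  qed
  have Sge: "S x = S 1" if "1 \<le> x" for x
  proof (cases "x = 1")
    case False
    then have "1 < x" using that by simp
    from MVT2[OF this, of S \<beta>] S obtain z where "1 < z" "S x - S 1 = (x - 1) * \<beta> z" by auto
    then show ?thesis using \<beta>(5)[of z] by simp
  qed simp
  define F where "F k x = (case k of 0 \<Rightarrow> S x / S 1 | Suc k \<Rightarrow> bump (P k) (2 * k) x / S 1)" for k x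
  have F1: "F 1 x = \<beta> x / S 1" for x by (simp add: F_def P \<beta>_def)
  show ?thesis
  proof (rule that)
    show "(F k has_real_derivative F (Suc k) x) (at x)" for k x
    proof (cases k)
      case 0
      then show ?thesis using DERIV_cdivide[OF S[of x], of "S 1"] by (simp add: F_def[abs_def] P \<beta>_def)
    next
      case (Suc j)
      then show ?thesis using DERIV_cdivide[OF D[of "P j" "2 * j" x], of "S 1"] by (simp add: F_def[abs_def] P)
    qed
    show "x \<le> 0 \<Longrightarrow> F 0 x = 0" "1 \<le> x \<Longrightarrow> F 0 x = 1" for x using S0 Sge[of x] S1 by (auto simp: F_def)
    show "0 \<le> F 1 x" "x \<notin> {0..1} \<Longrightarrow> F 1 x = 0" for x using \<beta>(1,2)[of x] S1 unfolding F1 by auto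
  qed
qed

section \<open>Primitives on a time interval, the weak fundamental theorem, the chain rule and
  Gronwall's lemma\<close>

lemma integral_split:
  fixes f :: "real \<Rightarrow> real"
  assumes "integrable (lebesgue_on {0..T}) f" "0 \<le> s" "s \<le> t" "t \<le> T"
  shows "(LINT r|lebesgue_on {0..t}. f r) = (LINT r|lebesgue_on {0..s}. f r) + (LINT r|lebesgue_on {s..t}. f r)"
  by (rule integral_combine) (use assms integrable_subinterval[OF assms(1)] in auto)

lemma indefinite_integral_continuous:
  fixes f :: "real \<Rightarrow> real"
  assumes "integrable (lebesgue_on {0..T}) f"
  shows "continuous_on {0..T} (\<lambda>t. LINT r|lebesgue_on {0..t}. f r)"
proof -
  have "continuous_on {0..T} (\<lambda>t. integral {0..t} f)"
    by (intro indefinite_integral_continuous_1 integrable_on_lebesgue_on assms) auto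
  then show ?thesis
    by (rule continuous_on_eq)
      (use integrable_subinterval[OF assms] in \<open>auto intro!: lebesgue_integral_eq_integral[symmetric]\<close>)
qed

lemma integrable_mult_continuous:
  fixes f g :: "real \<Rightarrow> real"
  assumes f: "integrable (lebesgue_on {a..b}) f" and g: "continuous_on {a..b} g"
  shows "integrable (lebesgue_on {a..b}) (\<lambda>x. g x * f x)"
proof -
  have "bounded (g ` {a..b})" using g by (intro compact_imp_bounded compact_continuous_image) auto
  then obtain B where "\<forall>x\<in>{a..b}. \<bar>g x\<bar> \<le> B" by (auto simp: bounded_iff)
  then have B: "\<And>x. x \<in> {a..b} \<Longrightarrow> \<bar>g x\<bar> \<le> B" by blast
  show ?thesis
  proof (rule Bochner_Integration.integrable_bound)
    show "integrable (lebesgue_on {a..b}) (\<lambda>x. B * f x)" using f by simp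
    have "g \<in> borel_measurable (lebesgue_on {a..b})" using g by (intro continuous_imp_measurable_on_sets_lebesgue) auto
    then show "(\<lambda>x. g x * f x) \<in> borel_measurable (lebesgue_on {a..b})" using f by auto
    show "AE x in lebesgue_on {a..b}. norm (g x * f x) \<le> norm (B * f x)"
    proof (rule AE_I2)
      fix x assume "x \<in> space (lebesgue_on {a..b})"
      then have "\<bar>g x\<bar> \<le> \<bar>B\<bar>" using B[of x] by auto
      then show "norm (g x * f x) \<le> norm (B * f x)" by (simp add: abs_mult mult_right_mono)
    qed
  qed
qed

text \<open>The kernel is nonnegative, has mass one for large \<open>n\<close> and lives on
  \<open>{a..a + 1/n}\<close>, to the right of \<open>a\<close>.\<close>

lemma approximate_identity:
  fixes F0 F1 c :: "real \<Rightarrow> real"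
  assumes F: "\<And>x. (F0 has_real_derivative F1 x) (at x)" "continuous_on UNIV F1"
      "\<And>x. x \<le> 0 \<Longrightarrow> F0 x = 0" "\<And>x. 1 \<le> x \<Longrightarrow> F0 x = 1"
      "\<And>x. 0 \<le> F1 x" "\<And>x. x \<notin> {0..1} \<Longrightarrow> F1 x = 0"
    and c: "continuous_on {0..T} c" and a: "0 < a" "a < T"
  shows "(\<lambda>n. LINT x|lebesgue_on {0..T}. (real n * F1 (real n * (x - a))) * c x) \<longlonglongrightarrow> c a"
proof (rule LIMSEQ_I)
  fix e :: real assume "e > 0"
  obtain d where d: "d > 0" "\<And>x. x \<in> {0..T} \<Longrightarrow> \<bar>x - a\<bar> < d \<Longrightarrow> \<bar>c x - c a\<bar> < e/2"
    using c a \<open>e > 0\<close> unfolding continuous_on_iff dist_real_def by (metis atLeastAtMost_iff half_gt_zero less_imp_le)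
  \<comment> \<open>The first bound puts the support of the kernel within the continuity radius
    \<open>d\<close>, the second inside \<open>{0..T}\<close>.\<close>
  obtain N :: nat where N: "real N > 1 / d" "real N > 1 / (T - a)"
    using reals_Archimedean2[of "max (1/d) (1/(T - a))"] by auto
  have "norm ((LINT x|lebesgue_on {0..T}. (real n * F1 (real n * (x - a))) * c x) - c a) < e" if "n \<ge> N" for n
  proof -
    define k where "k x = real n * F1 (real n * (x - a))" for x
    have n: "real n > 1 / d" "real n > 1 / (T - a)" using that N by (meson less_le_trans of_nat_le_iff)+
    then have n0: "real n > 0" using d(1) by (smt (verit) divide_pos_pos)
    have kc: "continuous_on A k" for A
      unfolding k_def by (intro continuous_intros continuous_on_compose2[OF F(2)]) auto
    have kF: "(k has_integral F0 (real n * (T - a)) - F0 (real n * (0 - a))) {0..T}"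
    proof (rule fundamental_theorem_of_calculus)
      show "0 \<le> T" using a by simp
      fix x assume "x \<in> {0..T}"
      have "((\<lambda>x. F0 (real n * (x - a))) has_real_derivative F1 (real n * (x - a)) * real n) (at x)"
        by (rule DERIV_chain2[OF F(1)]) (auto intro!: derivative_eq_intros)
      then show "((\<lambda>x. F0 (real n * (x - a))) has_vector_derivative k x) (at x within {0..T})"
        by (simp add: k_def mult.commute has_real_derivative_iff_has_vector_derivative has_vector_derivative_at_within)
    qed
    have "real n * (T - a) \<ge> 1" using n(2) a by (simp add: field_simps)
    moreover have "real n * (0 - a) \<le> 0" using a by (simp add: mult_nonneg_nonpos)
    ultimately have kI: "(LINT x|lebesgue_on {0..T}. k x) = 1"
      using integral_unique[OF kF] F(3,4) by (subst lebesgue_integral_eq_integral) (auto intro: continuous_imp_integrable_real kc)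
    have i1: "integrable (lebesgue_on {0..T}) (\<lambda>x. k x * c x)" "integrable (lebesgue_on {0..T}) (\<lambda>x. k x * (c x - c a))"
       "integrable (lebesgue_on {0..T}) k"
      by (auto intro!: continuous_imp_integrable_real continuous_intros kc c)
    have bound: "norm (k x * (c x - c a)) \<le> e/2 * k x" if "x \<in> {0..T}" for x
    proof (cases "real n * (x - a) \<in> {0..1}")
      case True
      then have "0 \<le> x - a" "x - a \<le> 1 / real n" using n0 by (auto simp: zero_le_mult_iff field_simps)
      moreover have "1 / real n < d" using n(1) n0 d(1) by (simp add: field_simps)
      ultimately have "\<bar>c x - c a\<bar> < e/2" by (intro d(2) that) auto
      then have "k x * \<bar>c x - c a\<bar> \<le> k x * (e/2)"
        using F(5)[of "real n * (x - a)"] n0 by (intro mult_left_mono) (auto simp: k_def)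
      moreover have "0 \<le> k x" using F(5)[of "real n * (x - a)"] by (simp add: k_def)
      then have "norm (k x * (c x - c a)) = k x * \<bar>c x - c a\<bar>" by (simp add: abs_mult)
      ultimately show ?thesis by (simp only: mult.commute[of "e/2"])
    next
      case False
      then show ?thesis using F(6) by (simp add: k_def)
    qed
    have "(LINT x|lebesgue_on {0..T}. k x * c x) - c a = (LINT x|lebesgue_on {0..T}. k x * c x) - (LINT x|lebesgue_on {0..T}. k x * c a)"
      using kI by simp
    also have "\<dots> = (LINT x|lebesgue_on {0..T}. k x * (c x - c a))"
      using i1 by (simp add: right_diff_distrib)
    finally have "norm ((LINT x|lebesgue_on {0..T}. k x * c x) - c a) \<le> (LINT x|lebesgue_on {0..T}. norm (k x * (c x - c a)))"
      by (simp add: integral_abs_bound)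
    also have "\<dots> \<le> (LINT x|lebesgue_on {0..T}. e/2 * k x)"
      using bound i1 by (intro integral_mono) auto
    also have "\<dots> = e/2" using kI by simp
    finally show ?thesis using \<open>e > 0\<close> by (simp add: k_def)
  qed
  then show "\<exists>no. \<forall>n\<ge>no. norm ((LINT x|lebesgue_on {0..T}. (real n * F1 (real n * (x - a))) * c x) - c a) < e" by blast
qed

text \<open>The test functions are smooth approximations of the indicator of the interval from
  \<open>s\<close> to \<open>t\<close>, differences of two rescaled steps. Their derivatives are
  differences of approximate identities and recover \<open>c s - c t\<close>; on the other side
  dominated convergence gives the integral of \<open>c'\<close>. Test functions vanish near the ends
  of the time interval, so this yields interior \<open>s\<close> and \<open>t\<close> only, and
  continuity extends the result to time zero.\<close>

lemma weak_FTC: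
  fixes c c' :: "real \<Rightarrow> real"
  assumes T: "0 < T" and c: "continuous_on {0..T} c" and c': "integrable (lebesgue_on {0..T}) c'"
    and weak: "\<And>\<phi>. smooth \<phi> \<Longrightarrow> \<exists>a b. 0 < a \<and> b < T \<and> (\<forall>t. t \<notin> {a..b} \<longrightarrow> \<phi> t = 0) \<Longrightarrow>
      (LINT t|lebesgue_on {0..T}. deriv \<phi> t * c t) = - (LINT t|lebesgue_on {0..T}. \<phi> t * c' t)"
    and t: "t \<in> {0..T}"
  shows "c t = c 0 + (LINT r|lebesgue_on {0..t}. c' r)"
proof -
  obtain F :: "nat \<Rightarrow> real \<Rightarrow> real" where F: "\<And>k x. (F k has_real_derivative F (Suc k) x) (at x)"
    "\<And>x. x \<le> 0 \<Longrightarrow> F 0 x = 0" "\<And>x. 1 \<le> x \<Longrightarrow> F 0 x = 1"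
    "\<And>x. 0 \<le> F 1 x" "\<And>x. x \<notin> {0..1} \<Longrightarrow> F 1 x = 0"
    using smooth_step by metis
  have Fc: "continuous_on A (F k)" for A k
    using F(1) by (meson DERIV_continuous_on has_field_derivative_at_within)
  have F0: "0 \<le> F 0 x \<and> F 0 x \<le> 1" for x
  proof -
    have mono: "F 0 x \<le> F 0 y" if "x \<le> y" for x y
      using F(1)[of 0] F(4) by (intro DERIV_nonneg_imp_nondecreasing[OF that]) auto
    have "F 0 (min x 0) \<le> F 0 x" "F 0 x \<le> F 0 (max x 1)" by (intro mono; simp)+
    then show ?thesis using F(2)[of "min x 0"] F(3)[of "max x 1"] by auto
  qed
  have inner: "c t - c s = (LINT r|lebesgue_on {s..t}. c' r)" if st: "0 < s" "s < t" "t < T" for s t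
  proof -
    define \<phi> where "\<phi> n x = F 0 (real n * (x - s)) - F 0 (real n * (x - t))" for n x
    \<comment> \<open>The \<open>k\<close>-th derivative of \<open>\<phi> n\<close>, in the form
      required by \<open>smoothI\<close>.\<close>
    define G where "G n k x = real n ^ k * (F k (real n * (x - s)) - F k (real n * (x - t)))" for n k x
    have G: "(G n k has_real_derivative G n (Suc k) x) (at x)" for n k x
    proof -
      have *: "((\<lambda>x. F k (real n * (x - a))) has_real_derivative F (Suc k) (real n * (x - a)) * real n) (at x)" for a
        by (rule DERIV_chain2[OF F(1)]) (auto intro!: derivative_eq_intros)
      have "((\<lambda>x. real n ^ k * (F k (real n * (x - s)) - F k (real n * (x - t)))) has_real_derivative
          real n ^ k * (F (Suc k) (real n * (x - s)) * real n - F (Suc k) (real n * (x - t)) * real n)) (at x)"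
        by (intro DERIV_cmult DERIV_diff *)
      then show ?thesis by (simp add: G_def[abs_def] algebra_simps)
    qed
    have \<phi>G: "\<phi> n = G n 0" for n by (simp add: \<phi>_def G_def fun_eq_iff)
    have sm: "smooth (\<phi> n)" and der: "deriv (\<phi> n) = G n 1" for n
      unfolding \<phi>G using smoothI[of "G n"] G by auto
    \<comment> \<open>The second step is complete at \<open>t + 1/n\<close>, which has to lie before
      \<open>T\<close> for an admissible test function.\<close>
    obtain N :: nat where N: "real N > 1 / (T - t)" using reals_Archimedean2 by blast
    have eq: "(LINT x|lebesgue_on {0..T}. G n 1 x * c x) = - (LINT x|lebesgue_on {0..T}. \<phi> n x * c' x)" if "n \<ge> N" for n
    proof -
      have n: "real n > 1 / (T - t)" using that N by (meson less_le_trans of_nat_le_iff)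
      then have n0: "real n > 0" using st by (smt (verit) divide_pos_pos)
      have "\<exists>a b. 0 < a \<and> b < T \<and> (\<forall>x. x \<notin> {a..b} \<longrightarrow> \<phi> n x = 0)"
      proof (intro exI conjI allI impI)
        show "0 < s" by fact
        show "t + 1 / real n < T" using n n0 st by (simp add: field_simps)
        fix x assume "x \<notin> {s..t + 1 / real n}"
        then consider "x < s" | "x > t + 1 / real n" by force
        then show "\<phi> n x = 0"
        proof cases
          case 1
          then show ?thesis using st n0 by (simp add: \<phi>_def F(2) mult_nonneg_nonpos)
        next
          case 2
          then have "1 \<le> real n * (x - t)" using n0 by (simp add: field_simps)
          moreover have "real n * (x - t) \<le> real n * (x - s)" using st n0 by simp
          ultimately show ?thesis by (simp add: \<phi>_def F(3))
        qed
      qed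
      from weak[OF sm this] show ?thesis by (simp add: der)
    qed
    have lim1: "(\<lambda>n. LINT x|lebesgue_on {0..T}. G n 1 x * c x) \<longlonglongrightarrow> c s - c t"
    proof -
      have ai: "(\<lambda>n. LINT x|lebesgue_on {0..T}. (real n * F 1 (real n * (x - a))) * c x) \<longlonglongrightarrow> c a" if "0 < a" "a < T" for a
      proof (rule approximate_identity[where ?F0.0="F 0"])
        show "(F 0 has_real_derivative F 1 x) (at x)" for x using F(1)[of 0] by simp
      qed (fact Fc F(2-5) that c)+
      have i: "integrable (lebesgue_on {0..T}) (\<lambda>x. (real n * F 1 (real n * (x - a))) * c x)" for n a
        by (intro continuous_imp_integrable_real continuous_intros c continuous_on_compose2[OF Fc[of UNIV]]) auto
      have "(LINT x|lebesgue_on {0..T}. G n 1 x * c x) = (LINT x|lebesgue_on {0..T}. (real n * F 1 (real n * (x - s))) * c x) - (LINT x|lebesgue_on {0..T}. (real n * F 1 (real n * (x - t))) * c x)" for n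
        by (subst Bochner_Integration.integral_diff[symmetric, OF i i]) (simp add: G_def algebra_simps)
      then show ?thesis using tendsto_diff[OF ai[of s] ai[of t]] st by simp
    qed
    have lim2: "(\<lambda>n. LINT x|lebesgue_on {0..T}. \<phi> n x * c' x) \<longlonglongrightarrow> (LINT x|lebesgue_on {0..T}. indicator {s<..t} x * c' x)"
    proof (rule integral_dominated_convergence[where w="\<lambda>x. \<bar>c' x\<bar>"])
      have c'm: "c' \<in> borel_measurable (lebesgue_on {0..T})" using c' by simp
      have "(indicator {s<..t} :: real \<Rightarrow> real) \<in> borel_measurable (lebesgue_on {0..T})" by (intro borel_measurable_indicator) (use st in \<open>auto simp: sets_restrict_space_iff\<close>)
      then show "(\<lambda>x. indicator {s<..t} x * c' x) \<in> borel_measurable (lebesgue_on {0..T})" using c'm by simp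
      have "\<phi> n \<in> borel_measurable (lebesgue_on {0..T})" for n
        unfolding \<phi>_def by (intro continuous_imp_measurable_on_sets_lebesgue continuous_intros continuous_on_compose2[OF Fc[of UNIV]]) auto
      then show "(\<lambda>x. \<phi> n x * c' x) \<in> borel_measurable (lebesgue_on {0..T})" for n using c'm by simp
      show "integrable (lebesgue_on {0..T}) (\<lambda>x. \<bar>c' x\<bar>)" using c' by simp
      have conv: "(\<lambda>n. \<phi> n x) \<longlonglongrightarrow> indicator {s<..t} x" for x
      proof -
        have step: "(\<lambda>n. F 0 (real n * (x - a))) \<longlonglongrightarrow> indicator {a<..} x" for a
        proof (cases "a < x")
          case True
          obtain M :: nat where M: "real M > 1 / (x - a)" using reals_Archimedean2 by blast
          have "F 0 (real n * (x - a)) = 1" if "n \<ge> M" for n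
          proof -
            have "real n > 1 / (x - a)" using that M by (meson less_le_trans of_nat_le_iff)
            then show ?thesis using True by (intro F(3)) (simp add: field_simps)
          qed
          then show ?thesis using True by (intro tendsto_eventually eventually_sequentiallyI[of M]) auto
        next
          case False
          then show ?thesis by (simp add: F(2) mult_nonneg_nonpos)
        qed
        have "indicator {s<..t} x = (indicator {s<..} x - indicator {t<..} x :: real)" using st by (auto simp: indicator_def)
        then show ?thesis unfolding \<phi>_def using tendsto_diff[OF step[of s] step[of t]] by simp
      qed
      show "AE x in lebesgue_on {0..T}. (\<lambda>n. \<phi> n x * c' x) \<longlonglongrightarrow> indicator {s<..t} x * c' x"
        by (intro AE_I2 tendsto_intros conv)
      have "\<bar>\<phi> n x\<bar> \<le> 1" for n x using F0[of "real n * (x - s)"] F0[of "real n * (x - t)"] by (auto simp: \<phi>_def abs_le_iff)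
      then show "AE x in lebesgue_on {0..T}. norm (\<phi> n x * c' x) \<le> \<bar>c' x\<bar>" for n
        by (intro AE_I2) (simp add: abs_mult mult_left_le_one_le)
    qed
    have "(\<lambda>n. LINT x|lebesgue_on {0..T}. G n 1 x * c x) \<longlonglongrightarrow> - (LINT x|lebesgue_on {0..T}. indicator {s<..t} x * c' x)"
      by (rule Lim_transform_eventually[OF tendsto_minus[OF lim2]], rule eventually_sequentiallyI[of N]) (simp only: eq)
    from LIMSEQ_unique[OF lim1 this] have "c t - c s = (LINT x|lebesgue_on {0..T}. indicator {s<..t} x * c' x)" by simp
    also have "\<dots> = (LINT x|lebesgue. indicator {0..T} x * (indicator {s<..t} x * c' x))"
      by (subst integral_restrict_space) auto
    also have "\<dots> = (LINT x|lebesgue. indicator {s<..t} x * c' x)"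
      using st by (intro Bochner_Integration.integral_cong) (auto simp: indicator_def)
    \<comment> \<open>Steps vanish at their starting point, so the limit is the indicator of a
      half-open interval; it differs from the closed one at the null point \<open>s\<close>.\<close>
    also have "\<dots> = (LINT x|lebesgue. indicator {s..t} x * c' x)"
    proof (rule integral_cong_AE)
      have m: "(\<lambda>x. indicator {0..T} x * c' x) \<in> borel_measurable lebesgue"
        using borel_measurable_integrable[OF c'] by (subst (asm) borel_measurable_restrict_space_iff) (auto simp: mult.commute)
      have "(\<lambda>x. indicator {s<..t} x * (indicator {0..T} x * c' x)) \<in> borel_measurable lebesgue"
        "(\<lambda>x. indicator {s..t} x * (indicator {0..T} x * c' x)) \<in> borel_measurable lebesgue"
        by (intro borel_measurable_times m borel_measurable_indicator; simp)+
      moreover have "indicator {s<..t} x * (indicator {0..T} x * c' x) = indicator {s<..t} x * c' x"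
        "indicator {s..t} x * (indicator {0..T} x * c' x) = indicator {s..t} x * c' x" for x
        using st by (auto simp: indicator_def)
      ultimately show "(\<lambda>x. indicator {s<..t} x * c' x) \<in> borel_measurable lebesgue" "(\<lambda>x. indicator {s..t} x * c' x) \<in> borel_measurable lebesgue"
        by simp_all
      have "AE x in lebesgue. x \<noteq> s" by (rule AE_completion) (rule AE_lborel_singleton)
      then show "AE x in lebesgue. indicator {s<..t} x * c' x = indicator {s..t} x * c' x"
        by eventually_elim (auto simp: indicator_def)
    qed
    also have "\<dots> = (LINT x|lebesgue_on {s..t}. c' x)"
      by (subst integral_restrict_space) auto
    finally show ?thesis .
  qed
  define h where "h t = c t - (LINT r|lebesgue_on {0..t}. c' r)" for t
  have hc: "continuous_on {0..T} h" unfolding h_def by (intro continuous_intros c indefinite_integral_continuous c')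
  have hconst: "h s = h (T/2)" if s: "s \<in> {0<..<T}" for s
  proof -
    have *: "h s = h t" if "0 < s" "s < t" "t < T" for s t
      using inner[OF that] integral_split[OF c', of s t] that by (simp add: h_def)
    consider "s < T/2" | "s = T/2" | "T/2 < s" by linarith
    then show ?thesis by cases (use s T *[of s "T/2"] *[of "T/2" s] in auto)
  qed
  have cl: "closure {0<..<T} = {0..T}" using T by simp
  have "h s = h (T/2)" if "s \<in> {0..T}" for s
  proof (rule continuous_constant_on_closure[of "{0<..<T}" h "h (T/2)"])
    show "continuous_on (closure {0<..<T}) h" unfolding cl by (rule hc)
    show "s \<in> closure {0<..<T}" unfolding cl by (rule that)
  qed (rule hconst)
  from this[OF t] this[of 0] have "h t = h 0" using T by simp
  moreover have "(LINT r|lebesgue_on {0..0}. c' r) = 0"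
    using integral_split[OF c', of 0 0] T by simp
  ultimately show ?thesis by (simp add: h_def)
qed

text \<open>\<open>c\<close> need not be differentiable at a given point, so the argument is by
  increments. That of \<open>h\<close> from \<open>a\<close> to \<open>b\<close> is the integral of
  \<open>(c b + c a - 2 * c r) * c' r\<close>, which is at most \<open>e\<close> times the increment
  of \<open>A\<close> when \<open>c\<close> oscillates little between \<open>a\<close> and
  \<open>b\<close>. Bolzano's interval principle glues such short intervals together.\<close>

lemma square_chain_rule:
  fixes c c' :: "real \<Rightarrow> real"
  assumes T: "0 < T" and c: "continuous_on {0..T} c" and c': "integrable (lebesgue_on {0..T}) c'"
    and FTC: "\<And>t. t \<in> {0..T} \<Longrightarrow> c t = c 0 + (LINT r|lebesgue_on {0..t}. c' r)"
    and t: "t \<in> {0..T}"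
  shows "(c t)\<^sup>2 = (c 0)\<^sup>2 + 2 * (LINT r|lebesgue_on {0..t}. c r * c' r)"
proof -
  have ci: "integrable (lebesgue_on {0..T}) (\<lambda>r. c r * c' r)" by (rule integrable_mult_continuous[OF c' c])
  have ni: "integrable (lebesgue_on {0..T}) (\<lambda>r. \<bar>c' r\<bar>)" using c' by simp
  define h where "h t = (c t)\<^sup>2 - 2 * (LINT r|lebesgue_on {0..t}. c r * c' r)" for t
  define A where "A t = (LINT r|lebesgue_on {0..t}. \<bar>c' r\<bar>)" for t
  have hdiff: "\<bar>h b - h a\<bar> \<le> e * (A b - A a)"
    if ab: "0 \<le> a" "a \<le> b" "b \<le> T" and e: "\<And>r. r \<in> {a..b} \<Longrightarrow> \<bar>c b + c a - 2 * c r\<bar> \<le> e" for a b e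
  proof -
    have cb: "c b - c a = (LINT r|lebesgue_on {a..b}. c' r)"
      using FTC[of a] FTC[of b] integral_split[OF c', of a b] ab by auto
    have sub: "{a..b} \<subseteq> {0..T}" using ab by auto
    have i: "integrable (lebesgue_on {a..b}) c'" "integrable (lebesgue_on {a..b}) (\<lambda>r. c r * c' r)"
      using integrable_subinterval[OF c' sub] integrable_subinterval[OF ci sub] by auto
    have i2: "integrable (lebesgue_on {a..b}) (\<lambda>r. (c b + c a - 2 * c r) * c' r)"
      by (intro integrable_mult_continuous[OF i(1)] continuous_intros continuous_on_subset[OF c sub])
    have "h b - h a = (c b + c a) * (c b - c a) - 2 * (LINT r|lebesgue_on {a..b}. c r * c' r)"
      using integral_split[OF ci, of a b] ab by (simp add: h_def power2_eq_square algebra_simps)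
    also have "\<dots> = (LINT r|lebesgue_on {a..b}. (c b + c a) * c' r) - (LINT r|lebesgue_on {a..b}. 2 * (c r * c' r))"
      by (simp add: cb)
    also have "\<dots> = (LINT r|lebesgue_on {a..b}. (c b + c a - 2 * c r) * c' r)"
    proof -
      have "(\<lambda>r. (c b + c a - 2 * c r) * c' r) = (\<lambda>r. (c b + c a) * c' r - 2 * (c r * c' r))"
        by (simp add: fun_eq_iff algebra_simps)
      then show ?thesis using i
        by (simp only:) (intro Bochner_Integration.integral_diff[symmetric] integrable_mult_right)
    qed
    finally have "\<bar>h b - h a\<bar> \<le> (LINT r|lebesgue_on {a..b}. \<bar>(c b + c a - 2 * c r) * c' r\<bar>)"
      by (simp add: integral_abs_bound)
    also have "\<dots> \<le> (LINT r|lebesgue_on {a..b}. e * \<bar>c' r\<bar>)"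
    proof (rule integral_mono)
      show "integrable (lebesgue_on {a..b}) (\<lambda>r. \<bar>(c b + c a - 2 * c r) * c' r\<bar>)" by (rule integrable_abs[OF i2])
      show "integrable (lebesgue_on {a..b}) (\<lambda>r. e * \<bar>c' r\<bar>)" using i(1) by simp
      show "\<bar>(c b + c a - 2 * c r) * c' r\<bar> \<le> e * \<bar>c' r\<bar>" if "r \<in> space (lebesgue_on {a..b})" for r
        unfolding abs_mult using that by (intro mult_right_mono e) auto
    qed
    also have "\<dots> = e * (A b - A a)" using integral_split[OF ni, of a b] ab by (simp add: A_def)
    finally show ?thesis .
  qed
  have "\<bar>h t - h 0\<bar> \<le> e * (A t - A 0)" if "e > 0" for e
  proof -
    define P where "P a b \<longleftrightarrow> (0 \<le> a \<and> b \<le> T \<longrightarrow> \<bar>h b - h a\<bar> \<le> e * (A b - A a))" for a b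
    have "P 0 t"
    proof (rule Bolzano)
      show "0 \<le> t" using t by simp
      show "P a w" if "P a b" "P b w" "a \<le> b" "b \<le> w" for a b w
        unfolding P_def
      proof
        assume "0 \<le> a \<and> w \<le> T"
        then have "\<bar>h b - h a\<bar> \<le> e * A b - e * A a" "\<bar>h w - h b\<bar> \<le> e * A w - e * A b"
          using that by (auto simp: P_def right_diff_distrib)
        then show "\<bar>h w - h a\<bar> \<le> e * (A w - A a)" unfolding abs_le_iff right_diff_distrib by linarith
      qed
    next
      fix x assume "0 \<le> x" "x \<le> t"
      then have x: "x \<in> {0..T}" using t by auto
      \<comment> \<open>Radius for a quarter of \<open>e\<close>: the values at \<open>a\<close> and
        \<open>b\<close>, and twice the value at \<open>r\<close>, are compared with the value at
        \<open>x\<close>, four deviations in all.\<close>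
      obtain d where d: "d > 0" "\<And>y. y \<in> {0..T} \<Longrightarrow> \<bar>y - x\<bar> < d \<Longrightarrow> \<bar>c y - c x\<bar> < e/4"
        using c x \<open>e > 0\<close> unfolding continuous_on_iff dist_real_def by (metis zero_less_divide_iff zero_less_numeral)
      show "\<exists>d>0. \<forall>a b. a \<le> x \<and> x \<le> b \<and> b - a < d \<longrightarrow> P a b"
        unfolding P_def
      proof (intro exI[of _ d] conjI allI impI)
        fix a b assume ab: "a \<le> x \<and> x \<le> b \<and> b - a < d" "0 \<le> a \<and> b \<le> T"
        have near: "\<bar>c r - c x\<bar> < e/4" if "r \<in> {a..b}" for r using that ab by (intro d(2)) auto
        show "\<bar>h b - h a\<bar> \<le> e * (A b - A a)"
        proof (rule hdiff)
          fix r assume "r \<in> {a..b}"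
          moreover have "a \<in> {a..b}" "b \<in> {a..b}" using ab by auto
          ultimately have "\<bar>c a - c x\<bar> < e/4" "\<bar>c b - c x\<bar> < e/4" "\<bar>c r - c x\<bar> < e/4" by (blast intro: near)+
          then show "\<bar>c b + c a - 2 * c r\<bar> \<le> e" unfolding abs_le_iff abs_less_iff by linarith
        qed (use ab in auto)
      qed (rule d(1))
    qed
    then show ?thesis using t by (simp add: P_def)
  qed
  moreover have "0 \<le> A t - A 0"
    using integral_split[OF ni, of 0 t] t by (simp add: A_def Bochner_Integration.integral_nonneg)
  \<comment> \<open>The bound holds for every positive \<open>e\<close>, in particular for
    \<open>sqrt e\<close>, the form that \<open>le_zero_of_le_sqrt\<close> expects.\<close>
  ultimately have "\<bar>h t - h 0\<bar> \<le> 0"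
    by (intro le_zero_of_le_sqrt[of "A t - A 0"]) (auto simp: mult.commute)
  then have "h t = h 0" by simp
  moreover have "(LINT r|lebesgue_on {0..0}. c r * c' r) = 0"
    using integral_split[OF ci, of 0 0] T by simp
  ultimately show ?thesis by (simp add: h_def)
qed

text \<open>If \<open>E\<close> vanishes up to \<open>u\<close> and the integral of \<open>a\<close>
  grows by at most one half from \<open>u\<close> to \<open>v\<close>, then the maximum of
  \<open>E\<close> on \<open>{u..v}\<close> is at most half of itself, so \<open>E\<close> vanishes
  up to \<open>v\<close>. Continuity of the primitive of \<open>a\<close> provides such steps, even
  for unbounded \<open>a\<close>, and Bolzano's principle chains them.\<close>

lemma Gronwall_zero:
  fixes E a :: "real \<Rightarrow> real"
  assumes T: "0 < T" and E: "continuous_on {0..T} E" "\<And>t. t \<in> {0..T} \<Longrightarrow> 0 \<le> E t"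
    and a: "integrable (lebesgue_on {0..T}) a" "\<And>t. 0 \<le> a t"
    and le: "\<And>t. t \<in> {0..T} \<Longrightarrow> E t \<le> (LINT r|lebesgue_on {0..t}. E r * a r)"
    and t: "t \<in> {0..T}"
  shows "E t = 0"
proof -
  have i: "integrable (lebesgue_on {0..T}) (\<lambda>r. E r * a r)" by (rule integrable_mult_continuous[OF a(1) E(1)])
  define A where "A t = (LINT r|lebesgue_on {0..t}. a r)" for t
  have Ac: "continuous_on {0..T} A" unfolding A_def by (rule indefinite_integral_continuous[OF a(1)])
  have zero: "(LINT r|lebesgue_on {0..u}. E r * a r) = 0" if "\<forall>s\<in>{0..u}. E s = 0" for u
    using that by (intro integral_eq_zero_AE AE_I2) auto
  define Q where "Q u \<longleftrightarrow> (\<forall>s\<in>{0..u}. E s = 0)" for u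
  define P where "P u v \<longleftrightarrow> (0 \<le> u \<and> v \<le> T \<longrightarrow> Q u \<longrightarrow> Q v)" for u v
  have "P 0 T"
  proof (rule Bolzano)
    show "0 \<le> T" using T by simp
    show "P u w" if "P u v" "P v w" "u \<le> v" "v \<le> w" for u v w
      unfolding P_def using that unfolding P_def by (meson order_trans)
  next
    fix x assume "0 \<le> x" "x \<le> T"
    then have x: "x \<in> {0..T}" by simp
    obtain d where d: "d > 0" "\<And>y. y \<in> {0..T} \<Longrightarrow> \<bar>y - x\<bar> < d \<Longrightarrow> \<bar>A y - A x\<bar> < 1/4"
      using Ac x unfolding continuous_on_iff dist_real_def by (metis zero_less_divide_iff zero_less_numeral zero_less_one)
    show "\<exists>d>0. \<forall>u v. u \<le> x \<and> x \<le> v \<and> v - u < d \<longrightarrow> P u v"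
      unfolding P_def
    proof (intro exI[of _ d] conjI impI allI)
      fix u v assume uv: "u \<le> x \<and> x \<le> v \<and> v - u < d" "0 \<le> u \<and> v \<le> T" and "Q u"
      then have z: "\<forall>s\<in>{0..u}. E s = 0" by (simp add: Q_def)
      have "\<exists>m\<in>{u..v}. \<forall>y\<in>{u..v}. E y \<le> E m"
        by (rule continuous_attains_sup) (use uv in \<open>auto intro: continuous_on_subset[OF E(1)]\<close>)
      then obtain m where m: "m \<in> {u..v}" "\<And>y. y \<in> {u..v} \<Longrightarrow> E y \<le> E m" by blast
      have mT: "m \<in> {0..T}" using m uv by auto
      have sub: "{u..m} \<subseteq> {0..T}" using m uv by auto
      have "E m \<le> (LINT r|lebesgue_on {0..m}. E r * a r)" by (rule le[OF mT])
      also have "\<dots> = (LINT r|lebesgue_on {u..m}. E r * a r)"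
        using integral_split[OF i, of u m] m uv zero[OF z] by simp
      also have "\<dots> \<le> (LINT r|lebesgue_on {u..m}. E m * a r)"
        using integrable_subinterval[OF i sub] integrable_subinterval[OF a(1) sub] m a(2)
        by (intro integral_mono) (auto intro!: mult_right_mono)
      also have "\<dots> = E m * (A m - A u)" using integral_split[OF a(1), of u m] m uv by (simp add: A_def)
      also have "\<dots> \<le> E m * (1/2)"
      proof (rule mult_left_mono[OF _ E(2)[OF mT]])
        have "\<bar>m - x\<bar> < d" "\<bar>u - x\<bar> < d" "u \<in> {0..T}" using m uv by auto
        then have "\<bar>A m - A x\<bar> < 1/4" "\<bar>A u - A x\<bar> < 1/4" using d(2) mT by blast+
        then show "A m - A u \<le> 1/2" unfolding abs_less_iff by linarith
      qed
      finally have "E m \<le> 0" by simp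
      show "Q v" unfolding Q_def
      proof
        fix s assume s: "s \<in> {0..v}"
        show "E s = 0"
        proof (cases "s \<le> u")
          case True
          then show ?thesis using z s by simp
        next
          case False
          then have "E s \<le> 0" using m(2)[of s] \<open>E m \<le> 0\<close> s by simp
          moreover have "0 \<le> E s" using s uv by (intro E(2)) auto
          ultimately show ?thesis by simp
        qed
      qed
    qed (rule d(1))
  qed
  moreover have "E 0 = 0" using le[of 0] E(2)[of 0] T integral_split[OF i, of 0 0] by simp
  ultimately show ?thesis using t T by (simp add: Q_def P_def)
qed

section \<open>Pairing vector valued time integrals with functionals\<close>

text \<open>Linearity and boundedness are asked on the set \<open>X\<close> alone, together with
  closure of \<open>X\<close> under linear combinations, as the function spaces are sets rather than
  types. One notion then serves for \<open>L2\<close> and for \<open>H_minus1\<close>.\<close>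

definition bdd_functional :: "('x \<Rightarrow> 'v::euclidean_space) set \<Rightarrow> (('x \<Rightarrow> 'v) \<Rightarrow> real) \<Rightarrow> (('x \<Rightarrow> 'v) \<Rightarrow> real) \<Rightarrow> bool" where
  "bdd_functional X N l \<longleftrightarrow>
    (\<forall>F\<in>X. \<forall>G\<in>X. \<forall>r s. (\<lambda>x. r *\<^sub>R F x + s *\<^sub>R G x) \<in> X \<and> l (\<lambda>x. r *\<^sub>R F x + s *\<^sub>R G x) = r * l F + s * l G) \<and>
    (\<exists>C. \<forall>F\<in>X. \<bar>l F\<bar> \<le> C * N F)"

lemma bdd_functionalD:
  assumes "bdd_functional X N l" "F \<in> X" "G \<in> X"
  shows "(\<lambda>x. r *\<^sub>R F x + s *\<^sub>R G x) \<in> X" "l (\<lambda>x. r *\<^sub>R F x + s *\<^sub>R G x) = r * l F + s * l G"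
    "l (\<lambda>x. F x - G x) = l F - l G" "(\<lambda>x. F x - G x) \<in> X"
    "l (\<lambda>x. r *\<^sub>R F x) = r * l F" "(\<lambda>x. r *\<^sub>R F x) \<in> X"
proof -
  have *: "(\<lambda>x. r *\<^sub>R F x + s *\<^sub>R G x) \<in> X" "l (\<lambda>x. r *\<^sub>R F x + s *\<^sub>R G x) = r * l F + s * l G" for r s
    using assms by (auto simp: bdd_functional_def)
  show "(\<lambda>x. r *\<^sub>R F x + s *\<^sub>R G x) \<in> X" "l (\<lambda>x. r *\<^sub>R F x + s *\<^sub>R G x) = r * l F + s * l G" by (fact *)+
  show "l (\<lambda>x. F x - G x) = l F - l G" "(\<lambda>x. F x - G x) \<in> X" using *[of 1 "-1"] by simp_all
  show "l (\<lambda>x. r *\<^sub>R F x) = r * l F" "(\<lambda>x. r *\<^sub>R F x) \<in> X" using *[of r 0] by simp_all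
qed

lemma space_time_interval [simp]: "space (time_interval T) = {0..T}"
  by (simp add: time_interval_def)

lemma time_interval_finite: "finite_measure (time_interval T)"
  unfolding time_interval_def by (simp add: finite_measure_lebesgue_on)

text \<open>Lebesgue measure is complete, so \<open>f\<close> inherits measurability from the
  pointwise \<open>lim\<close>, with which it agrees almost everywhere.\<close>

lemma time_interval_AE_limit:
  fixes f :: "real \<Rightarrow> real"
  assumes g: "\<And>n. g n \<in> borel_measurable (time_interval T)"
    and lim: "AE t in time_interval T. (\<lambda>n. g n t) \<longlonglongrightarrow> f t"
  shows "f \<in> borel_measurable (time_interval T)"
proof -
  define L where "L t = lim (\<lambda>n. g n t)" for t
  have Lm: "L \<in> borel_measurable (time_interval T)"
    unfolding L_def using g by measurable
  have AE: "AE t in time_interval T. L t = f t"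
    using lim by eventually_elim (simp add: L_def limI)
  have 1: "(\<lambda>t. indicator {0..T} t *\<^sub>R L t) \<in> borel_measurable lebesgue"
    using Lm unfolding time_interval_def by (subst (asm) borel_measurable_restrict_space_iff) auto
  have "AE t in lebesgue. indicator {0..T} t *\<^sub>R L t = indicator {0..T} t *\<^sub>R f t"
    using AE unfolding time_interval_def by (subst (asm) AE_restrict_space_iff) (auto elim!: eventually_mono simp: indicator_def)
  from borel_measurable_AE[OF 1 this] show ?thesis
    unfolding time_interval_def by (subst borel_measurable_restrict_space_iff) auto
qed

text \<open>On the interval \<open>s\<close> takes finitely many values, each on a measurable set,
  so composition with an arbitrary \<open>h\<close> gives a finite sum of indicators. Evaluation at
  a point \<open>x\<close> and a functional are both of this kind, which is how
  \<open>simple_in_pairing\<close> compares them.\<close>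

lemma simple_in_expand:
  assumes s: "simple_in T X s"
  shows "finite (s ` {0..T})" "s ` {0..T} \<subseteq> X"
    and "(\<lambda>t. h (s t) :: 'b::euclidean_space) \<in> borel_measurable (time_interval T)"
    and "integrable (time_interval T) (\<lambda>t. h (s t) :: 'b::euclidean_space)"
    and "(LINT t|time_interval T. (h (s t) :: 'b::euclidean_space))
      = (\<Sum>v\<in>s ` {0..T}. measure (time_interval T) (s -` {v} \<inter> {0..T}) *\<^sub>R h v)"
proof -
  interpret finite_measure "time_interval T" by (rule time_interval_finite)
  have sf: "simple_function (time_interval T) s" using s by (simp add: simple_in_def)
  show fin: "finite (s ` {0..T})" "s ` {0..T} \<subseteq> X"
    using s by (auto simp: simple_in_def simple_function_def)
  let ?A = "\<lambda>v. s -` {v} \<inter> {0..T}"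
  have A: "?A v \<in> sets (time_interval T)" if "v \<in> s ` {0..T}" for v
    using sf that by (auto simp: simple_function_def)
  have eq: "h (s t) = (\<Sum>v\<in>s ` {0..T}. indicator (?A v) t *\<^sub>R h v)" if "t \<in> {0..T}" for t
  proof -
    have "(\<Sum>v\<in>s ` {0..T}. indicator (?A v) t *\<^sub>R h v) = (\<Sum>v\<in>s ` {0..T}. if v = s t then h v else 0)"
      using that by (intro sum.cong refl) (auto simp: indicator_def)
    also have "\<dots> = h (s t)" using fin that by (simp add: sum.delta)
    finally show ?thesis ..
  qed
  have i: "integrable (time_interval T) (\<lambda>t. indicator (?A v) t *\<^sub>R h v)" if "v \<in> s ` {0..T}" for v
    using A[OF that] by (intro integrable_scaleR_left) (simp add: emeasure_eq_measure)
  have S: "integrable (time_interval T) (\<lambda>t. \<Sum>v\<in>s ` {0..T}. indicator (?A v) t *\<^sub>R h v)"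
    using i by (intro Bochner_Integration.integrable_sum)
  show I: "integrable (time_interval T) (\<lambda>t. h (s t))"
    using S by (rule Bochner_Integration.integrable_cong[THEN iffD2, rotated -1]) (auto simp: eq)
  then show "(\<lambda>t. h (s t)) \<in> borel_measurable (time_interval T)" by simp
  have "(LINT t|time_interval T. h (s t)) = (LINT t|time_interval T. (\<Sum>v\<in>s ` {0..T}. indicator (?A v) t *\<^sub>R h v))"
    by (rule Bochner_Integration.integral_cong) (auto simp: eq)
  also have "\<dots> = (\<Sum>v\<in>s ` {0..T}. (LINT t|time_interval T. indicator (?A v) t *\<^sub>R h v))"
    by (rule Bochner_Integration.integral_sum[OF i])
  also have "\<dots> = (\<Sum>v\<in>s ` {0..T}. measure (time_interval T) (?A v) *\<^sub>R h v)"
    using A by (intro sum.cong refl) (simp add: emeasure_eq_measure Int_absorb2)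
  finally show "(LINT t|time_interval T. h (s t)) = (\<Sum>v\<in>s ` {0..T}. measure (time_interval T) (?A v) *\<^sub>R h v)" .
qed

lemma bdd_functional_sum:
  assumes b: "bdd_functional X N l" and F0: "F0 \<in> X" and V: "finite V" "V \<subseteq> X"
  shows "(\<lambda>x. \<Sum>v\<in>V. m v *\<^sub>R v x) \<in> X \<and> l (\<lambda>x. \<Sum>v\<in>V. m v *\<^sub>R v x) = (\<Sum>v\<in>V. m v * l v)"
  using V
proof (induction V rule: finite_induct)
  case empty
  show ?case using bdd_functionalD(5,6)[OF b F0 F0, of 0] by simp
next
  case (insert v V)
  then have IH: "(\<lambda>x. \<Sum>v\<in>V. m v *\<^sub>R v x) \<in> X" "l (\<lambda>x. \<Sum>v\<in>V. m v *\<^sub>R v x) = (\<Sum>v\<in>V. m v * l v)" "v \<in> X" by auto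
  show ?case using bdd_functionalD(1,2)[OF b IH(3,1), of "m v" 1] insert.hyps IH(2) by simp
qed

lemma simple_in_pairing:
  assumes T: "0 < T" and s: "simple_in T X s" and b: "bdd_functional X N l"
  shows "(\<lambda>x. LINT t|time_interval T. s t x) \<in> X"
    and "l (\<lambda>x. LINT t|time_interval T. s t x) = (LINT t|time_interval T. l (s t))"
proof -
  have "s 0 \<in> X" using s T by (simp add: simple_in_def)
  from bdd_functional_sum[OF b this simple_in_expand(1,2)[OF s], of "\<lambda>v. measure (time_interval T) (s -` {v} \<inter> {0..T})"]
  show "(\<lambda>x. LINT t|time_interval T. s t x) \<in> X"
    and "l (\<lambda>x. LINT t|time_interval T. s t x) = (LINT t|time_interval T. l (s t))"
    using simple_in_expand(5)[OF s, of "\<lambda>F. F x" for x] simple_in_expand(5)[OF s, of l] by simp_all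
qed

lemma strongly_measurable_pairing:
  assumes f: "strongly_measurable T X N f" and b: "bdd_functional X N l"
  shows "(\<lambda>t. l (f t)) \<in> borel_measurable (time_interval T)"
proof -
  obtain s where s: "\<And>n. simple_in T X (s n)" and lim: "AE t in time_interval T. (\<lambda>n. N (\<lambda>x. s n t x - f t x)) \<longlonglongrightarrow> 0"
    and fX: "AE t in time_interval T. f t \<in> X"
    using f unfolding strongly_measurable_def by blast
  obtain C where C: "\<And>F. F \<in> X \<Longrightarrow> \<bar>l F\<bar> \<le> C * N F" using b unfolding bdd_functional_def by blast
  show ?thesis
  proof (rule time_interval_AE_limit)
    show "(\<lambda>t. l (s n t)) \<in> borel_measurable (time_interval T)" for n by (rule simple_in_expand(3)[OF s])
    show "AE t in time_interval T. (\<lambda>n. l (s n t)) \<longlonglongrightarrow> l (f t)"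
      using lim fX AE_space
    proof eventually_elim
      case (elim t)
      have sX: "s n t \<in> X" for n using s[of n] elim(3) by (simp add: simple_in_def)
      have "(\<lambda>n. l (s n t) - l (f t)) \<longlonglongrightarrow> 0"
      proof (rule tendsto_rabs_zero_cancel, rule tendsto_sandwich[OF _ _ tendsto_const])
        show "(\<lambda>n. C * N (\<lambda>x. s n t x - f t x)) \<longlonglongrightarrow> 0" using tendsto_mult_right_zero[OF elim(1)] .
        show "\<forall>\<^sub>F n in sequentially. \<bar>l (s n t) - l (f t)\<bar> \<le> C * N (\<lambda>x. s n t x - f t x)"
          using C[OF bdd_functionalD(4)[OF b sX elim(2)]] bdd_functionalD(3)[OF b sX elim(2)] by simp
      qed simp
      then show ?case by (simp add: LIM_zero_iff)
    qed
  qed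
qed

text \<open>The functional commutes with integrals of simple paths; boundedness carries this to the
  limit, in mean over time for the integrand and in \<open>N\<close> for the integral.\<close>

lemma time_integral_pairing:
  assumes T: "0 < T" and J: "has_time_integral T X N f J" and b: "bdd_functional X N l"
  shows "integrable (time_interval T) (\<lambda>t. l (f t))" and "(LINT t|time_interval T. l (f t)) = l J"
proof -
  have sm: "strongly_measurable T X N f" and JX: "J \<in> X" using J by (auto simp: has_time_integral_def)
  have fX: "AE t in time_interval T. f t \<in> X" using sm by (simp add: strongly_measurable_def)
  obtain s where s: "\<And>n. simple_in T X (s n)"
      and i: "\<And>n. integrable (time_interval T) (\<lambda>t. N (\<lambda>x. s n t x - f t x))"
      and lim1: "(\<lambda>n. \<integral>t. N (\<lambda>x. s n t x - f t x) \<partial>time_interval T) \<longlonglongrightarrow> 0"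
      and lim2: "(\<lambda>n. N (\<lambda>x. (\<integral>t. s n t x \<partial>time_interval T) - J x)) \<longlonglongrightarrow> 0"
    using J unfolding has_time_integral_def by blast
  obtain C where C: "\<And>F. F \<in> X \<Longrightarrow> \<bar>l F\<bar> \<le> C * N F" using b unfolding bdd_functional_def by blast
  have m: "(\<lambda>t. l (f t)) \<in> borel_measurable (time_interval T)" by (rule strongly_measurable_pairing[OF sm b])
  have si: "integrable (time_interval T) (\<lambda>t. l (s n t))" for n by (rule simple_in_expand(4)[OF s])
  have le: "AE t in time_interval T. \<bar>l (s n t) - l (f t)\<bar> \<le> C * N (\<lambda>x. s n t x - f t x)" for n
    using fX AE_space
  proof eventually_elim
    case (elim t)
    have sX: "s n t \<in> X" using s[of n] elim(2) by (simp add: simple_in_def)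
    show ?case using C[OF bdd_functionalD(4)[OF b sX elim(1)]] bdd_functionalD(3)[OF b sX elim(1)] by simp
  qed
  have di: "integrable (time_interval T) (\<lambda>t. l (s n t) - l (f t))" for n
  proof (rule Bochner_Integration.integrable_bound)
    show "integrable (time_interval T) (\<lambda>t. C * N (\<lambda>x. s n t x - f t x))" using i by simp
    show "(\<lambda>t. l (s n t) - l (f t)) \<in> borel_measurable (time_interval T)" using m borel_measurable_integrable[OF si] by simp
    show "AE t in time_interval T. norm (l (s n t) - l (f t)) \<le> norm (C * N (\<lambda>x. s n t x - f t x))"
      using le[of n] by eventually_elim simp
  qed
  show fi: "integrable (time_interval T) (\<lambda>t. l (f t))"
    using Bochner_Integration.integrable_diff[OF si[of 0] di[of 0]] by simp
  have "(\<lambda>n. (LINT t|time_interval T. l (s n t)) - (LINT t|time_interval T. l (f t))) \<longlonglongrightarrow> 0"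
  proof (rule tendsto_rabs_zero_cancel, rule tendsto_sandwich[OF _ _ tendsto_const tendsto_mult_right_zero[OF lim1]])
    have "\<bar>(LINT t|time_interval T. l (s n t)) - (LINT t|time_interval T. l (f t))\<bar> \<le> C * (\<integral>t. N (\<lambda>x. s n t x - f t x) \<partial>time_interval T)" for n
    proof -
      have "\<bar>(LINT t|time_interval T. l (s n t)) - (LINT t|time_interval T. l (f t))\<bar> = \<bar>LINT t|time_interval T. l (s n t) - l (f t)\<bar>"
        using si fi by simp
      also have "\<dots> \<le> (LINT t|time_interval T. \<bar>l (s n t) - l (f t)\<bar>)" by (rule integral_abs_bound)
      also have "\<dots> \<le> (LINT t|time_interval T. C * N (\<lambda>x. s n t x - f t x))"
        using le[of n] di[of n] i[of n] by (intro integral_mono_AE) auto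
      finally show ?thesis by simp
    qed
    then show "\<forall>\<^sub>F n in sequentially. \<bar>(LINT t|time_interval T. l (s n t)) - (LINT t|time_interval T. l (f t))\<bar> \<le> C * (\<integral>t. N (\<lambda>x. s n t x - f t x) \<partial>time_interval T)"
      by simp
  qed simp
  then have l1: "(\<lambda>n. LINT t|time_interval T. l (s n t)) \<longlonglongrightarrow> (LINT t|time_interval T. l (f t))" by (simp add: LIM_zero_iff)
  have "(\<lambda>n. (LINT t|time_interval T. l (s n t)) - l J) \<longlonglongrightarrow> 0"
  proof (rule tendsto_rabs_zero_cancel, rule tendsto_sandwich[OF _ _ tendsto_const tendsto_mult_right_zero[OF lim2]])
    have "\<bar>(LINT t|time_interval T. l (s n t)) - l J\<bar> \<le> C * N (\<lambda>x. (\<integral>t. s n t x \<partial>time_interval T) - J x)" for n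
      using C[OF bdd_functionalD(4)[OF b simple_in_pairing(1)[OF T s b] JX]]
        bdd_functionalD(3)[OF b simple_in_pairing(1)[OF T s b] JX] simple_in_pairing(2)[OF T s b] by simp
    then show "\<forall>\<^sub>F n in sequentially. \<bar>(LINT t|time_interval T. l (s n t)) - l J\<bar> \<le> C * N (\<lambda>x. (\<integral>t. s n t x \<partial>time_interval T) - J x)" by simp
  qed simp
  then have "(\<lambda>n. LINT t|time_interval T. l (s n t)) \<longlonglongrightarrow> l J" by (simp add: LIM_zero_iff)
  with l1 show "(LINT t|time_interval T. l (f t)) = l J" by (rule LIMSEQ_unique)
qed

text \<open>Pairing with \<open>l\<close> turns the vector valued weak derivative into a scalar one,
  to which \<open>weak_FTC\<close> applies. The two integrals in \<open>has_time_deriv\<close> share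
  the same \<open>J\<close>, so after pairing they differ by a sign only.\<close>

lemma time_deriv_FTC:
  assumes T: "0 < T" and b: "bdd_functional X N l" and fX: "\<And>t. t \<in> {0..T} \<Longrightarrow> f t \<in> X"
    and d: "has_time_deriv T X N f f'" and f': "f' \<in> L2_time T X N"
    and cont: "continuous_on {0..T} (\<lambda>t. l (f t))"
  shows "integrable (time_interval T) (\<lambda>t. l (f' t))"
    and "t \<in> {0..T} \<Longrightarrow> l (f t) = l (f 0) + (LINT r|lebesgue_on {0..t}. l (f' r))"
proof -
  interpret finite_measure "time_interval T" by (rule time_interval_finite)
  have sm: "strongly_measurable T X N f'" and sq: "integrable (time_interval T) (\<lambda>t. (N (f' t))\<^sup>2)"
    using f' by (auto simp: L2_time_def)
  have f'X: "AE t in time_interval T. f' t \<in> X" using sm by (simp add: strongly_measurable_def)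
  obtain C where C: "\<And>F. F \<in> X \<Longrightarrow> \<bar>l F\<bar> \<le> C * N F" using b unfolding bdd_functional_def by blast
  show i: "integrable (time_interval T) (\<lambda>t. l (f' t))"
  proof (rule Bochner_Integration.integrable_bound)
    \<comment> \<open>On an interval of finite length square integrability gives integrability, as a
      number is at most one plus its square.\<close>
    show "integrable (time_interval T) (\<lambda>t. \<bar>C\<bar> * (1 + (N (f' t))\<^sup>2))" using sq by simp
    show "(\<lambda>t. l (f' t)) \<in> borel_measurable (time_interval T)" by (rule strongly_measurable_pairing[OF sm b])
    show "AE t in time_interval T. norm (l (f' t)) \<le> norm (\<bar>C\<bar> * (1 + (N (f' t))\<^sup>2))"
      using f'X
    proof eventually_elim
      case (elim t)
      have "\<bar>N (f' t)\<bar> \<le> 1 + (N (f' t))\<^sup>2"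
        using sum_squares_bound[of "\<bar>N (f' t)\<bar>" 1] zero_le_power2[of "N (f' t)"] by simp
      then have "\<bar>C\<bar> * \<bar>N (f' t)\<bar> \<le> \<bar>C\<bar> * (1 + (N (f' t))\<^sup>2)" by (intro mult_left_mono) auto
      then show ?case using C[OF elim] by (simp add: abs_mult[symmetric])
    qed
  qed
  assume t: "t \<in> {0..T}"
  show "l (f t) = l (f 0) + (LINT r|lebesgue_on {0..t}. l (f' r))"
  proof (rule weak_FTC[OF T cont i[unfolded time_interval_def] _ t])
    fix \<phi> :: "real \<Rightarrow> real" assume \<phi>: "smooth \<phi>" "\<exists>a b. 0 < a \<and> b < T \<and> (\<forall>t. t \<notin> {a..b} \<longrightarrow> \<phi> t = 0)"
    then obtain J where J: "has_time_integral T X N (\<lambda>t x. deriv \<phi> t *\<^sub>R f t x) J"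
        "has_time_integral T X N (\<lambda>t x. \<phi> t *\<^sub>R f' t x) (\<lambda>x. - J x)"
      using d unfolding has_time_deriv_def by blast
    have JX: "J \<in> X" using J by (simp add: has_time_integral_def)
    have "(LINT t|time_interval T. deriv \<phi> t * l (f t)) = (LINT t|time_interval T. l (\<lambda>x. deriv \<phi> t *\<^sub>R f t x))"
      using bdd_functionalD(5)[OF b fX fX] by (intro Bochner_Integration.integral_cong) auto
    also have "\<dots> = l J" by (rule time_integral_pairing(2)[OF T J(1) b])
    also have "l J = - l (\<lambda>x. - J x)" using bdd_functionalD(5)[OF b JX JX, of "-1"] by simp
    also have "l (\<lambda>x. - J x) = (LINT t|time_interval T. l (\<lambda>x. \<phi> t *\<^sub>R f' t x))"
      by (rule time_integral_pairing(2)[OF T J(2) b, symmetric])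
    also have "\<dots> = (LINT t|time_interval T. \<phi> t * l (f' t))"
    proof (rule integral_cong_AE)
      show "(\<lambda>t. l (\<lambda>x. \<phi> t *\<^sub>R f' t x)) \<in> borel_measurable (time_interval T)"
        using time_integral_pairing(1)[OF T J(2) b] by simp
      have "\<phi> differentiable_on UNIV" using \<phi>(1) unfolding smooth_def by (auto dest: spec[of _ "[]"])
      then have "continuous_on {0..T} \<phi>" using differentiable_imp_continuous_on continuous_on_subset by blast
      then show "(\<lambda>t. \<phi> t * l (f' t)) \<in> borel_measurable (time_interval T)"
        using integrable_mult_continuous[OF i[unfolded time_interval_def]] by (simp add: time_interval_def)
      show "AE t in time_interval T. l (\<lambda>x. \<phi> t *\<^sub>R f' t x) = \<phi> t * l (f' t)"
        using f'X by eventually_elim (simp add: bdd_functionalD(5)[OF b])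
    qed
    finally show "(LINT t|lebesgue_on {0..T}. deriv \<phi> t * l (f t)) = - (LINT t|lebesgue_on {0..T}. \<phi> t * l (f' t))"
      by (simp add: time_interval_def)
  qed
qed

section \<open>Enlarging the target space, and the functionals in use on \<open>L2\<close> and on
  the dual of \<open>H\<^sup>1\<close>\<close>

lemma simple_in_mono: "X \<subseteq> Y \<Longrightarrow> simple_in T X s \<Longrightarrow> simple_in T Y s"
  by (auto simp: simple_in_def)

lemma strongly_measurable_mono: "X \<subseteq> Y \<Longrightarrow> strongly_measurable T X N f \<Longrightarrow> strongly_measurable T Y N f"
  unfolding strongly_measurable_def by (auto intro: simple_in_mono elim!: eventually_mono)

lemma L2_time_mono: "X \<subseteq> Y \<Longrightarrow> L2_time T X N \<subseteq> L2_time T Y N"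
  by (auto simp: L2_time_def intro: strongly_measurable_mono)

lemma has_time_integral_mono: "X \<subseteq> Y \<Longrightarrow> has_time_integral T X N f J \<Longrightarrow> has_time_integral T Y N f J"
  unfolding has_time_integral_def by (blast intro: simple_in_mono strongly_measurable_mono)

lemma has_time_deriv_mono: "X \<subseteq> Y \<Longrightarrow> has_time_deriv T X N f f' \<Longrightarrow> has_time_deriv T Y N f f'"
  unfolding has_time_deriv_def by (blast intro: has_time_integral_mono)

lemma L2_bdd_functional:
  assumes "e \<in> L2" shows "bdd_functional L2 L2_norm (\<lambda>F. L2_inner F e)"
  unfolding bdd_functional_def
proof (intro conjI ballI allI)
  show "\<exists>C. \<forall>F\<in>L2. \<bar>L2_inner F e\<bar> \<le> C * L2_norm F"
    using L2_Cauchy_Schwarz[OF _ assms] by (auto intro!: exI[of _ "L2_norm e"] simp: mult.commute)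
qed (auto simp: L2_inner_add_left L2_inner_scaleR_left assms)

lemma sobolev_norm_scaleR:
  assumes f: "f \<in> sobolev s" shows "sobolev_norm s (\<lambda>x. r *\<^sub>R f x) = \<bar>r\<bar> * sobolev_norm s f"
proof -
  have "L2_norm (weak_deriv m (\<lambda>x. r *\<^sub>R f x)) = \<bar>r\<bar> * L2_norm (weak_deriv m f)" if m: "fst m + snd m \<le> s" for m
  proof -
    have rf: "(\<lambda>x. r *\<^sub>R f x) \<in> sobolev s" using sobolev_lincomb[OF f f, of r 0] by simp
    have "AE x in torus. weak_deriv m (\<lambda>x. r *\<^sub>R f x) x = r *\<^sub>R weak_deriv m f x"
      using weak_deriv_lincomb[OF f f m, of r 0] by simp
    then have "L2_norm (weak_deriv m (\<lambda>x. r *\<^sub>R f x)) = L2_norm (\<lambda>x. r *\<^sub>R weak_deriv m f x)"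
      using sobolev_weak_deriv_L2[OF rf m] sobolev_weak_deriv_L2[OF f m] by (intro L2_norm_cong_AE) (auto intro: L2D)
    then show ?thesis by (simp add: L2_norm_scaleR)
  qed
  then have "(\<Sum>m | fst m + snd m \<le> s. (L2_norm (weak_deriv m (\<lambda>x. r *\<^sub>R f x)))\<^sup>2) = r\<^sup>2 * (\<Sum>m | fst m + snd m \<le> s. (L2_norm (weak_deriv m f))\<^sup>2)"
    unfolding sum_distrib_left by (intro sum.cong) (auto simp: power_mult_distrib)
  then show ?thesis by (simp add: sobolev_norm_def real_sqrt_mult)
qed

lemma sobolev_norm_diff_power2:
  assumes "f \<in> sobolev s" "h \<in> sobolev s"
  shows "(sobolev_norm s (\<lambda>x. f x - h x))\<^sup>2 \<le> 2 * (sobolev_norm s f)\<^sup>2 + 2 * (sobolev_norm s h)\<^sup>2"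
proof -
  have "(L2_norm (weak_deriv m (\<lambda>x. f x - h x)))\<^sup>2 \<le> 2 * (L2_norm (weak_deriv m f))\<^sup>2 + 2 * (L2_norm (weak_deriv m h))\<^sup>2"
    if m: "fst m + snd m \<le> s" for m
  proof -
    have L: "weak_deriv m f \<in> L2" "weak_deriv m h \<in> L2" "weak_deriv m (\<lambda>x. f x - h x) \<in> L2"
      by (rule sobolev_weak_deriv_L2[OF _ m], intro assms sobolev_diff)+
    have eq: "L2_norm (weak_deriv m (\<lambda>x. f x - h x)) = L2_norm (\<lambda>x. weak_deriv m f x - weak_deriv m h x)"
      using weak_deriv_diff[OF assms m] L by (intro L2_norm_cong_AE) (auto intro: L2D)
    show ?thesis unfolding eq using L2_parallelogram[OF L(1,2)] zero_le_power2[of "L2_norm (\<lambda>x. weak_deriv m f x + weak_deriv m h x)"] by linarith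
  qed
  then have "(\<Sum>m | fst m + snd m \<le> s. (L2_norm (weak_deriv m (\<lambda>x. f x - h x)))\<^sup>2)
      \<le> (\<Sum>m | fst m + snd m \<le> s. 2 * (L2_norm (weak_deriv m f))\<^sup>2 + 2 * (L2_norm (weak_deriv m h))\<^sup>2)"
    by (intro sum_mono) auto
  then show ?thesis by (simp add: sobolev_norm_def sum_nonneg sum.distrib sum_distrib_left)
qed

lemma H_minus1_lin:
  assumes "F \<in> H_minus1" "\<phi> \<in> sobolev 1" "\<psi> \<in> sobolev 1"
  shows "F (\<lambda>x. r * \<phi> x + s * \<psi> x) = r * F \<phi> + s * F \<psi>"
  using assms by (auto simp: H_minus1_def)

lemma H_minus1_diff:
  "F \<in> H_minus1 \<Longrightarrow> \<phi> \<in> sobolev 1 \<Longrightarrow> \<psi> \<in> sobolev 1 \<Longrightarrow> F (\<lambda>x. \<phi> x - \<psi> x) = F \<phi> - F \<psi>"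
  using H_minus1_lin[of F \<phi> \<psi> 1 "-1"] by simp

text \<open>Membership in \<open>H_minus1\<close> bounds the set whose supremum is the norm, and
  scaling to unit norm gives the estimate. Functions of norm zero cannot be scaled; for them the
  bound in the definition of \<open>H_minus1\<close> is used.\<close>

lemma H_minus1_bound:
  assumes F: "F \<in> H_minus1" and \<psi>: "\<psi> \<in> sobolev 1"
  shows "\<bar>F \<psi>\<bar> \<le> H_minus1_norm F * sobolev_norm 1 \<psi>"
proof -
  obtain C where C: "\<And>\<psi>. \<psi> \<in> sobolev 1 \<Longrightarrow> \<bar>F \<psi>\<bar> \<le> C * sobolev_norm 1 \<psi>"
    using F unfolding H_minus1_def by blast
  have bdd: "bdd_above {\<bar>F \<psi>\<bar> | \<psi>. \<psi> \<in> sobolev 1 \<and> sobolev_norm 1 \<psi> \<le> 1}"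
  proof (rule bdd_aboveI[of _ "\<bar>C\<bar>"])
    fix y assume "y \<in> {\<bar>F \<psi>\<bar> | \<psi>. \<psi> \<in> sobolev 1 \<and> sobolev_norm 1 \<psi> \<le> 1}"
    then obtain \<psi> where \<psi>: "y = \<bar>F \<psi>\<bar>" "\<psi> \<in> sobolev 1" "sobolev_norm 1 \<psi> \<le> 1" by blast
    have "y \<le> C * sobolev_norm 1 \<psi>" using C[OF \<psi>(2)] \<psi>(1) by simp
    also have "\<dots> \<le> \<bar>C\<bar> * 1" using \<psi>(3) by (intro mult_mono) auto
    finally show "y \<le> \<bar>C\<bar>" by simp
  qed
  show ?thesis
  proof (cases "sobolev_norm 1 \<psi> = 0")
    case True
    then show ?thesis using C[OF \<psi>] by simp
  next
    case False
    define s where "s = sobolev_norm 1 \<psi>"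
    have s: "s > 0" using False sobolev_norm_ge_0[of 1 \<psi>] by (simp add: s_def less_le)
    have sc: "(\<lambda>x. (1/s) * \<psi> x) \<in> sobolev 1" using sobolev_lincomb[OF \<psi> \<psi>, of "1/s" 0] by simp
    have "sobolev_norm 1 (\<lambda>x. (1/s) * \<psi> x) = 1"
      using sobolev_norm_scaleR[OF \<psi>, of "1/s"] s by (simp add: s_def)
    then have "\<bar>F (\<lambda>x. (1/s) * \<psi> x)\<bar> \<le> H_minus1_norm F"
      unfolding H_minus1_norm_def using sc by (intro cSup_upper bdd) auto
    moreover have "F (\<lambda>x. (1/s) * \<psi> x) = (1/s) * F \<psi>"
      using H_minus1_lin[OF F \<psi> \<psi>, of "1/s" 0] by simp
    then have "\<bar>F \<psi>\<bar> = s * \<bar>F (\<lambda>x. (1/s) * \<psi> x)\<bar>" using s by (simp add: abs_mult)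
    ultimately show ?thesis using s unfolding s_def[symmetric] by (simp add: mult.commute)
  qed
qed

lemma H_minus1_bdd_functional:
  assumes \<psi>: "\<psi> \<in> sobolev 1" shows "bdd_functional H_minus1 H_minus1_norm (\<lambda>F. F \<psi>)"
  unfolding bdd_functional_def
proof (intro conjI ballI allI)
  show "\<exists>C. \<forall>F\<in>H_minus1. \<bar>F \<psi>\<bar> \<le> C * H_minus1_norm F"
    using H_minus1_bound[OF _ \<psi>] by (auto intro!: exI[of _ "sobolev_norm 1 \<psi>"] simp: mult.commute)
  fix F G :: "(real^2 \<Rightarrow> real) \<Rightarrow> real" and r s :: real
  assume F: "F \<in> H_minus1" and G: "G \<in> H_minus1"
  then obtain C C' where C: "\<And>\<psi>. \<psi> \<in> sobolev 1 \<Longrightarrow> \<bar>F \<psi>\<bar> \<le> C * sobolev_norm 1 \<psi>" "\<And>\<psi>. \<psi> \<in> sobolev 1 \<Longrightarrow> \<bar>G \<psi>\<bar> \<le> C' * sobolev_norm 1 \<psi>"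
    unfolding H_minus1_def by blast
  have "\<bar>r * F \<psi> + s * G \<psi>\<bar> \<le> (\<bar>r\<bar> * C + \<bar>s\<bar> * C') * sobolev_norm 1 \<psi>" if "\<psi> \<in> sobolev 1" for \<psi>
  proof -
    have "\<bar>r * F \<psi> + s * G \<psi>\<bar> \<le> \<bar>r\<bar> * \<bar>F \<psi>\<bar> + \<bar>s\<bar> * \<bar>G \<psi>\<bar>" by (metis abs_mult abs_triangle_ineq)
    also have "\<dots> \<le> \<bar>r\<bar> * (C * sobolev_norm 1 \<psi>) + \<bar>s\<bar> * (C' * sobolev_norm 1 \<psi>)"
      using C that by (intro add_mono mult_left_mono) auto
    finally show ?thesis by (simp add: algebra_simps)
  qed
  moreover have "r * F (\<lambda>x. p * \<phi> x + q * \<psi> x) + s * G (\<lambda>x. p * \<phi> x + q * \<psi> x) = p * (r * F \<phi> + s * G \<phi>) + q * (r * F \<psi> + s * G \<psi>)"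
    if "\<phi> \<in> sobolev 1" "\<psi> \<in> sobolev 1" for \<phi> \<psi> p q
    using H_minus1_lin[OF F that] H_minus1_lin[OF G that] by (simp add: algebra_simps)
  ultimately show "(\<lambda>x. r *\<^sub>R F x + s *\<^sub>R G x) \<in> H_minus1" unfolding H_minus1_def by auto
qed simp

lemma L2_to_dual_H_minus1:
  assumes f: "f \<in> L2" shows "L2_to_dual f \<in> H_minus1"
  unfolding H_minus1_def L2_to_dual_def
proof (intro CollectI conjI ballI allI)
  fix \<phi> \<psi> :: "real^2 \<Rightarrow> real" and r s :: real assume "\<phi> \<in> sobolev 1" "\<psi> \<in> sobolev 1"
  then have L: "\<phi> \<in> L2" "\<psi> \<in> L2" by (auto intro: sobolev_L2)
  show "L2_inner f (\<lambda>x. r * \<phi> x + s * \<psi> x) = r * L2_inner f \<phi> + s * L2_inner f \<psi>"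
    using L2_inner_add_right[OF L2_scaleR[OF L(1), of r] L2_scaleR[OF L(2), of s] f] L2_inner_scaleR_right[of f r \<phi>] L2_inner_scaleR_right[of f s \<psi>]
    by simp
next
  have "\<bar>L2_inner f \<psi>\<bar> \<le> L2_norm f * sobolev_norm 1 \<psi>" if "\<psi> \<in> sobolev 1" for \<psi>
    using L2_Cauchy_Schwarz[OF f sobolev_L2[OF that]] mult_left_mono[OF L2_norm_le_sobolev_norm_0[OF sobolev_L2[OF that], of 1] L2_norm_ge_0[of f]]
    by linarith
  then show "\<exists>C. \<forall>\<psi>\<in>sobolev 1. \<bar>L2_inner f \<psi>\<bar> \<le> C * sobolev_norm 1 \<psi>" by blast
qed

lemma H_minus1_sum:
  assumes F: "F \<in> H_minus1" and I: "finite I" and \<psi>: "\<And>j. j \<in> I \<Longrightarrow> \<psi> j \<in> sobolev 1"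
  shows "F (\<lambda>x. \<Sum>j\<in>I. a j *\<^sub>R \<psi> j x) = (\<Sum>j\<in>I. a j * F (\<psi> j))"
  using I \<psi>
proof (induction I rule: finite_induct)
  case empty
  have "(\<lambda>x. 0 :: real) \<in> sobolev 1" using sobolev_sum[of "{}" "\<lambda>_. undefined" 1 "\<lambda>_. 0"] by simp
  from H_minus1_lin[OF F this this, of 0 0] show ?case by simp
next
  case (insert j I)
  have "(\<lambda>x. \<Sum>j\<in>I. a j *\<^sub>R \<psi> j x) \<in> sobolev 1" using insert by (intro sobolev_sum) auto
  from H_minus1_lin[OF F _ this, of "\<psi> j" "a j" 1] insert show ?case by simp
qed

section \<open>Energy identities\<close>

text \<open>A common scheme for both kinds of time derivative: \<open>c j\<close> is a coefficient
  of the difference of two solutions, \<open>d j\<close> that of its time derivative. Each square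
  obeys the chain rule, finitely many are added, and the bound \<open>G\<close>, independent of
  \<open>n\<close>, permits the passage to the limit under the time integral. The applications
  differ in how \<open>dom\<close> and \<open>lim\<close> are obtained.\<close>

lemma energy_identity:
  fixes c d :: "'j \<Rightarrow> real \<Rightarrow> real"
  assumes T: "0 < T"
    and c: "\<And>n j. j \<in> J n \<Longrightarrow> continuous_on {0..T} (c j)"
    and d: "\<And>n j. j \<in> J n \<Longrightarrow> integrable (time_interval T) (d j)"
    and FTC: "\<And>n j t. j \<in> J n \<Longrightarrow> t \<in> {0..T} \<Longrightarrow> c j t = c j 0 + (LINT r|lebesgue_on {0..t}. d j r)"
    and c0: "\<And>n j. j \<in> J n \<Longrightarrow> c j 0 = 0"
    and G: "integrable (time_interval T) G"
    and dom: "AE r in time_interval T. \<forall>n. \<bar>\<Sum>j\<in>J n. c j r * d j r\<bar> \<le> G r"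
    and lim: "AE r in time_interval T. (\<lambda>n. \<Sum>j\<in>J n. c j r * d j r) \<longlonglongrightarrow> D r"
    and E: "\<And>t. t \<in> {0..T} \<Longrightarrow> (\<lambda>n. \<Sum>j\<in>J n. (c j t)\<^sup>2) \<longlonglongrightarrow> E t"
  shows "integrable (time_interval T) D"
    and "t \<in> {0..T} \<Longrightarrow> E t = 2 * (LINT r|lebesgue_on {0..t}. D r)"
proof -
  have cd: "integrable (time_interval T) (\<lambda>r. c j r * d j r)" if "j \<in> J n" for n j
    using d[OF that] c[OF that] integrable_mult_continuous unfolding time_interval_def by blast
  have S: "integrable (time_interval T) (\<lambda>r. \<Sum>j\<in>J n. c j r * d j r)" for n
    using cd by (intro Bochner_Integration.integrable_sum)
  have Dm: "D \<in> borel_measurable (time_interval T)"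
    by (rule time_interval_AE_limit[OF _ lim]) (use S in auto)
  show D: "integrable (time_interval T) D"
  proof (rule Bochner_Integration.integrable_bound[OF G Dm])
    show "AE r in time_interval T. norm (D r) \<le> norm (G r)"
      using dom lim
    proof eventually_elim
      case (elim r)
      have "\<bar>D r\<bar> \<le> G r"
        by (rule LIMSEQ_le_const2[OF tendsto_rabs[OF elim(2)]]) (use elim(1) in auto)
      then show ?case by simp
    qed
  qed
  assume t: "t \<in> {0..T}"
  have sub: "{0..t} \<subseteq> {0..T}" using t by auto
  have int_sub: "integrable (lebesgue_on {0..t}) f" if "integrable (time_interval T) f" for f :: "real \<Rightarrow> real"
    using integrable_subinterval[OF that[unfolded time_interval_def] sub] .
  have AE_sub: "AE r in lebesgue_on {0..t}. P r" if "AE r in time_interval T. P r" for P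
    using that t unfolding time_interval_def by (subst (asm) AE_restrict_space_iff, simp, subst AE_restrict_space_iff) (auto elim!: eventually_mono)
  have "(\<Sum>j\<in>J n. (c j t)\<^sup>2) = 2 * (LINT r|lebesgue_on {0..t}. (\<Sum>j\<in>J n. c j r * d j r))" for n
  proof -
    have "(c j t)\<^sup>2 = 2 * (LINT r|lebesgue_on {0..t}. c j r * d j r)" if j: "j \<in> J n" for j
      using square_chain_rule[OF T c[OF j] d[OF j, unfolded time_interval_def] FTC[OF j] t] c0[OF j] by simp
    then have "(\<Sum>j\<in>J n. (c j t)\<^sup>2) = 2 * (\<Sum>j\<in>J n. (LINT r|lebesgue_on {0..t}. c j r * d j r))"
      by (simp add: sum_distrib_left)
    also have "(\<Sum>j\<in>J n. (LINT r|lebesgue_on {0..t}. c j r * d j r)) = (LINT r|lebesgue_on {0..t}. (\<Sum>j\<in>J n. c j r * d j r))"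
      by (rule Bochner_Integration.integral_sum[symmetric]) (use cd int_sub in blast)
    finally show ?thesis .
  qed
  moreover have "(\<lambda>n. LINT r|lebesgue_on {0..t}. (\<Sum>j\<in>J n. c j r * d j r)) \<longlonglongrightarrow> (LINT r|lebesgue_on {0..t}. D r)"
  proof (rule integral_dominated_convergence[where w=G])
    show "AE r in lebesgue_on {0..t}. norm (\<Sum>j\<in>J n. c j r * d j r) \<le> G r" for n
      by (rule AE_sub) (use dom in \<open>auto elim!: eventually_mono\<close>)
  qed (use int_sub[OF D] int_sub[OF S] int_sub[OF G] AE_sub[OF lim] in auto)
  ultimately have "(\<lambda>n. \<Sum>j\<in>J n. (c j t)\<^sup>2) \<longlonglongrightarrow> 2 * (LINT r|lebesgue_on {0..t}. D r)"
    by (simp add: tendsto_mult_left)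
  from LIMSEQ_unique[OF E[OF t] this] show "E t = 2 * (LINT r|lebesgue_on {0..t}. D r)" .
qed

lemma C_time_coef_continuous:
  assumes u: "u \<in> C_time T X N" and X: "X \<subseteq> L2"
    and N: "\<And>f h. f \<in> X \<Longrightarrow> h \<in> X \<Longrightarrow> L2_norm (\<lambda>x. f x - h x) \<le> N (\<lambda>x. f x - h x)"
  shows "continuous_on {0..T} (\<lambda>t. coef (u t) j)"
  unfolding continuous_on
proof
  fix t assume t: "t \<in> {0..T}"
  have uX: "u s \<in> X" if "s \<in> {0..T}" for s using u that by (auto simp: C_time_def)
  have "((\<lambda>s. coef (u s) j - coef (u t) j) \<longlongrightarrow> 0) (at t within {0..T})"
  proof (rule tendsto_rabs_zero_cancel, rule tendsto_sandwich[OF _ _ tendsto_const])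
    show "((\<lambda>s. N (\<lambda>x. u s x - u t x) * L2_norm (mode_fun j)) \<longlongrightarrow> 0) (at t within {0..T})"
      using u t by (intro tendsto_mult_left_zero) (auto simp: C_time_def)
    have "\<bar>coef (u s) j - coef (u t) j\<bar> \<le> N (\<lambda>x. u s x - u t x) * L2_norm (mode_fun j)" if s: "s \<in> {0..T}" for s
    proof -
      have L: "u s \<in> L2" "u t \<in> L2" using uX[OF s] uX[OF t] X by auto
      have "\<bar>coef (u s) j - coef (u t) j\<bar> = \<bar>L2_inner (\<lambda>x. u s x - u t x) (mode_fun j)\<bar>"
        using L by (simp add: coef_def L2_inner_diff_left)
      also have "\<dots> \<le> L2_norm (\<lambda>x. u s x - u t x) * L2_norm (mode_fun j)" using L by (intro L2_Cauchy_Schwarz) auto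
      also have "\<dots> \<le> N (\<lambda>x. u s x - u t x) * L2_norm (mode_fun j)" by (intro mult_right_mono N uX s t) simp
      finally show ?thesis .
    qed
    then show "\<forall>\<^sub>F s in at t within {0..T}. \<bar>coef (u s) j - coef (u t) j\<bar> \<le> N (\<lambda>x. u s x - u t x) * L2_norm (mode_fun j)"
      by (auto simp: eventually_at_filter)
  qed simp
  then show "((\<lambda>s. coef (u s) j) \<longlongrightarrow> coef (u t) j) (at t within {0..T})" by (simp add: LIM_zero_iff)
qed

lemma coef_diff: "f \<in> L2 \<Longrightarrow> h \<in> L2 \<Longrightarrow> coef (\<lambda>x. f x - h x) j = coef f j - coef h j"
  by (simp add: coef_def L2_inner_diff_left)

lemma coef_cong_AE:
  assumes "f \<in> L2" "h \<in> L2" "AE x in torus. f x = h x" shows "coef f j = coef h j"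
  unfolding coef_def using assms by (intro L2_inner_cong_AE) (auto intro: L2D)

lemma sum_coef_le:
  assumes "f \<in> L2" "h \<in> L2" shows "\<bar>\<Sum>j\<in>modes n. coef f j * coef h j\<bar> \<le> L2_norm f * L2_norm h"
proof -
  have "\<bar>L2_inner (proj n f) h\<bar> \<le> L2_norm (proj n f) * L2_norm h" by (rule L2_Cauchy_Schwarz[OF proj_L2 assms(2)])
  also have "\<dots> \<le> L2_norm f * L2_norm h" by (intro mult_right_mono proj_norm_le assms) simp
  finally show ?thesis by (simp add: proj_inner[OF assms(2)])
qed

lemma product_le_squares:
  fixes a b p q r s :: real
  assumes "a\<^sup>2 \<le> 2 * p + 2 * q" "b\<^sup>2 \<le> 2 * r + 2 * s" shows "a * b \<le> p + q + r + s"
  using sum_squares_bound[of a b] assms by simp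

text \<open>Difference and time derivative are both in \<open>L2\<close> at almost every time, so
  Parseval gives the limit of the mode sums and the product of the two norms bounds them
  uniformly.\<close>

lemma energy_vector:
  fixes u v u' v' :: "real \<Rightarrow> real^2 \<Rightarrow> real^2"
  assumes T: "0 < T"
    and uC: "u \<in> C_time T V_space (sobolev_norm 1)" and vC: "v \<in> C_time T V_space (sobolev_norm 1)"
    and uL: "u \<in> L2_time T (sobolev 2 \<inter> V_space) (sobolev_norm 2)" and vL: "v \<in> L2_time T (sobolev 2 \<inter> V_space) (sobolev_norm 2)"
    and u': "u' \<in> L2_time T H_space L2_norm" "has_time_deriv T H_space L2_norm u u'"
    and v': "v' \<in> L2_time T H_space L2_norm" "has_time_deriv T H_space L2_norm v v'"
    and init: "AE x in torus. u 0 x = v 0 x"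
  shows "integrable (time_interval T) (\<lambda>r. L2_inner (\<lambda>x. u r x - v r x) (\<lambda>x. u' r x - v' r x))"
    and "t \<in> {0..T} \<Longrightarrow> (L2_norm (\<lambda>x. u t x - v t x))\<^sup>2 = 2 * (LINT r|lebesgue_on {0..t}. L2_inner (\<lambda>x. u r x - v r x) (\<lambda>x. u' r x - v' r x))"
proof -
  have HL: "H_space \<subseteq> L2" by (auto intro: H_space_L2)
  have VL: "V_space \<subseteq> L2" using V_space_sobolev sobolev_L2 by blast
  have uV: "u t \<in> L2" "v t \<in> L2" if "t \<in> {0..T}" for t using uC vC that VL by (auto simp: C_time_def)
  have N: "L2_norm (\<lambda>x. f x - h x) \<le> sobolev_norm 1 (\<lambda>x. f x - h x)" if "f \<in> V_space" "h \<in> V_space" for f h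
    using that VL by (intro L2_norm_le_sobolev_norm_0) auto
  note uc = C_time_coef_continuous[OF uC VL N] and vc = C_time_coef_continuous[OF vC VL N]
  note bf = L2_bdd_functional[OF mode_fun_L2]
  have uF: "integrable (time_interval T) (\<lambda>r. coef (u' r) j)" "t \<in> {0..T} \<Longrightarrow> coef (u t) j = coef (u 0) j + (LINT r|lebesgue_on {0..t}. coef (u' r) j)" for j t
    using time_deriv_FTC[OF T bf uV(1) has_time_deriv_mono[OF HL u'(2)] subsetD[OF L2_time_mono[OF HL] u'(1)]] uc
    unfolding coef_def by blast+
  have vF: "integrable (time_interval T) (\<lambda>r. coef (v' r) j)" "t \<in> {0..T} \<Longrightarrow> coef (v t) j = coef (v 0) j + (LINT r|lebesgue_on {0..t}. coef (v' r) j)" for j t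
    using time_deriv_FTC[OF T bf uV(2) has_time_deriv_mono[OF HL v'(2)] subsetD[OF L2_time_mono[OF HL] v'(1)]] vc
    unfolding coef_def by blast+
  let ?c = "\<lambda>j t. coef (u t) j - coef (v t) j" and ?d = "\<lambda>j r. coef (u' r) j - coef (v' r) j"
  \<comment> \<open>Built from norms whose squares the solution class makes integrable in time; the
    \<open>H\<^sup>2\<close> norms control the \<open>L2\<close> norm of the difference.\<close>
  let ?G = "\<lambda>r. (sobolev_norm 2 (u r))\<^sup>2 + (sobolev_norm 2 (v r))\<^sup>2 + (L2_norm (u' r))\<^sup>2 + (L2_norm (v' r))\<^sup>2"
  let ?w = "\<lambda>r x. u r x - v r x" and ?w' = "\<lambda>r x. u' r x - v' r x"
  have AEH: "AE r in time_interval T. u' r \<in> L2 \<and> v' r \<in> L2 \<and> r \<in> {0..T}"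
  proof -
    have "AE r in time_interval T. u' r \<in> H_space" "AE r in time_interval T. v' r \<in> H_space"
      using u'(1) v'(1) by (auto simp: L2_time_def strongly_measurable_def)
    then show ?thesis using AE_space by eventually_elim (use HL in auto)
  qed
  have tot: "?c j t = coef (?w t) j" if "t \<in> {0..T}" for j t using uV[OF that] by (simp add: coef_diff)
  have *: "integrable (time_interval T) (\<lambda>r. L2_inner (?w r) (?w' r)) \<and>
     (t \<in> {0..T} \<longrightarrow> (L2_norm (?w t))\<^sup>2 = 2 * (LINT r|lebesgue_on {0..t}. L2_inner (?w r) (?w' r)))" for t
  proof (intro conjI impI)
    note ei = energy_identity[OF T, where J=modes and c="?c" and d="?d" and G="?G" and D="\<lambda>r. L2_inner (?w r) (?w' r)" and E="\<lambda>t. (L2_norm (?w t))\<^sup>2"]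
    have 1: "continuous_on {0..T} (?c j)" for j by (intro continuous_intros uc vc)
    have 2: "integrable (time_interval T) (?d j)" for j using uF(1) vF(1) by simp
    have 3: "?c j t = ?c j 0 + (LINT r|lebesgue_on {0..t}. ?d j r)" if t: "t \<in> {0..T}" for j t
    proof -
      have sub: "{0..t} \<subseteq> {0..T}" using t by auto
      show ?thesis using uF(2)[OF t, of j] vF(2)[OF t, of j]
          integrable_subinterval[OF uF(1)[unfolded time_interval_def] sub] integrable_subinterval[OF vF(1)[unfolded time_interval_def] sub]
        by simp
    qed
    have 4: "?c j 0 = 0" for j using coef_cong_AE[OF uV(1) uV(2) init, of j] T by simp
    have 5: "integrable (time_interval T) ?G" using uL vL u'(1) v'(1) by (simp add: L2_time_def)
    have uS: "AE r in time_interval T. u r \<in> sobolev 2 \<and> v r \<in> sobolev 2"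
    proof -
      have "AE r in time_interval T. u r \<in> sobolev 2 \<inter> V_space" "AE r in time_interval T. v r \<in> sobolev 2 \<inter> V_space"
        using uL vL by (auto simp: L2_time_def strongly_measurable_def)
      then show ?thesis by eventually_elim auto
    qed
    have 6: "AE r in time_interval T. \<forall>n. \<bar>\<Sum>j\<in>modes n. ?c j r * ?d j r\<bar> \<le> ?G r"
      using AEH uS
    proof eventually_elim
      case (elim r)
      then have L: "u r \<in> L2" "v r \<in> L2" "u' r \<in> L2" "v' r \<in> L2" using uV by auto
      have "\<bar>\<Sum>j\<in>modes n. ?c j r * ?d j r\<bar> \<le> L2_norm (?w r) * L2_norm (?w' r)" for n
        using sum_coef_le[of "?w r" "?w' r" n] L by (simp add: coef_diff)
      moreover have "L2_norm (?w r) * L2_norm (?w' r) \<le> ?G r"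
      proof (rule product_le_squares)
        have "(L2_norm (?w r))\<^sup>2 \<le> (sobolev_norm 2 (?w r))\<^sup>2" using L by (intro power_mono L2_norm_le_sobolev_norm_0) auto
        also have "\<dots> \<le> 2 * (sobolev_norm 2 (u r))\<^sup>2 + 2 * (sobolev_norm 2 (v r))\<^sup>2" using elim by (intro sobolev_norm_diff_power2) auto
        finally show "(L2_norm (?w r))\<^sup>2 \<le> 2 * (sobolev_norm 2 (u r))\<^sup>2 + 2 * (sobolev_norm 2 (v r))\<^sup>2" .
        show "(L2_norm (?w' r))\<^sup>2 \<le> 2 * (L2_norm (u' r))\<^sup>2 + 2 * (L2_norm (v' r))\<^sup>2"
          using L2_parallelogram[OF L(3,4)] zero_le_power2[of "L2_norm (\<lambda>x. u' r x + v' r x)"] by linarith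
      qed
      ultimately show ?case by (meson order_trans)
    qed
    have 7: "AE r in time_interval T. (\<lambda>n. \<Sum>j\<in>modes n. ?c j r * ?d j r) \<longlonglongrightarrow> L2_inner (?w r) (?w' r)"
      using AEH
    proof eventually_elim
      case (elim r)
      then have L: "u r \<in> L2" "v r \<in> L2" "u' r \<in> L2" "v' r \<in> L2" using uV by auto
      show ?case using Parseval[of "?w r" "?w' r"] L by (simp add: coef_diff)
    qed
    have 8: "(\<lambda>n. \<Sum>j\<in>modes n. (?c j t)\<^sup>2) \<longlonglongrightarrow> (L2_norm (?w t))\<^sup>2" if t: "t \<in> {0..T}" for t
      using Parseval[of "?w t" "?w t"] uV[OF t] by (simp add: coef_diff power2_eq_square L2_norm_power2[unfolded power2_eq_square])
    show "integrable (time_interval T) (\<lambda>r. L2_inner (?w r) (?w' r))"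
      by (rule ei(1)) (rule 1 2 3 4 5 6 7 8 | assumption)+
    show "t \<in> {0..T} \<Longrightarrow> (L2_norm (?w t))\<^sup>2 = 2 * (LINT r|lebesgue_on {0..t}. L2_inner (?w r) (?w' r))"
      by (rule ei(2)) (rule 1 2 3 4 5 6 7 8 | assumption)+
  qed
  then show "integrable (time_interval T) (\<lambda>r. L2_inner (?w r) (?w' r))"
    and "t \<in> {0..T} \<Longrightarrow> (L2_norm (?w t))\<^sup>2 = 2 * (LINT r|lebesgue_on {0..t}. L2_inner (?w r) (?w' r))" by blast+
qed

text \<open>The time derivative is a functional on \<open>H\<^sup>1\<close>, so Parseval does not
  apply. The mode sum is the value of this functional at \<open>proj n\<close> of the difference;
  projections are bounded in \<open>H\<^sup>1\<close> uniformly in \<open>n\<close> and converge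
  there, which gives domination and limit.\<close>

lemma energy_scalar:
  fixes u v :: "real \<Rightarrow> real^2 \<Rightarrow> real"
  assumes T: "0 < T"
    and uC: "u \<in> C_time T L2 L2_norm" and vC: "v \<in> C_time T L2 L2_norm"
    and uL: "u \<in> L2_time T (sobolev 1) (sobolev_norm 1)" and vL: "v \<in> L2_time T (sobolev 1) (sobolev_norm 1)"
    and u': "u' \<in> L2_time T H_minus1 H_minus1_norm" "has_time_deriv T H_minus1 H_minus1_norm (\<lambda>t. L2_to_dual (u t)) u'"
    and v': "v' \<in> L2_time T H_minus1 H_minus1_norm" "has_time_deriv T H_minus1 H_minus1_norm (\<lambda>t. L2_to_dual (v t)) v'"
    and init: "AE x in torus. u 0 x = v 0 x"
  shows "integrable (time_interval T) (\<lambda>r. u' r (\<lambda>x. u r x - v r x) - v' r (\<lambda>x. u r x - v r x))"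
    and "t \<in> {0..T} \<Longrightarrow> (L2_norm (\<lambda>x. u t x - v t x))\<^sup>2 = 2 * (LINT r|lebesgue_on {0..t}. u' r (\<lambda>x. u r x - v r x) - v' r (\<lambda>x. u r x - v r x))"
proof -
  have uV: "u t \<in> L2" "v t \<in> L2" if "t \<in> {0..T}" for t using uC vC that by (auto simp: C_time_def)
  note uc = C_time_coef_continuous[OF uC order_refl order_refl] and vc = C_time_coef_continuous[OF vC order_refl order_refl]
  have bf: "bdd_functional H_minus1 H_minus1_norm (\<lambda>F. F (mode_fun j))" if "j \<in> modes n" for j n
    by (rule H_minus1_bdd_functional[OF mode_sobolev[OF that]])
  have cd: "L2_to_dual f (mode_fun j) = coef f j" for f :: "real^2 \<Rightarrow> real" and j by (simp add: L2_to_dual_def coef_def)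
  have uF: "integrable (time_interval T) (\<lambda>r. u' r (mode_fun j))" "t \<in> {0..T} \<Longrightarrow> coef (u t) j = coef (u 0) j + (LINT r|lebesgue_on {0..t}. u' r (mode_fun j))"
    if "j \<in> modes n" for j n t
  proof -
    have uc': "continuous_on {0..T} (\<lambda>t. L2_to_dual (u t) (mode_fun j))" by (simp only: cd uc)
    have X: "L2_to_dual (u t) \<in> H_minus1" if "t \<in> {0..T}" for t by (rule L2_to_dual_H_minus1[OF uV(1)[OF that]])
    show "integrable (time_interval T) (\<lambda>r. u' r (mode_fun j))"
      by (rule time_deriv_FTC(1)[where f="\<lambda>t. L2_to_dual (u t)" and l="\<lambda>F. F (mode_fun j)", OF T bf[OF that] X u'(2) u'(1) uc'])
    assume t: "t \<in> {0..T}"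
    have "L2_to_dual (u t) (mode_fun j) = L2_to_dual (u 0) (mode_fun j) + (LINT r|lebesgue_on {0..t}. u' r (mode_fun j))"
      by (rule time_deriv_FTC(2)[where f="\<lambda>t. L2_to_dual (u t)" and l="\<lambda>F. F (mode_fun j)", OF T bf[OF that] X u'(2) u'(1) uc' t])
    then show "coef (u t) j = coef (u 0) j + (LINT r|lebesgue_on {0..t}. u' r (mode_fun j))" by (simp only: cd)
  qed
  have vF: "integrable (time_interval T) (\<lambda>r. v' r (mode_fun j))" "t \<in> {0..T} \<Longrightarrow> coef (v t) j = coef (v 0) j + (LINT r|lebesgue_on {0..t}. v' r (mode_fun j))"
    if "j \<in> modes n" for j n t
  proof -
    have vc': "continuous_on {0..T} (\<lambda>t. L2_to_dual (v t) (mode_fun j))" by (simp only: cd vc)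
    have X: "L2_to_dual (v t) \<in> H_minus1" if "t \<in> {0..T}" for t by (rule L2_to_dual_H_minus1[OF uV(2)[OF that]])
    show "integrable (time_interval T) (\<lambda>r. v' r (mode_fun j))"
      by (rule time_deriv_FTC(1)[where f="\<lambda>t. L2_to_dual (v t)" and l="\<lambda>F. F (mode_fun j)", OF T bf[OF that] X v'(2) v'(1) vc'])
    assume t: "t \<in> {0..T}"
    have "L2_to_dual (v t) (mode_fun j) = L2_to_dual (v 0) (mode_fun j) + (LINT r|lebesgue_on {0..t}. v' r (mode_fun j))"
      by (rule time_deriv_FTC(2)[where f="\<lambda>t. L2_to_dual (v t)" and l="\<lambda>F. F (mode_fun j)", OF T bf[OF that] X v'(2) v'(1) vc' t])
    then show "coef (v t) j = coef (v 0) j + (LINT r|lebesgue_on {0..t}. v' r (mode_fun j))" by (simp only: cd)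
  qed
  let ?c = "\<lambda>j t. coef (u t) j - coef (v t) j" and ?d = "\<lambda>j r. u' r (mode_fun j) - v' r (mode_fun j)"
  let ?G = "\<lambda>r. (sobolev_norm 1 (u r))\<^sup>2 + (sobolev_norm 1 (v r))\<^sup>2 + (H_minus1_norm (u' r))\<^sup>2 + (H_minus1_norm (v' r))\<^sup>2"
  let ?w = "\<lambda>r x. u r x - v r x"
  let ?D = "\<lambda>r. u' r (?w r) - v' r (?w r)"
  have AEH: "AE r in time_interval T. u' r \<in> H_minus1 \<and> v' r \<in> H_minus1 \<and> u r \<in> sobolev 1 \<and> v r \<in> sobolev 1"
  proof -
    have "AE r in time_interval T. u' r \<in> H_minus1" "AE r in time_interval T. v' r \<in> H_minus1"
      "AE r in time_interval T. u r \<in> sobolev 1" "AE r in time_interval T. v r \<in> sobolev 1"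
      using u'(1) v'(1) uL vL by (auto simp: L2_time_def strongly_measurable_def)
    then show ?thesis by eventually_elim auto
  qed
  have sum_eq: "(\<Sum>j\<in>modes n. ?c j r * ?d j r) = u' r (proj n (?w r)) - v' r (proj n (?w r))"
    if "u' r \<in> H_minus1" "v' r \<in> H_minus1" "u r \<in> sobolev 1" "v r \<in> sobolev 1" for r n
  proof -
    have "?c j r = coef (?w r) j" for j using that by (simp add: coef_diff sobolev_L2)
    then show ?thesis
      using H_minus1_sum[where a="coef (?w r)", OF that(1) finite_modes mode_sobolev[where n=n]]
        H_minus1_sum[where a="coef (?w r)", OF that(2) finite_modes mode_sobolev[where n=n]]
      by (simp add: proj_def right_diff_distrib sum_subtractf)
  qed
  have *: "integrable (time_interval T) ?D \<and>
     (t \<in> {0..T} \<longrightarrow> (L2_norm (?w t))\<^sup>2 = 2 * (LINT r|lebesgue_on {0..t}. ?D r))" for t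
  proof (intro conjI impI)
    note ei = energy_identity[OF T, where J=modes and c="?c" and d="?d" and G="?G" and D="?D" and E="\<lambda>t. (L2_norm (?w t))\<^sup>2"]
    have 1: "continuous_on {0..T} (?c j)" for j by (intro continuous_intros uc vc)
    have 2: "integrable (time_interval T) (?d j)" if "j \<in> modes n" for j n using uF(1)[OF that] vF(1)[OF that] by simp
    have 3: "?c j t = ?c j 0 + (LINT r|lebesgue_on {0..t}. ?d j r)" if j: "j \<in> modes n" and t: "t \<in> {0..T}" for j n t
    proof -
      have sub: "{0..t} \<subseteq> {0..T}" using t by auto
      show ?thesis using uF(2)[OF j t] vF(2)[OF j t]
          integrable_subinterval[OF uF(1)[OF j, unfolded time_interval_def] sub] integrable_subinterval[OF vF(1)[OF j, unfolded time_interval_def] sub]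
        by simp
    qed
    have 4: "?c j 0 = 0" for j using coef_cong_AE[OF uV(1) uV(2) init, of j] T by simp
    have 5: "integrable (time_interval T) ?G" using uL vL u'(1) v'(1) by (simp add: L2_time_def)
    have 6: "AE r in time_interval T. \<forall>n. \<bar>\<Sum>j\<in>modes n. ?c j r * ?d j r\<bar> \<le> ?G r"
      using AEH
    proof eventually_elim
      case (elim r)
      then have e: "u' r \<in> H_minus1" "v' r \<in> H_minus1" "u r \<in> sobolev 1" "v r \<in> sobolev 1" by auto
      have w: "?w r \<in> sobolev 1" using e by (intro sobolev_diff)
      have wn: "(sobolev_norm 1 (?w r))\<^sup>2 \<le> 2 * (sobolev_norm 1 (u r))\<^sup>2 + 2 * (sobolev_norm 1 (v r))\<^sup>2"
        by (rule sobolev_norm_diff_power2[OF e(3,4)])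
      have "\<bar>u' r (proj n (?w r)) - v' r (proj n (?w r))\<bar> \<le> sobolev_norm 1 (?w r) * (\<bar>H_minus1_norm (u' r)\<bar> + \<bar>H_minus1_norm (v' r)\<bar>)" for n
      proof -
        have "\<bar>F (proj n (?w r))\<bar> \<le> sobolev_norm 1 (?w r) * \<bar>H_minus1_norm F\<bar>" if "F \<in> H_minus1" for F
        proof -
          have "\<bar>F (proj n (?w r))\<bar> \<le> H_minus1_norm F * sobolev_norm 1 (proj n (?w r))"
            by (rule H_minus1_bound[OF that proj_sobolev])
          also have "\<dots> \<le> \<bar>H_minus1_norm F\<bar> * sobolev_norm 1 (?w r)"
            by (intro mult_mono sobolev_norm_proj[OF w]) auto
          finally show ?thesis by (simp add: mult.commute)
        qed
        from this[OF e(1)] this[OF e(2)] show ?thesis unfolding distrib_left by linarith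
      qed
      moreover have "sobolev_norm 1 (?w r) * (\<bar>H_minus1_norm (u' r)\<bar> + \<bar>H_minus1_norm (v' r)\<bar>) \<le> ?G r"
      proof (rule product_le_squares[OF wn])
        show "(\<bar>H_minus1_norm (u' r)\<bar> + \<bar>H_minus1_norm (v' r)\<bar>)\<^sup>2 \<le> 2 * (H_minus1_norm (u' r))\<^sup>2 + 2 * (H_minus1_norm (v' r))\<^sup>2"
          using sum_squares_bound[of "\<bar>H_minus1_norm (u' r)\<bar>" "\<bar>H_minus1_norm (v' r)\<bar>"] by (simp add: power2_sum)
      qed
      ultimately show ?case unfolding sum_eq[OF e] by (meson order_trans)
    qed
    have 7: "AE r in time_interval T. (\<lambda>n. \<Sum>j\<in>modes n. ?c j r * ?d j r) \<longlonglongrightarrow> ?D r"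
      using AEH
    proof eventually_elim
      case (elim r)
      then have e: "u' r \<in> H_minus1" "v' r \<in> H_minus1" "u r \<in> sobolev 1" "v r \<in> sobolev 1" by auto
      have w: "?w r \<in> sobolev 1" using e by (intro sobolev_diff)
      have "(\<lambda>n. F (proj n (?w r))) \<longlonglongrightarrow> F (?w r)" if F: "F \<in> H_minus1" for F
      proof -
        have "(\<lambda>n. F (proj n (?w r)) - F (?w r)) \<longlonglongrightarrow> 0"
        proof (rule tendsto_rabs_zero_cancel, rule tendsto_sandwich[OF _ _ tendsto_const tendsto_mult_right_zero[OF sobolev_norm_proj_converges[OF w]]])
          have "\<bar>F (proj n (?w r)) - F (?w r)\<bar> \<le> H_minus1_norm F * sobolev_norm 1 (\<lambda>x. proj n (?w r) x - ?w r x)" for n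
            unfolding H_minus1_diff[OF F proj_sobolev w, symmetric] by (rule H_minus1_bound[OF F sobolev_diff[OF proj_sobolev w]])
          then show "\<forall>\<^sub>F n in sequentially. \<bar>F (proj n (?w r)) - F (?w r)\<bar> \<le> H_minus1_norm F * sobolev_norm 1 (\<lambda>x. proj n (?w r) x - ?w r x)" by simp
        qed simp
        then show ?thesis by (simp add: LIM_zero_iff)
      qed
      from tendsto_diff[OF this[OF e(1)] this[OF e(2)]] show ?case unfolding sum_eq[OF e] .
    qed
    have 8: "(\<lambda>n. \<Sum>j\<in>modes n. (?c j t)\<^sup>2) \<longlonglongrightarrow> (L2_norm (?w t))\<^sup>2" if t: "t \<in> {0..T}" for t
      using Parseval[of "?w t" "?w t"] uV[OF t] by (simp add: coef_diff power2_eq_square L2_norm_power2[unfolded power2_eq_square])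
    show "integrable (time_interval T) ?D"
      by (rule ei(1)) (rule 1 2 3 4 5 6 7 8 | assumption)+
    show "t \<in> {0..T} \<Longrightarrow> (L2_norm (?w t))\<^sup>2 = 2 * (LINT r|lebesgue_on {0..t}. ?D r)"
      by (rule ei(2)) (rule 1 2 3 4 5 6 7 8 | assumption)+
  qed
  then show "integrable (time_interval T) ?D"
    and "t \<in> {0..T} \<Longrightarrow> (L2_norm (?w t))\<^sup>2 = 2 * (LINT r|lebesgue_on {0..t}. ?D r)" by blast+
qed

section \<open>Estimates for the nonlinear terms\<close>

lemma AE_bounded_scaleR_L2:
  fixes p :: "real^2 \<Rightarrow> real" and f :: "real^2 \<Rightarrow> 'a::euclidean_space"
  assumes "p \<in> borel_measurable torus" "f \<in> borel_measurable torus" "q \<in> L2"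
    "AE x in torus. norm (p x *\<^sub>R f x) \<le> norm (q x :: 'b::euclidean_space)"
  shows "(\<lambda>x. p x *\<^sub>R f x) \<in> L2" "L2_norm (\<lambda>x. p x *\<^sub>R f x) \<le> L2_norm q"
proof -
  have m: "(\<lambda>x. p x *\<^sub>R f x) \<in> borel_measurable torus" using assms by simp
  show "(\<lambda>x. p x *\<^sub>R f x) \<in> L2" "L2_norm (\<lambda>x. p x *\<^sub>R f x) \<le> L2_norm q"
    by (rule L2_norm_mono[OF assms(4) m assms(3)])+
qed

lemma component_measurable:
  fixes v :: "real^2 \<Rightarrow> real^2"
  assumes "v \<in> borel_measurable torus" shows "(\<lambda>x. v x $ i) \<in> borel_measurable torus"
proof -
  have "(\<lambda>x. v x \<bullet> axis i 1) \<in> borel_measurable torus" using assms by simp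
  then show ?thesis by (simp add: inner_axis)
qed

lemma sobolev_1_derivs:
  assumes "f \<in> sobolev 1" shows "f \<in> L2" "D1 f \<in> L2" "D2 f \<in> L2"
  using assms sobolev_weak_deriv_L2[OF assms, of "(1,0)"] sobolev_weak_deriv_L2[OF assms, of "(0,1)"] by (auto intro: sobolev_L2)

lemma D_diff:
  assumes "f \<in> sobolev 1" "h \<in> sobolev 1"
  shows "AE x in torus. D1 (\<lambda>x. f x - h x) x = D1 f x - D1 h x" "AE x in torus. D2 (\<lambda>x. f x - h x) x = D2 f x - D2 h x"
  using weak_deriv_diff[OF assms, of "(1,0)"] weak_deriv_diff[OF assms, of "(0,1)"] by auto

lemma advect_bounded_velocity:
  fixes f :: "real^2 \<Rightarrow> 'a::euclidean_space"
  assumes v: "v \<in> borel_measurable torus" "AE x in torus. norm (v x) \<le> B" and f: "f \<in> sobolev 1" and B: "0 \<le> B"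
  shows "advect v f \<in> L2" "L2_norm (advect v f) \<le> B * (L2_norm (D1 f) + L2_norm (D2 f))"
proof -
  note L = sobolev_1_derivs[OF f]
  have t: "(\<lambda>x. v x $ i *\<^sub>R F x) \<in> L2 \<and> L2_norm (\<lambda>x. v x $ i *\<^sub>R F x) \<le> \<bar>B\<bar> * L2_norm F" if F: "F \<in> L2" for F :: "real^2 \<Rightarrow> 'a" and i
  proof -
    have "AE x in torus. norm (v x $ i *\<^sub>R F x) \<le> norm (B *\<^sub>R F x)"
      using v(2)
    proof eventually_elim
      case (elim x)
      have "\<bar>v x $ i\<bar> \<le> \<bar>B\<bar>" using component_le_norm_cart[of "v x" i] elim by linarith
      then show ?case by (simp add: mult_right_mono)
    qed
    from AE_bounded_scaleR_L2[OF component_measurable[OF v(1)] L2D(1)[OF F] L2_scaleR[OF F] this]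
    show ?thesis by (simp add: L2_norm_scaleR)
  qed
  show "advect v f \<in> L2" unfolding advect_def using t[OF L(2)] t[OF L(3)] by auto
  have "L2_norm (advect v f) \<le> L2_norm (\<lambda>x. v x $ 1 *\<^sub>R D1 f x) + L2_norm (\<lambda>x. v x $ 2 *\<^sub>R D2 f x)"
    unfolding advect_def using t[OF L(2)] t[OF L(3)] by (intro L2_norm_triangle) auto
  also have "\<dots> \<le> B * (L2_norm (D1 f) + L2_norm (D2 f))"
    using t[OF L(2), of 1] t[OF L(3), of 2] B by (simp add: distrib_left)
  finally show "L2_norm (advect v f) \<le> B * (L2_norm (D1 f) + L2_norm (D2 f))" .
qed

lemma advect_bounded_gradient:
  fixes f :: "real^2 \<Rightarrow> 'a::euclidean_space"
  assumes v: "v \<in> L2" and f: "f \<in> sobolev 1" "AE x in torus. norm (D1 f x) \<le> B" "AE x in torus. norm (D2 f x) \<le> B" and B: "0 \<le> B"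
  shows "advect v f \<in> L2" "L2_norm (advect v f) \<le> 2 * B * L2_norm v"
proof -
  note L = sobolev_1_derivs[OF f(1)]
  have t: "(\<lambda>x. v x $ i *\<^sub>R F x) \<in> L2 \<and> L2_norm (\<lambda>x. v x $ i *\<^sub>R F x) \<le> B * L2_norm v"
    if F: "F \<in> L2" "AE x in torus. norm (F x) \<le> B" for F :: "real^2 \<Rightarrow> 'a" and i
  proof -
    have "AE x in torus. norm (v x $ i *\<^sub>R F x) \<le> norm (B *\<^sub>R v x)"
      using F(2)
    proof eventually_elim
      case (elim x)
      have "\<bar>v x $ i\<bar> * norm (F x) \<le> norm (v x) * B" using elim component_le_norm_cart[of "v x" i] by (intro mult_mono) auto
      then show ?case using B by (simp add: mult.commute)
    qed
    from AE_bounded_scaleR_L2[OF component_measurable[OF L2D(1)[OF v]] L2D(1)[OF F(1)] L2_scaleR[OF v] this]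
    show ?thesis using B by (simp add: L2_norm_scaleR)
  qed
  show "advect v f \<in> L2" unfolding advect_def using t[OF L(2) f(2)] t[OF L(3) f(3)] by auto
  have "L2_norm (advect v f) \<le> L2_norm (\<lambda>x. v x $ 1 *\<^sub>R D1 f x) + L2_norm (\<lambda>x. v x $ 2 *\<^sub>R D2 f x)"
    unfolding advect_def using t[OF L(2) f(2)] t[OF L(3) f(3)] by (intro L2_norm_triangle) auto
  also have "\<dots> \<le> 2 * B * L2_norm v" using t[OF L(2) f(2), of 1] t[OF L(3) f(3), of 2] by simp
  finally show "L2_norm (advect v f) \<le> 2 * B * L2_norm v" .
qed

text \<open>The difference is the transport of \<open>f - h\<close> by \<open>v\<close> plus the
  transport of \<open>h\<close> by \<open>v - w\<close>. The first uses the bound on the values of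
  \<open>v\<close>, the second the bound on the gradient of \<open>h\<close>; the bound on
  \<open>w\<close> places \<open>advect w h\<close> in \<open>L2\<close>.\<close>

lemma advect_difference:
  fixes f h :: "real^2 \<Rightarrow> 'a::euclidean_space"
  assumes v: "v \<in> L2" "AE x in torus. norm (v x) \<le> B" and w: "w \<in> L2" "AE x in torus. norm (w x) \<le> B"
    and f: "f \<in> sobolev 1" and h: "h \<in> sobolev 1" "AE x in torus. norm (D1 h x) \<le> B" "AE x in torus. norm (D2 h x) \<le> B"
    and B: "0 \<le> B" and g: "g \<in> L2"
  shows "\<bar>L2_inner (advect v f) g - L2_inner (advect w h) g\<bar>
     \<le> (B * (L2_norm (D1 (\<lambda>x. f x - h x)) + L2_norm (D2 (\<lambda>x. f x - h x))) + 2 * B * L2_norm (\<lambda>x. v x - w x)) * L2_norm g"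
proof -
  let ?e = "\<lambda>x. f x - h x" and ?d = "\<lambda>x. v x - w x"
  have e: "?e \<in> sobolev 1" by (rule sobolev_diff[OF f h(1)])
  have d: "?d \<in> L2" using v w by auto
  note A1 = advect_bounded_velocity[OF L2D(1)[OF v(1)] v(2) e B] and A2 = advect_bounded_gradient[OF d h B]
    and A3 = advect_bounded_velocity(1)[OF L2D(1)[OF v(1)] v(2) f B] and A4 = advect_bounded_velocity(1)[OF L2D(1)[OF w(1)] w(2) h(1) B]
  have "AE x in torus. advect v f x - advect w h x = advect v ?e x + advect ?d h x"
    using D_diff[OF f h(1)]
  proof eventually_elim
    case (elim x)
    show ?case unfolding advect_def elim by (simp add: algebra_simps)
  qed
  then have "L2_inner (\<lambda>x. advect v f x - advect w h x) g = L2_inner (\<lambda>x. advect v ?e x + advect ?d h x) g"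
    using A1(1) A2(1) A3 A4 g by (intro L2_inner_cong_AE) (auto intro!: L2D L2_add L2_diff)
  then have "L2_inner (advect v f) g - L2_inner (advect w h) g = L2_inner (advect v ?e) g + L2_inner (advect ?d h) g"
    using A1(1) A2(1) A3 A4 g by (simp add: L2_inner_add_left L2_inner_diff_left)
  also have "\<bar>\<dots>\<bar> \<le> \<bar>L2_inner (advect v ?e) g\<bar> + \<bar>L2_inner (advect ?d h) g\<bar>" by (rule abs_triangle_ineq)
  also have "\<dots> \<le> L2_norm (advect v ?e) * L2_norm g + L2_norm (advect ?d h) * L2_norm g"
    by (intro add_mono L2_Cauchy_Schwarz A1(1) A2(1) g)
  also have "\<dots> = (L2_norm (advect v ?e) + L2_norm (advect ?d h)) * L2_norm g" by (simp add: distrib_right)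
  also have "\<dots> \<le> (B * (L2_norm (D1 ?e) + L2_norm (D2 ?e)) + 2 * B * L2_norm ?d) * L2_norm g"
    by (intro mult_right_mono add_mono A1(2) A2(2)) simp
  finally show ?thesis .
qed

lemma curl_measurable: "f \<in> sobolev 1 \<Longrightarrow> curl f \<in> borel_measurable torus"
  unfolding curl_def
  by (intro borel_measurable_diff component_measurable sobolev_1_derivs(2,3)[THEN L2D(1)])

lemma curl_le: "\<bar>curl f x\<bar> \<le> norm (D1 f x) + norm (D2 f x)"
  using component_le_norm_cart[of "D1 f x" 2] component_le_norm_cart[of "D2 f x" 1] by (simp add: curl_def)

text \<open>The heating term of the temperature equation without its constant factor
  \<open>\<alpha> * \<eta>\<close>.\<close>

definition source :: "(real \<Rightarrow> real) \<Rightarrow> (real^2 \<Rightarrow> real^2) \<Rightarrow> real^2 \<Rightarrow> real" where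
  "source z f x = z \<bar>curl f x\<bar> * \<bar>curl f x\<bar>"

text \<open>With \<open>s\<close> and \<open>t\<close> the absolute curls of \<open>f\<close> and
  \<open>h\<close>, \<open>z s * s - z t * t\<close> equals
  \<open>z s * (s - t) + (z s - z t) * t\<close>. The bound \<open>M\<close> controls the first
  term; the Lipschitz constant controls the second, where \<open>t\<close> is at most
  \<open>2 * B\<close>.\<close>

lemma source_difference:
  assumes z: "\<And>s. \<bar>z s\<bar> \<le> M" "L-lipschitz_on UNIV z"
    and f: "f \<in> sobolev 1" and h: "h \<in> sobolev 1" "AE x in torus. norm (D1 h x) \<le> B" "AE x in torus. norm (D2 h x) \<le> B"
    and B0: "0 \<le> B" and g: "g \<in> L2"
  shows "source z f \<in> L2" "source z h \<in> L2"
    "\<bar>L2_inner (source z f) g - L2_inner (source z h) g\<bar>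
     \<le> (M + L * (2 * B)) * (L2_norm (D1 (\<lambda>x. f x - h x)) + L2_norm (D2 (\<lambda>x. f x - h x))) * L2_norm g"
proof -
  have M: "0 \<le> M" using z(1)[of 0] by simp
  have L: "0 \<le> L" using z(2) lipschitz_on_nonneg by blast
  have zc: "z \<in> borel_measurable borel" using z(2) lipschitz_on_continuous_on by (intro borel_measurable_continuous_onI) blast
  have sm: "source z f \<in> borel_measurable torus" if "f \<in> sobolev 1" for f
  proof -
    have m: "(\<lambda>x. \<bar>curl f x\<bar>) \<in> borel_measurable torus" using curl_measurable[OF that] by simp
    then show ?thesis unfolding source_def[abs_def] by (intro borel_measurable_times measurable_compose[OF m zc])
  qed
  have nL: "(\<lambda>x. norm (D1 f x) + norm (D2 f x)) \<in> L2" "L2_norm (\<lambda>x. norm (D1 f x) + norm (D2 f x)) \<le> L2_norm (D1 f) + L2_norm (D2 f)"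
    if "f \<in> sobolev 1" for f :: "real^2 \<Rightarrow> real^2"
  proof -
    have n: "(\<lambda>x. norm (D1 f x)) \<in> L2" "(\<lambda>x. norm (D2 f x)) \<in> L2" using sobolev_1_derivs[OF that] by (auto simp: L2_def)
    show "(\<lambda>x. norm (D1 f x) + norm (D2 f x)) \<in> L2" using n by auto
    show "L2_norm (\<lambda>x. norm (D1 f x) + norm (D2 f x)) \<le> L2_norm (D1 f) + L2_norm (D2 f)"
      using L2_norm_triangle[OF n] by (simp add: L2_norm_def)
  qed
  have sL: "source z f \<in> L2" if f: "f \<in> sobolev 1" for f
  proof (rule L2_norm_mono(1)[OF _ sm[OF f] L2_scaleR[OF nL(1)[OF f], of M]])
    show "AE x in torus. norm (source z f x) \<le> norm (M *\<^sub>R (norm (D1 f x) + norm (D2 f x)))"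
    proof (rule AE_I2)
      fix x
      have "\<bar>z \<bar>curl f x\<bar>\<bar> * \<bar>curl f x\<bar> \<le> M * (norm (D1 f x) + norm (D2 f x))" using M by (intro mult_mono z curl_le) auto
      then show "norm (source z f x) \<le> norm (M *\<^sub>R (norm (D1 f x) + norm (D2 f x)))"
        using M by (simp add: source_def abs_mult)
    qed
  qed
  show "source z f \<in> L2" "source z h \<in> L2" by (intro sL f h)+
  let ?e = "\<lambda>x. f x - h x"
  have e: "?e \<in> sobolev 1" by (rule sobolev_diff[OF f h(1)])
  have B: "AE x in torus. \<bar>curl h x\<bar> \<le> 2 * B"
    using h(2,3)
  proof eventually_elim
    case (elim x)
    then show ?case using curl_le[of h x] by simp
  qed
  have "AE x in torus. norm (source z f x - source z h x) \<le> norm ((M + L * (2 * B)) *\<^sub>R (norm (D1 ?e x) + norm (D2 ?e x)))"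
    using B D_diff[OF f h(1)]
  proof eventually_elim
    case (elim x)
    define s t where "s = \<bar>curl f x\<bar>" and "t = \<bar>curl h x\<bar>"
    have B0: "0 \<le> M + L * (2 * B)" using B0 M L by simp
    have "\<bar>s - t\<bar> \<le> \<bar>curl f x - curl h x\<bar>" by (simp add: s_def t_def abs_triangle_ineq3)
    also have "curl f x - curl h x = curl ?e x" unfolding curl_def elim by simp
    also have "\<bar>curl ?e x\<bar> \<le> norm (D1 ?e x) + norm (D2 ?e x)" by (rule curl_le)
    finally have st: "\<bar>s - t\<bar> \<le> norm (D1 ?e x) + norm (D2 ?e x)" .
    have "z s * s - z t * t = z s * (s - t) + (z s - z t) * t" by (simp add: algebra_simps)
    then have "\<bar>z s * s - z t * t\<bar> \<le> \<bar>z s\<bar> * \<bar>s - t\<bar> + \<bar>z s - z t\<bar> * \<bar>t\<bar>" by (metis abs_mult abs_triangle_ineq)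
    also have "\<dots> \<le> M * \<bar>s - t\<bar> + (L * \<bar>s - t\<bar>) * (2 * B)"
      using lipschitz_onD[OF z(2), of s t] elim(1) L M by (intro add_mono mult_mono z) (auto simp: dist_real_def t_def)
    also have "\<dots> = (M + L * (2 * B)) * \<bar>s - t\<bar>" by (simp add: algebra_simps)
    also have "\<dots> \<le> (M + L * (2 * B)) * (norm (D1 ?e x) + norm (D2 ?e x))" by (intro mult_left_mono st B0)
    finally show ?case using B0 by (simp add: source_def s_def t_def abs_mult)
  qed
  from L2_norm_mono(2)[OF this _ L2_scaleR[OF nL(1)[OF e]]] have d: "L2_norm (\<lambda>x. source z f x - source z h x) \<le> \<bar>M + L * (2 * B)\<bar> * L2_norm (\<lambda>x. norm (D1 ?e x) + norm (D2 ?e x))"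
    using sm[OF f] sm[OF h(1)] by (simp add: L2_norm_scaleR flip: real_scaleR_def)
  have "0 \<le> M + L * (2 * B)" using M L B0 by simp
  then have d': "L2_norm (\<lambda>x. source z f x - source z h x) \<le> (M + L * (2 * B)) * (L2_norm (D1 ?e) + L2_norm (D2 ?e))"
    using d mult_left_mono[OF nL(2)[OF e]] by (fastforce simp: abs_of_nonneg)
  have "L2_inner (source z f) g - L2_inner (source z h) g = L2_inner (\<lambda>x. source z f x - source z h x) g"
    using sL f h g by (simp add: L2_inner_diff_left)
  also have "\<bar>\<dots>\<bar> \<le> L2_norm (\<lambda>x. source z f x - source z h x) * L2_norm g"
    using sL f h g by (intro L2_Cauchy_Schwarz) auto
  also have "\<dots> \<le> (M + L * (2 * B)) * (L2_norm (D1 ?e) + L2_norm (D2 ?e)) * L2_norm g"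
    by (intro mult_right_mono d') simp
  finally show "\<bar>L2_inner (source z f) g - L2_inner (source z h) g\<bar> \<le> (M + L * (2 * B)) * (L2_norm (D1 ?e) + L2_norm (D2 ?e)) * L2_norm g" .
qed

section \<open>The energy inequality at a fixed time\<close>

lemma gradient_inner_diff:
  assumes f: "f \<in> sobolev 1" and h: "h \<in> sobolev 1"
  shows "L2_inner (D1 f) (D1 (\<lambda>x. f x - h x)) + L2_inner (D2 f) (D2 (\<lambda>x. f x - h x))
     - (L2_inner (D1 h) (D1 (\<lambda>x. f x - h x)) + L2_inner (D2 h) (D2 (\<lambda>x. f x - h x)))
     = (L2_norm (D1 (\<lambda>x. f x - h x)))\<^sup>2 + (L2_norm (D2 (\<lambda>x. f x - h x)))\<^sup>2"
proof -
  let ?e = "\<lambda>x. f x - h x"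
  note e = sobolev_1_derivs[OF sobolev_diff[OF f h]] and L = sobolev_1_derivs[OF f] sobolev_1_derivs[OF h]
  have "L2_inner (D1 ?e) (D1 ?e) = L2_inner (\<lambda>x. D1 f x - D1 h x) (D1 ?e)"
    "L2_inner (D2 ?e) (D2 ?e) = L2_inner (\<lambda>x. D2 f x - D2 h x) (D2 ?e)"
    using D_diff[OF f h] e L by (auto intro!: L2_inner_cong_AE L2D L2_diff)
  then show ?thesis using e L by (simp add: L2_norm_power2 L2_inner_diff_left)
qed

lemma gradient_square: "((p::real) + q)\<^sup>2 \<le> 2 * (p\<^sup>2 + q\<^sup>2)"
  using sum_squares_bound[of p q] by (simp add: power2_sum)

text \<open>Young's inequality with the weight chosen so that the gradient is absorbed by dissipation.\<close>

lemma Young_absorb: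
  fixes p x s \<nu> :: real
  assumes "0 < \<nu>" shows "s * p * x \<le> \<nu>/8 * p\<^sup>2 + 2/\<nu> * (s\<^sup>2 * x\<^sup>2)"
proof -
  have "0 \<le> \<nu>/8 * (p - 4/\<nu> * (s * x))\<^sup>2" using assms by simp
  also have "\<nu>/8 * (p - 4/\<nu> * (s * x))\<^sup>2 = \<nu>/8 * p\<^sup>2 + 2/\<nu> * (s\<^sup>2 * x\<^sup>2) - s * p * x"
    using assms by (simp add: power2_eq_square field_simps)
  finally show ?thesis by simp
qed

text \<open>\<open>x\<close>, \<open>y\<close>, \<open>z\<close> are norms of the differences of
  velocity, magnetic field and temperature, \<open>P\<close>, \<open>Q\<close>, \<open>R\<close>
  those of their gradients, \<open>s\<close> the coefficient of the heating term. Each product with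
  a gradient costs one eighth of a dissipation constant: two of them for \<open>P\<close>, three for
  \<open>Q\<close>, one for \<open>R\<close>, all within the available half. The constant collects
  the rest: \<open>2/\<nu>\<close>, \<open>2/\<eta>\<close> or \<open>2/\<kappa>\<close> per
  absorbed term, with the extra factor \<open>S\<close> for heating, \<open>5\<close> for the
  products without a gradient and \<open>g\<close> for buoyancy.\<close>

lemma dissipation_estimate:
  fixes x y z P Q R B s :: real
  assumes pos: "0 < \<nu>" "0 < \<eta>" "0 < \<kappa>" "0 < g" and nn: "0 \<le> x" "0 \<le> y" "0 \<le> z" "0 \<le> B"
    and s: "s\<^sup>2 \<le> S * (1 + B\<^sup>2)"
  shows "(- \<nu>/2 * P\<^sup>2 + (B * P + 2 * B * x) * x + (B * Q + 2 * B * y) * x + g * z * x)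
     + (- \<eta>/2 * Q\<^sup>2 + (B * Q + 2 * B * x) * y + (B * P + 2 * B * y) * y)
     + (- \<kappa>/2 * R\<^sup>2 + (B * R + 2 * B * x) * z + s * Q * z)
    \<le> (4/\<nu> + 4/\<eta> + 2/\<kappa> + 2/\<eta> * S + g + 5) * (1 + B\<^sup>2) * (x\<^sup>2 + y\<^sup>2 + z\<^sup>2)"
proof -
  define Y where "Y = x\<^sup>2 + y\<^sup>2 + z\<^sup>2"
  define W where "W = 1 + B\<^sup>2"
  \<comment> \<open>One factor \<open>W\<close> thus dominates terms linear and quadratic in
    \<open>B\<close> alike.\<close>
  have W1: "1 \<le> W" "B\<^sup>2 \<le> W" "2 * B \<le> W" using sum_squares_bound[of B 1] by (auto simp: W_def)
  have Y: "x\<^sup>2 \<le> Y" "y\<^sup>2 \<le> Y" "z\<^sup>2 \<le> Y" "0 \<le> Y" by (auto simp: Y_def)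
  have sq: "2/m * (B\<^sup>2 * a\<^sup>2) \<le> 2/m * (W * Y)" if "0 < m" "a\<^sup>2 \<le> Y" for m a :: real
    using that W1 Y by (intro mult_left_mono mult_mono) auto
  have b: "2 * B * (a * c) \<le> W * Y" if "0 \<le> a" "0 \<le> c" "a\<^sup>2 \<le> Y" "c\<^sup>2 \<le> Y" for a c :: real
  proof -
    have "a * c \<le> Y" using sum_squares_bound[of a c] that by simp
    then show ?thesis using W1 nn that by (intro mult_mono) auto
  qed
  have s2: "2/\<eta> * (s\<^sup>2 * z\<^sup>2) \<le> 2/\<eta> * (S * W * Y)"
    using s pos Y W1 zero_le_power2[of s] order_trans[OF zero_le_power2 s] unfolding W_def[symmetric] by (intro mult_left_mono mult_mono) auto
  have gz: "g * (z * x) \<le> g * (W * Y)"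
  proof -
    have "z * x \<le> Y" using sum_squares_bound[of z x] Y by simp
    also have "Y \<le> W * Y" using W1 Y mult_right_mono[of 1 W Y] by simp
    finally show ?thesis using pos by (intro mult_left_mono) auto
  qed
  have "(- \<nu>/2 * P\<^sup>2 + (B * P + 2 * B * x) * x + (B * Q + 2 * B * y) * x + g * z * x)
     + (- \<eta>/2 * Q\<^sup>2 + (B * Q + 2 * B * x) * y + (B * P + 2 * B * y) * y)
     + (- \<kappa>/2 * R\<^sup>2 + (B * R + 2 * B * x) * z + s * Q * z)
    = (- \<nu>/2 * P\<^sup>2 - \<eta>/2 * Q\<^sup>2 - \<kappa>/2 * R\<^sup>2)
      + (B * P * x + B * P * y + B * Q * x + B * Q * y + B * R * z + s * Q * z)
      + (2 * B * (x * x) + 2 * B * (y * x) + 2 * B * (x * y) + 2 * B * (y * y) + 2 * B * (x * z)) + g * (z * x)"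
    by (simp add: algebra_simps)
  also have "\<dots> \<le> (- \<nu>/2 * P\<^sup>2 - \<eta>/2 * Q\<^sup>2 - \<kappa>/2 * R\<^sup>2)
      + ((\<nu>/8 * P\<^sup>2 + 2/\<nu> * (W * Y)) + (\<nu>/8 * P\<^sup>2 + 2/\<nu> * (W * Y)) + (\<eta>/8 * Q\<^sup>2 + 2/\<eta> * (W * Y)) + (\<eta>/8 * Q\<^sup>2 + 2/\<eta> * (W * Y))
         + (\<kappa>/8 * R\<^sup>2 + 2/\<kappa> * (W * Y)) + (\<eta>/8 * Q\<^sup>2 + 2/\<eta> * (S * W * Y)))
      + (W * Y + W * Y + W * Y + W * Y + W * Y) + g * (W * Y)"
    by (intro add_mono order_refl b gz nn Y order_trans[OF Young_absorb add_left_mono[OF sq]] order_trans[OF Young_absorb add_left_mono[OF s2]] pos)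
  also have "\<dots> \<le> (4/\<nu> + 4/\<eta> + 2/\<kappa> + 2/\<eta> * S + g + 5) * W * Y"
  proof -
    \<comment> \<open>What is left of the dissipation, a quarter for \<open>P\<close>, an eighth for
      \<open>Q\<close> and three eighths for \<open>R\<close>, is dropped.\<close>
    have "0 \<le> \<nu> * P\<^sup>2" "0 \<le> \<eta> * Q\<^sup>2" "0 \<le> \<kappa> * R\<^sup>2" using pos by auto
    then show ?thesis by (simp add: algebra_simps)
  qed
  finally show ?thesis by (simp add: W_def Y_def)
qed

text \<open>Tested with \<open>h\<close>, the Stokes term becomes a product of gradients and the
  projector in front of \<open>F\<close> disappears. The right-hand side \<open>r\<close> is kept
  general because it differs between the two vector equations.\<close>

lemma rate_of_equation:
  assumes w: "w \<in> sobolev 2" and h: "h \<in> H_space" "h \<in> sobolev 1" and L: "w' \<in> L2" "F \<in> L2" "r \<in> L2"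
    and eq: "AE x in torus. w' x + c *\<^sub>R stokes w x + leray F x = r x"
  shows "L2_inner h w' = - c * (L2_inner (D1 w) (D1 h) + L2_inner (D2 w) (D2 h)) - L2_inner F h + L2_inner r h"
proof -
  note st = stokes_inner[OF w h]
  have hL: "h \<in> L2" using h by (auto intro: H_space_L2)
  note lF = leray_L2[OF L(2)]
  have "AE x in torus. w' x = r x - (c *\<^sub>R stokes w x + leray F x)"
    using eq by eventually_elim (simp add: eq_diff_eq add.assoc)
  then have "L2_inner w' h = L2_inner (\<lambda>x. r x - (c *\<^sub>R stokes w x + leray F x)) h"
    using L st(1) lF hL by (intro L2_inner_cong_AE) (auto intro!: L2D L2_add L2_diff L2_scaleR)
  also have "\<dots> = L2_inner r h - (c * L2_inner (stokes w) h + L2_inner (leray F) h)"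
    using L2_inner_diff_left[OF L(3) L2_add[OF L2_scaleR[OF st(1), of c] lF] hL]
      L2_inner_add_left[OF L2_scaleR[OF st(1), of c] lF hL] by (simp only: L2_inner_scaleR_left)
  finally show ?thesis using st(2) leray_props(2)[OF L(2) h(1)] by (simp add: L2_inner_commute[of h] algebra_simps)
qed

text \<open>The three equations are added before anything is absorbed, because the gradient of the
  magnetic difference occurs in all of them and that of the velocity difference in two. The bound
  \<open>B\<close> covers the values of the velocity and magnetic fields of both solutions and the
  gradients of the second one.\<close>

lemma rate_estimate:
  fixes u1 u2 b1 b2 u1' u2' b1' b2' :: "real^2 \<Rightarrow> real^2" and \<theta>1 \<theta>2 :: "real^2 \<Rightarrow> real"
  assumes pos: "0 < \<nu>" "0 < \<eta>" "0 < \<kappa>" "0 < g"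
    and z: "\<And>s. \<bar>z s\<bar> \<le> M" "L-lipschitz_on UNIV z"
    and S: "u1 \<in> sobolev 2 \<inter> V_space" "u2 \<in> sobolev 2 \<inter> V_space" "b1 \<in> sobolev 2 \<inter> V_space" "b2 \<in> sobolev 2 \<inter> V_space"
      "\<theta>1 \<in> sobolev 1" "\<theta>2 \<in> sobolev 1"
    and B: "0 \<le> B" "AE x in torus. norm (u1 x) \<le> B" "AE x in torus. norm (u2 x) \<le> B"
      "AE x in torus. norm (b1 x) \<le> B" "AE x in torus. norm (b2 x) \<le> B"
      "AE x in torus. norm (D1 u2 x) \<le> B" "AE x in torus. norm (D2 u2 x) \<le> B"
      "AE x in torus. norm (D1 b2 x) \<le> B" "AE x in torus. norm (D2 b2 x) \<le> B"
      "AE x in torus. norm (D1 \<theta>2 x) \<le> B" "AE x in torus. norm (D2 \<theta>2 x) \<le> B"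
    and L': "u1' \<in> L2" "u2' \<in> L2" "b1' \<in> L2" "b2' \<in> L2"
    and u1: "AE x in torus. u1' x + \<nu> *\<^sub>R stokes u1 x + leray (advect u1 u1) x = leray (advect b1 b1) x + g *\<^sub>R leray (\<lambda>y. \<theta>1 y *\<^sub>R axis 2 1) x"
    and u2: "AE x in torus. u2' x + \<nu> *\<^sub>R stokes u2 x + leray (advect u2 u2) x = leray (advect b2 b2) x + g *\<^sub>R leray (\<lambda>y. \<theta>2 y *\<^sub>R axis 2 1) x"
    and b1: "AE x in torus. b1' x + \<eta> *\<^sub>R stokes b1 x + leray (advect u1 b1) x = leray (advect b1 u1) x"
    and b2: "AE x in torus. b2' x + \<eta> *\<^sub>R stokes b2 x + leray (advect u2 b2) x = leray (advect b2 u2) x"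
    and t1: "\<And>\<psi>. \<psi> \<in> sobolev 1 \<Longrightarrow> \<theta>1' \<psi> - \<kappa> * dual_laplacian \<theta>1 \<psi> + L2_inner (advect u1 \<theta>1) \<psi> = \<alpha> * \<eta> * L2_inner (source z b1) \<psi>"
    and t2: "\<And>\<psi>. \<psi> \<in> sobolev 1 \<Longrightarrow> \<theta>2' \<psi> - \<kappa> * dual_laplacian \<theta>2 \<psi> + L2_inner (advect u2 \<theta>2) \<psi> = \<alpha> * \<eta> * L2_inner (source z b2) \<psi>"
  shows "L2_inner (\<lambda>x. u1 x - u2 x) (\<lambda>x. u1' x - u2' x) + L2_inner (\<lambda>x. b1 x - b2 x) (\<lambda>x. b1' x - b2' x)
      + (\<theta>1' (\<lambda>x. \<theta>1 x - \<theta>2 x) - \<theta>2' (\<lambda>x. \<theta>1 x - \<theta>2 x))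
    \<le> (4/\<nu> + 4/\<eta> + 2/\<kappa> + 2/\<eta> * ((\<alpha> * \<eta>)\<^sup>2 * (2 * M\<^sup>2 + 8 * L\<^sup>2)) + g + 5) * (1 + B\<^sup>2)
      * ((L2_norm (\<lambda>x. u1 x - u2 x))\<^sup>2 + (L2_norm (\<lambda>x. b1 x - b2 x))\<^sup>2 + (L2_norm (\<lambda>x. \<theta>1 x - \<theta>2 x))\<^sup>2)"
proof -
  let ?u = "\<lambda>x. u1 x - u2 x" and ?b = "\<lambda>x. b1 x - b2 x" and ?t = "\<lambda>x. \<theta>1 x - \<theta>2 x"
  have S1: "u1 \<in> sobolev 1" "u2 \<in> sobolev 1" "b1 \<in> sobolev 1" "b2 \<in> sobolev 1" using S V_space_sobolev by blast+
  have H: "u1 \<in> H_space" "u2 \<in> H_space" "b1 \<in> H_space" "b2 \<in> H_space" using S V_space_H_space by blast+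
  have L: "u1 \<in> L2" "u2 \<in> L2" "b1 \<in> L2" "b2 \<in> L2" "\<theta>1 \<in> L2" "\<theta>2 \<in> L2" using S S1 sobolev_L2 by blast+
  have D: "?u \<in> sobolev 1" "?b \<in> sobolev 1" "?t \<in> sobolev 1" "?u \<in> H_space" "?b \<in> H_space"
    by (intro sobolev_diff H_space_diff S1 S H)+
  have DL: "?u \<in> L2" "?b \<in> L2" "?t \<in> L2" using L by auto
  define x y w where "x = L2_norm ?u" and "y = L2_norm ?b" and "w = L2_norm ?t"
  define P Q R where "P = L2_norm (D1 ?u) + L2_norm (D2 ?u)" and "Q = L2_norm (D1 ?b) + L2_norm (D2 ?b)" and "R = L2_norm (D1 ?t) + L2_norm (D2 ?t)"
  note bv = advect_bounded_velocity(1)[OF L2D(1) _ _ B(1)]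
  have A: "advect u1 u1 \<in> L2" "advect u2 u2 \<in> L2" "advect b1 b1 \<in> L2" "advect b2 b2 \<in> L2"
    "advect u1 b1 \<in> L2" "advect u2 b2 \<in> L2" "advect b1 u1 \<in> L2" "advect b2 u2 \<in> L2"
    by (rule bv; fact L B S1)+
  have tL: "(\<lambda>y. \<theta> y *\<^sub>R axis 2 1 :: real^2) \<in> L2" if "\<theta> \<in> L2" for \<theta> :: "real^2 \<Rightarrow> real"
    using that by (auto simp: L2_def)
  have rL: "(\<lambda>x. leray (advect b1 b1) x + g *\<^sub>R leray (\<lambda>y. \<theta>1 y *\<^sub>R axis 2 1) x) \<in> L2"
    "(\<lambda>x. leray (advect b2 b2) x + g *\<^sub>R leray (\<lambda>y. \<theta>2 y *\<^sub>R axis 2 1) x) \<in> L2"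
    by (intro L2_add L2_scaleR leray_L2 tL A L)+
  have force: "L2_inner (\<lambda>x. leray F x + g *\<^sub>R leray (\<lambda>y. \<theta> y *\<^sub>R axis 2 1) x) ?u = L2_inner F ?u + g * L2_inner (\<lambda>y. \<theta> y *\<^sub>R axis 2 1) ?u"
    if "F \<in> L2" "\<theta> \<in> L2" for F and \<theta> :: "real^2 \<Rightarrow> real"
    using L2_inner_add_left[OF leray_L2[OF that(1)] L2_scaleR[OF leray_L2[OF tL[OF that(2)]], of g] DL(1)]
    by (simp only: L2_inner_scaleR_left leray_props(2)[OF that(1) D(4)] leray_props(2)[OF tL[OF that(2)] D(4)])
  have S2: "u1 \<in> sobolev 2" "u2 \<in> sobolev 2" "b1 \<in> sobolev 2" "b2 \<in> sobolev 2" using S by auto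
  \<comment> \<open>The transport estimates deliver the sum of the two norms; in terms of its square
    only half of the dissipation is available.\<close>
  have gr: "(L2_norm (D1 e))\<^sup>2 + (L2_norm (D2 e))\<^sup>2 \<ge> (L2_norm (D1 e) + L2_norm (D2 e))\<^sup>2 / 2" for e :: "real^2 \<Rightarrow> 'a::euclidean_space"
    using gradient_square[of "L2_norm (D1 e)" "L2_norm (D2 e)"] by simp
  have vel: "L2_inner ?u (\<lambda>x. u1' x - u2' x) \<le> - \<nu>/2 * P\<^sup>2 + (B * P + 2 * B * x) * x + (B * Q + 2 * B * y) * x + g * w * x"
  proof -
    have e1: "L2_inner ?u u1' = - \<nu> * (L2_inner (D1 u1) (D1 ?u) + L2_inner (D2 u1) (D2 ?u)) - L2_inner (advect u1 u1) ?u
        + (L2_inner (advect b1 b1) ?u + g * L2_inner (\<lambda>y. \<theta>1 y *\<^sub>R axis 2 1) ?u)"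
      unfolding force[OF A(3) L(5), symmetric] by (rule rate_of_equation[OF S2(1) D(4,1) L'(1) A(1) rL(1) u1])
    have e2: "L2_inner ?u u2' = - \<nu> * (L2_inner (D1 u2) (D1 ?u) + L2_inner (D2 u2) (D2 ?u)) - L2_inner (advect u2 u2) ?u
        + (L2_inner (advect b2 b2) ?u + g * L2_inner (\<lambda>y. \<theta>2 y *\<^sub>R axis 2 1) ?u)"
      unfolding force[OF A(4) L(6), symmetric] by (rule rate_of_equation[OF S2(2) D(4,1) L'(2) A(2) rL(2) u2])
    have th: "L2_inner (\<lambda>y. \<theta>1 y *\<^sub>R axis 2 1) ?u - L2_inner (\<lambda>y. \<theta>2 y *\<^sub>R axis 2 1) ?u \<le> w * x"
    proof -
      have "L2_inner (\<lambda>y. \<theta>1 y *\<^sub>R axis 2 1) ?u - L2_inner (\<lambda>y. \<theta>2 y *\<^sub>R axis 2 1) ?u = L2_inner (\<lambda>y. ?t y *\<^sub>R axis 2 1) ?u"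
        using L2_inner_diff_left[OF tL[OF L(5)] tL[OF L(6)] DL(1)] by (simp add: scaleR_diff_left)
      also have "\<dots> \<le> L2_norm (\<lambda>y. ?t y *\<^sub>R axis 2 1 :: real^2) * x"
        using L2_Cauchy_Schwarz[OF tL[OF DL(3)] DL(1)] by (simp add: x_def)
      also have "L2_norm (\<lambda>y. ?t y *\<^sub>R axis 2 1 :: real^2) = w" by (simp add: w_def L2_norm_def)
      finally show ?thesis .
    qed
    have "L2_inner ?u (\<lambda>x. u1' x - u2' x) = - \<nu> * ((L2_norm (D1 ?u))\<^sup>2 + (L2_norm (D2 ?u))\<^sup>2)
        - (L2_inner (advect u1 u1) ?u - L2_inner (advect u2 u2) ?u) + (L2_inner (advect b1 b1) ?u - L2_inner (advect b2 b2) ?u)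
        + g * (L2_inner (\<lambda>y. \<theta>1 y *\<^sub>R axis 2 1) ?u - L2_inner (\<lambda>y. \<theta>2 y *\<^sub>R axis 2 1) ?u)"
      unfolding L2_inner_diff_right[OF L'(1,2) DL(1)] e1 e2 gradient_inner_diff[OF S1(1,2), symmetric] by (simp add: algebra_simps)
    also have "\<dots> \<le> - \<nu> * (P\<^sup>2 / 2) + (B * P + 2 * B * x) * x + (B * Q + 2 * B * y) * x + g * (w * x)"
    proof (intro add_mono)
      have "\<nu> * (P\<^sup>2 / 2) \<le> \<nu> * ((L2_norm (D1 ?u))\<^sup>2 + (L2_norm (D2 ?u))\<^sup>2)"
        using gr[of ?u] pos by (intro mult_left_mono) (auto simp: P_def)
      moreover have "\<bar>L2_inner (advect u1 u1) ?u - L2_inner (advect u2 u2) ?u\<bar> \<le> (B * P + 2 * B * x) * x"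
        unfolding P_def x_def by (rule advect_difference[OF L(1) B(2) L(2) B(3) S1(1,2) B(6,7,1) DL(1)])
      ultimately show "- \<nu> * ((L2_norm (D1 ?u))\<^sup>2 + (L2_norm (D2 ?u))\<^sup>2) - (L2_inner (advect u1 u1) ?u - L2_inner (advect u2 u2) ?u) \<le> - \<nu> * (P\<^sup>2 / 2) + (B * P + 2 * B * x) * x"
        unfolding mult_minus_left by linarith
      have "\<bar>L2_inner (advect b1 b1) ?u - L2_inner (advect b2 b2) ?u\<bar> \<le> (B * Q + 2 * B * y) * x"
        unfolding Q_def x_def y_def by (rule advect_difference[OF L(3) B(4) L(4) B(5) S1(3,4) B(8,9,1) DL(1)])
      then show "L2_inner (advect b1 b1) ?u - L2_inner (advect b2 b2) ?u \<le> (B * Q + 2 * B * y) * x" by linarith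
      show "g * (L2_inner (\<lambda>y. \<theta>1 y *\<^sub>R axis 2 1) ?u - L2_inner (\<lambda>y. \<theta>2 y *\<^sub>R axis 2 1) ?u) \<le> g * (w * x)"
        using th pos by (intro mult_left_mono) auto
    qed
    finally show ?thesis by (simp add: mult.assoc)
  qed
  have mag: "L2_inner ?b (\<lambda>x. b1' x - b2' x) \<le> - \<eta>/2 * Q\<^sup>2 + (B * Q + 2 * B * x) * y + (B * P + 2 * B * y) * y"
  proof -
    have e1: "L2_inner ?b b1' = - \<eta> * (L2_inner (D1 b1) (D1 ?b) + L2_inner (D2 b1) (D2 ?b)) - L2_inner (advect u1 b1) ?b + L2_inner (advect b1 u1) ?b"
      using rate_of_equation[OF S2(3) D(5,2) L'(3) A(5) leray_L2[OF A(7)] b1] leray_props(2)[OF A(7) D(5)] by simp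
    have e2: "L2_inner ?b b2' = - \<eta> * (L2_inner (D1 b2) (D1 ?b) + L2_inner (D2 b2) (D2 ?b)) - L2_inner (advect u2 b2) ?b + L2_inner (advect b2 u2) ?b"
      using rate_of_equation[OF S2(4) D(5,2) L'(4) A(6) leray_L2[OF A(8)] b2] leray_props(2)[OF A(8) D(5)] by simp
    have "L2_inner ?b (\<lambda>x. b1' x - b2' x) = - \<eta> * ((L2_norm (D1 ?b))\<^sup>2 + (L2_norm (D2 ?b))\<^sup>2)
        - (L2_inner (advect u1 b1) ?b - L2_inner (advect u2 b2) ?b) + (L2_inner (advect b1 u1) ?b - L2_inner (advect b2 u2) ?b)"
      unfolding L2_inner_diff_right[OF L'(3,4) DL(2)] e1 e2 gradient_inner_diff[OF S1(3,4), symmetric] by (simp add: algebra_simps)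
    also have "\<dots> \<le> - \<eta> * (Q\<^sup>2 / 2) + (B * Q + 2 * B * x) * y + (B * P + 2 * B * y) * y"
    proof (intro add_mono)
      have "\<eta> * (Q\<^sup>2 / 2) \<le> \<eta> * ((L2_norm (D1 ?b))\<^sup>2 + (L2_norm (D2 ?b))\<^sup>2)"
        using gr[of ?b] pos by (intro mult_left_mono) (auto simp: Q_def)
      moreover have "\<bar>L2_inner (advect u1 b1) ?b - L2_inner (advect u2 b2) ?b\<bar> \<le> (B * Q + 2 * B * x) * y"
        unfolding Q_def x_def y_def by (rule advect_difference[OF L(1) B(2) L(2) B(3) S1(3,4) B(8,9,1) DL(2)])
      ultimately show "- \<eta> * ((L2_norm (D1 ?b))\<^sup>2 + (L2_norm (D2 ?b))\<^sup>2) - (L2_inner (advect u1 b1) ?b - L2_inner (advect u2 b2) ?b) \<le> - \<eta> * (Q\<^sup>2 / 2) + (B * Q + 2 * B * x) * y"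
        unfolding mult_minus_left by linarith
      have "\<bar>L2_inner (advect b1 u1) ?b - L2_inner (advect b2 u2) ?b\<bar> \<le> (B * P + 2 * B * y) * y"
        unfolding P_def y_def by (rule advect_difference[OF L(3) B(4) L(4) B(5) S1(1,2) B(6,7,1) DL(2)])
      then show "L2_inner (advect b1 u1) ?b - L2_inner (advect b2 u2) ?b \<le> (B * P + 2 * B * y) * y" by linarith
    qed
    finally show ?thesis by (simp add: mult.assoc)
  qed
  have temp: "\<theta>1' ?t - \<theta>2' ?t \<le> - \<kappa>/2 * R\<^sup>2 + (B * R + 2 * B * x) * w + \<bar>\<alpha> * \<eta>\<bar> * (M + L * (2 * B)) * Q * w"
  proof -
    have src: "\<bar>L2_inner (source z b1) ?t - L2_inner (source z b2) ?t\<bar> \<le> (M + L * (2 * B)) * Q * w"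
      unfolding Q_def w_def by (rule source_difference(3)[OF z S1(3,4) B(8,9,1) DL(3)])
    have "\<theta>1' ?t - \<theta>2' ?t = - \<kappa> * ((L2_norm (D1 ?t))\<^sup>2 + (L2_norm (D2 ?t))\<^sup>2) - (L2_inner (advect u1 \<theta>1) ?t - L2_inner (advect u2 \<theta>2) ?t)
        + \<alpha> * \<eta> * (L2_inner (source z b1) ?t - L2_inner (source z b2) ?t)"
      using t1[OF D(3)] t2[OF D(3)] unfolding gradient_inner_diff[OF S(5,6), symmetric] dual_laplacian_def by (simp add: algebra_simps)
    also have "\<dots> \<le> - \<kappa> * (R\<^sup>2 / 2) + (B * R + 2 * B * x) * w + \<bar>\<alpha> * \<eta>\<bar> * ((M + L * (2 * B)) * Q * w)"
    proof (rule add_mono)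
      have "\<kappa> * (R\<^sup>2 / 2) \<le> \<kappa> * ((L2_norm (D1 ?t))\<^sup>2 + (L2_norm (D2 ?t))\<^sup>2)"
        using gr[of ?t] pos by (intro mult_left_mono) (auto simp: R_def)
      moreover have "\<bar>L2_inner (advect u1 \<theta>1) ?t - L2_inner (advect u2 \<theta>2) ?t\<bar> \<le> (B * R + 2 * B * x) * w"
        unfolding R_def x_def w_def by (rule advect_difference[OF L(1) B(2) L(2) B(3) S(5,6) B(10,11,1) DL(3)])
      ultimately show "- \<kappa> * ((L2_norm (D1 ?t))\<^sup>2 + (L2_norm (D2 ?t))\<^sup>2) - (L2_inner (advect u1 \<theta>1) ?t - L2_inner (advect u2 \<theta>2) ?t) \<le> - \<kappa> * (R\<^sup>2 / 2) + (B * R + 2 * B * x) * w"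
        unfolding mult_minus_left by linarith
      have "\<alpha> * \<eta> * (L2_inner (source z b1) ?t - L2_inner (source z b2) ?t) \<le> \<bar>\<alpha> * \<eta>\<bar> * \<bar>L2_inner (source z b1) ?t - L2_inner (source z b2) ?t\<bar>"
        using abs_ge_self[of "\<alpha> * \<eta> * (L2_inner (source z b1) ?t - L2_inner (source z b2) ?t)"] by (simp only: abs_mult)
      also have "\<dots> \<le> \<bar>\<alpha> * \<eta>\<bar> * ((M + L * (2 * B)) * Q * w)" by (intro mult_left_mono src) simp
      finally show "\<alpha> * \<eta> * (L2_inner (source z b1) ?t - L2_inner (source z b2) ?t) \<le> \<bar>\<alpha> * \<eta>\<bar> * ((M + L * (2 * B)) * Q * w)" .
    qed
    finally show ?thesis by (simp add: mult.assoc)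
  qed
  \<comment> \<open>Supplies the constant \<open>S\<close> of \<open>dissipation_estimate\<close>:
    the square of a sum is at most twice the sum of squares, and twice
    \<open>(2 * L * B)\<^sup>2\<close> gives the \<open>8\<close>.\<close>
  have s: "(\<bar>\<alpha> * \<eta>\<bar> * (M + L * (2 * B)))\<^sup>2 \<le> (\<alpha> * \<eta>)\<^sup>2 * (2 * M\<^sup>2 + 8 * L\<^sup>2) * (1 + B\<^sup>2)"
  proof -
    have "(M + L * (2 * B))\<^sup>2 \<le> 2 * M\<^sup>2 + 8 * (L\<^sup>2 * B\<^sup>2)"
      using gradient_square[of M "L * (2 * B)"] by (simp add: power_mult_distrib)
    also have "\<dots> \<le> 2 * M\<^sup>2 + 8 * (L\<^sup>2 * B\<^sup>2) + (2 * (M\<^sup>2 * B\<^sup>2) + 8 * L\<^sup>2)" by simp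
    also have "\<dots> = (2 * M\<^sup>2 + 8 * L\<^sup>2) * (1 + B\<^sup>2)" by (simp add: algebra_simps)
    finally have "(\<alpha> * \<eta>)\<^sup>2 * (M + L * (2 * B))\<^sup>2 \<le> (\<alpha> * \<eta>)\<^sup>2 * ((2 * M\<^sup>2 + 8 * L\<^sup>2) * (1 + B\<^sup>2))"
      by (intro mult_left_mono) auto
    then show ?thesis by (simp only: power_mult_distrib[of "\<bar>\<alpha> * \<eta>\<bar>"] power2_abs mult.assoc)
  qed
  have nn: "0 \<le> x" "0 \<le> y" "0 \<le> w" by (simp_all add: x_def y_def w_def)
  from dissipation_estimate[OF pos nn B(1) s, of P Q R] vel mag temp
  show ?thesis unfolding x_def[symmetric] y_def[symmetric] w_def[symmetric] by linarith
qed

section \<open>Uniqueness\<close>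

text \<open>\<open>600\<close> is \<open>300\<close> times the largest dimension of the values, so
  that one bound fits the vector fields and the temperature.\<close>

lemma sobolev_3_bounds:
  fixes f :: "real^2 \<Rightarrow> 'a::euclidean_space"
  assumes f: "f \<in> sobolev 3" "sobolev_norm 3 f \<le> S" and dim: "DIM('a) \<le> 2"
  shows "AE x in torus. norm (f x) \<le> sqrt 600 * S" "AE x in torus. norm (D1 f x) \<le> sqrt 600 * S" "AE x in torus. norm (D2 f x) \<le> sqrt 600 * S"
proof -
  have "sqrt (300 * DIM('a)) * sobolev_norm 3 f \<le> sqrt 600 * S"
    using dim f(2) by (intro mult_mono) auto
  then have *: "AE x in torus. norm (h x) \<le> sqrt 600 * S"
    if "AE x in torus. norm (h x) \<le> sqrt (300 * DIM('a)) * sobolev_norm 3 f" for h :: "real^2 \<Rightarrow> 'a"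
    using that by (auto elim!: eventually_mono)
  show "AE x in torus. norm (f x) \<le> sqrt 600 * S" by (rule *[OF sobolev_bounded[OF f(1)]])
  show "AE x in torus. norm (D1 f x) \<le> sqrt 600 * S" "AE x in torus. norm (D2 f x) \<le> sqrt 600 * S"
    by (rule *, rule weak_deriv_bounded[OF f(1)], simp)+
qed

lemma sum_six_squares:
  fixes a b c d e f :: real
  shows "(a + b + c + d + e + f)\<^sup>2 \<le> 6 * (a\<^sup>2 + b\<^sup>2 + c\<^sup>2 + d\<^sup>2 + e\<^sup>2 + f\<^sup>2)"
proof -
  have "(\<Sum>i<6::nat. [a, b, c, d, e, f] ! i)\<^sup>2 \<le> (\<Sum>i<6::nat. (1::real)\<^sup>2) * (\<Sum>i<6::nat. ([a, b, c, d, e, f] ! i)\<^sup>2)"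
    using Cauchy_Schwarz_ineq_sum[of "\<lambda>i. 1" "\<lambda>i. [a, b, c, d, e, f] ! i" "{..<6::nat}"] by simp
  then show ?thesis by (simp add: eval_nat_numeral algebra_simps)
qed

lemma strong_solutionE:
  assumes "strong_solution \<nu> \<eta> \<kappa> g \<alpha> z T u0 b0 \<theta>0 u b \<theta>"
  obtains u' b' \<theta>' where
    "u \<in> C_time T V_space (sobolev_norm 1)" "u \<in> L2_time T (sobolev 2 \<inter> V_space) (sobolev_norm 2)" "u \<in> L2_time T (sobolev 3 \<inter> V_space) (sobolev_norm 3)"
    "b \<in> C_time T V_space (sobolev_norm 1)" "b \<in> L2_time T (sobolev 2 \<inter> V_space) (sobolev_norm 2)" "b \<in> L2_time T (sobolev 3 \<inter> V_space) (sobolev_norm 3)"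
    "\<theta> \<in> C_time T L2 L2_norm" "\<theta> \<in> L2_time T (sobolev 1) (sobolev_norm 1)" "\<theta> \<in> L2_time T (sobolev 3) (sobolev_norm 3)"
    "u' \<in> L2_time T H_space L2_norm" "has_time_deriv T H_space L2_norm u u'"
    "b' \<in> L2_time T H_space L2_norm" "has_time_deriv T H_space L2_norm b b'"
    "\<theta>' \<in> L2_time T H_minus1 H_minus1_norm" "has_time_deriv T H_minus1 H_minus1_norm (\<lambda>t. L2_to_dual (\<theta> t)) \<theta>'"
    "AE t in time_interval T. AE x in torus. u' t x + \<nu> *\<^sub>R stokes (u t) x + leray (advect (u t) (u t)) x
               = leray (advect (b t) (b t)) x + g *\<^sub>R leray (\<lambda>y. \<theta> t y *\<^sub>R axis 2 1) x"
    "AE t in time_interval T. AE x in torus. b' t x + \<eta> *\<^sub>R stokes (b t) x + leray (advect (u t) (b t)) x = leray (advect (b t) (u t)) x"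
    "AE t in time_interval T. \<forall>\<psi>\<in>sobolev 1. \<theta>' t \<psi> - \<kappa> * dual_laplacian (\<theta> t) \<psi> + L2_inner (advect (u t) (\<theta> t)) \<psi>
               = \<alpha> * \<eta> * L2_inner (source z (b t)) \<psi>"
    "AE x in torus. u 0 x = u0 x" "AE x in torus. b 0 x = b0 x" "AE x in torus. \<theta> 0 x = \<theta>0 x"
proof -
  have semi: "semi_strong_solution \<nu> \<eta> \<kappa> g \<alpha> z T u0 b0 \<theta>0 u b \<theta>"
    and 3: "u \<in> L2_time T (sobolev 3 \<inter> V_space) (sobolev_norm 3)" "b \<in> L2_time T (sobolev 3 \<inter> V_space) (sobolev_norm 3)" "\<theta> \<in> L2_time T (sobolev 3) (sobolev_norm 3)"
    using assms unfolding strong_solution_def by blast+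
  have src: "L2_to_dual (\<lambda>x. \<alpha> * \<eta> * z \<bar>curl f x\<bar> * \<bar>curl f x\<bar>) \<psi> = \<alpha> * \<eta> * L2_inner (source z f) \<psi>" for f \<psi>
    using L2_inner_scaleR_left[of "\<alpha> * \<eta>" "source z f" \<psi>] by (simp add: L2_to_dual_def source_def mult.assoc)
  obtain u' b' \<theta>' where d: 
    "u' \<in> L2_time T H_space L2_norm" "has_time_deriv T H_space L2_norm u u'"
    "b' \<in> L2_time T H_space L2_norm" "has_time_deriv T H_space L2_norm b b'"
    "\<theta>' \<in> L2_time T H_minus1 H_minus1_norm" "has_time_deriv T H_minus1 H_minus1_norm (\<lambda>t. L2_to_dual (\<theta> t)) \<theta>'"
    and eq: "AE t in time_interval T.
          (AE x in torus.
             u' t x + \<nu> *\<^sub>R stokes (u t) x + leray (advect (u t) (u t)) x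
               = leray (advect (b t) (b t)) x + g *\<^sub>R leray (\<lambda>y. \<theta> t y *\<^sub>R axis 2 1) x) \<and>
          (AE x in torus.
             b' t x + \<eta> *\<^sub>R stokes (b t) x + leray (advect (u t) (b t)) x
               = leray (advect (b t) (u t)) x) \<and>
          (\<forall>\<psi>\<in>sobolev 1.
             \<theta>' t \<psi> - \<kappa> * dual_laplacian (\<theta> t) \<psi> + L2_to_dual (advect (u t) (\<theta> t)) \<psi>
               = L2_to_dual (\<lambda>x. \<alpha> * \<eta> * z \<bar>curl (b t) x\<bar> * \<bar>curl (b t) x\<bar>) \<psi>)"
    using semi unfolding semi_strong_solution_def by blast
  have e3: "AE t in time_interval T. \<forall>\<psi>\<in>sobolev 1. \<theta>' t \<psi> - \<kappa> * dual_laplacian (\<theta> t) \<psi> + L2_inner (advect (u t) (\<theta> t)) \<psi>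
               = \<alpha> * \<eta> * L2_inner (source z (b t)) \<psi>"
    using eq unfolding src by eventually_elim (simp add: L2_to_dual_def)
  note r = semi[unfolded semi_strong_solution_def]
  show ?thesis
    by (rule that[OF _ _ 3(1) _ _ 3(2) _ _ 3(3) d _ _ e3]) (use r eq in \<open>auto elim!: eventually_mono\<close>)
qed

theorem theorem2p14:
  fixes \<nu> \<eta> \<kappa> g \<alpha> \<epsilon> T :: real
    and \<zeta> :: "real \<Rightarrow> real \<Rightarrow> real"
    and u0 b0 :: "real^2 \<Rightarrow> real^2"
    and \<theta>0 :: "real^2 \<Rightarrow> real"
    and u1 b1 u2 b2 :: "real \<Rightarrow> real^2 \<Rightarrow> real^2"
    and \<theta>1 \<theta>2 :: "real \<Rightarrow> real^2 \<Rightarrow> real"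
  assumes "\<nu> > 0" and "\<eta> > 0" and "\<kappa> > 0" and "g > 0"
    and "\<epsilon> > 0" and "calming_family \<zeta>"
    and "T > 0"
    and "u0 \<in> sobolev 2 \<inter> V_space" and "b0 \<in> sobolev 2 \<inter> V_space" and "\<theta>0 \<in> sobolev 2"
    and "strong_solution \<nu> \<eta> \<kappa> g \<alpha> (\<zeta> \<epsilon>) T u0 b0 \<theta>0 u1 b1 \<theta>1"
    and "strong_solution \<nu> \<eta> \<kappa> g \<alpha> (\<zeta> \<epsilon>) T u0 b0 \<theta>0 u2 b2 \<theta>2"
  shows "\<forall>t\<in>{0..T}. AE x in torus. u1 t x = u2 t x \<and> b1 t x = b2 t x \<and> \<theta>1 t x = \<theta>2 t x"
proof -
  note pos = assms(1-4) and T = assms(7)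
  obtain u1' b1' \<theta>1' where s1:
    "u1 \<in> C_time T V_space (sobolev_norm 1)" "u1 \<in> L2_time T (sobolev 2 \<inter> V_space) (sobolev_norm 2)" "u1 \<in> L2_time T (sobolev 3 \<inter> V_space) (sobolev_norm 3)"
    "b1 \<in> C_time T V_space (sobolev_norm 1)" "b1 \<in> L2_time T (sobolev 2 \<inter> V_space) (sobolev_norm 2)" "b1 \<in> L2_time T (sobolev 3 \<inter> V_space) (sobolev_norm 3)"
    "\<theta>1 \<in> C_time T L2 L2_norm" "\<theta>1 \<in> L2_time T (sobolev 1) (sobolev_norm 1)" "\<theta>1 \<in> L2_time T (sobolev 3) (sobolev_norm 3)"
    "u1' \<in> L2_time T H_space L2_norm" "has_time_deriv T H_space L2_norm u1 u1'"
    "b1' \<in> L2_time T H_space L2_norm" "has_time_deriv T H_space L2_norm b1 b1'"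
    "\<theta>1' \<in> L2_time T H_minus1 H_minus1_norm" "has_time_deriv T H_minus1 H_minus1_norm (\<lambda>t. L2_to_dual (\<theta>1 t)) \<theta>1'"
    "AE t in time_interval T. AE x in torus. u1' t x + \<nu> *\<^sub>R stokes (u1 t) x + leray (advect (u1 t) (u1 t)) x
               = leray (advect (b1 t) (b1 t)) x + g *\<^sub>R leray (\<lambda>y. \<theta>1 t y *\<^sub>R axis 2 1) x"
    "AE t in time_interval T. AE x in torus. b1' t x + \<eta> *\<^sub>R stokes (b1 t) x + leray (advect (u1 t) (b1 t)) x = leray (advect (b1 t) (u1 t)) x"
    "AE t in time_interval T. \<forall>\<psi>\<in>sobolev 1. \<theta>1' t \<psi> - \<kappa> * dual_laplacian (\<theta>1 t) \<psi> + L2_inner (advect (u1 t) (\<theta>1 t)) \<psi>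
               = \<alpha> * \<eta> * L2_inner (source (\<zeta> \<epsilon>) (b1 t)) \<psi>"
    "AE x in torus. u1 0 x = u0 x" "AE x in torus. b1 0 x = b0 x" "AE x in torus. \<theta>1 0 x = \<theta>0 x"
    using strong_solutionE[OF assms(11)] by blast
  obtain u2' b2' \<theta>2' where s2:
    "u2 \<in> C_time T V_space (sobolev_norm 1)" "u2 \<in> L2_time T (sobolev 2 \<inter> V_space) (sobolev_norm 2)" "u2 \<in> L2_time T (sobolev 3 \<inter> V_space) (sobolev_norm 3)"
    "b2 \<in> C_time T V_space (sobolev_norm 1)" "b2 \<in> L2_time T (sobolev 2 \<inter> V_space) (sobolev_norm 2)" "b2 \<in> L2_time T (sobolev 3 \<inter> V_space) (sobolev_norm 3)"
    "\<theta>2 \<in> C_time T L2 L2_norm" "\<theta>2 \<in> L2_time T (sobolev 1) (sobolev_norm 1)" "\<theta>2 \<in> L2_time T (sobolev 3) (sobolev_norm 3)"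
    "u2' \<in> L2_time T H_space L2_norm" "has_time_deriv T H_space L2_norm u2 u2'"
    "b2' \<in> L2_time T H_space L2_norm" "has_time_deriv T H_space L2_norm b2 b2'"
    "\<theta>2' \<in> L2_time T H_minus1 H_minus1_norm" "has_time_deriv T H_minus1 H_minus1_norm (\<lambda>t. L2_to_dual (\<theta>2 t)) \<theta>2'"
    "AE t in time_interval T. AE x in torus. u2' t x + \<nu> *\<^sub>R stokes (u2 t) x + leray (advect (u2 t) (u2 t)) x
               = leray (advect (b2 t) (b2 t)) x + g *\<^sub>R leray (\<lambda>y. \<theta>2 t y *\<^sub>R axis 2 1) x"
    "AE t in time_interval T. AE x in torus. b2' t x + \<eta> *\<^sub>R stokes (b2 t) x + leray (advect (u2 t) (b2 t)) x = leray (advect (b2 t) (u2 t)) x"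
    "AE t in time_interval T. \<forall>\<psi>\<in>sobolev 1. \<theta>2' t \<psi> - \<kappa> * dual_laplacian (\<theta>2 t) \<psi> + L2_inner (advect (u2 t) (\<theta>2 t)) \<psi>
               = \<alpha> * \<eta> * L2_inner (source (\<zeta> \<epsilon>) (b2 t)) \<psi>"
    "AE x in torus. u2 0 x = u0 x" "AE x in torus. b2 0 x = b0 x" "AE x in torus. \<theta>2 0 x = \<theta>0 x"
    using strong_solutionE[OF assms(12)] by blast
  obtain M where M: "\<And>x. \<bar>\<zeta> \<epsilon> x\<bar> \<le> M"
  proof -
    have "bounded (range (\<zeta> \<epsilon>))" using assms(5,6) by (auto simp: calming_family_def)
    then obtain M where "\<forall>y\<in>range (\<zeta> \<epsilon>). norm y \<le> M" unfolding bounded_iff by blast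
    then show ?thesis using that[of M] by auto
  qed
  obtain L where L: "L-lipschitz_on UNIV (\<zeta> \<epsilon>)" using assms(5,6) by (auto simp: calming_family_def)
  define C where "C = 4/\<nu> + 4/\<eta> + 2/\<kappa> + 2/\<eta> * ((\<alpha> * \<eta>)\<^sup>2 * (2 * M\<^sup>2 + 8 * L\<^sup>2)) + g + 5"
  have C0: "0 \<le> C" using pos by (simp add: C_def)
  define N where "N f = sobolev_norm 3 f" for f :: "real^2 \<Rightarrow> real^2"
  define q where "q r = (N (u1 r))\<^sup>2 + (N (u2 r))\<^sup>2 + (N (b1 r))\<^sup>2 + (N (b2 r))\<^sup>2 + (sobolev_norm 3 (\<theta>1 r))\<^sup>2 + (sobolev_norm 3 (\<theta>2 r))\<^sup>2" for r
  \<comment> \<open>\<open>3600\<close> is \<open>600 * 6\<close>: the squared supremum bound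
    contains \<open>600\<close>, and the square of a sum of six norms is at most six times the sum
    of squares. The \<open>2\<close> is that of the energy identity.\<close>
  define a where "a r = 2 * C * (1 + 3600 * q r)" for r
  have q0: "0 \<le> q r" for r by (simp add: q_def)
  have a0: "0 \<le> a r" for r using C0 q0[of r] by (simp add: a_def)
  interpret ft: finite_measure "time_interval T" by (rule time_interval_finite)
  have qi: "integrable (time_interval T) q"
    using s1(3,6,9) s2(3,6,9) unfolding q_def N_def by (simp add: L2_time_def)
  then have ai: "integrable (time_interval T) a" unfolding a_def by simp
  let ?u = "\<lambda>r x. u1 r x - u2 r x" and ?b = "\<lambda>r x. b1 r x - b2 r x" and ?t = "\<lambda>r x. \<theta>1 r x - \<theta>2 r x"
  define D where "D r = L2_inner (?u r) (\<lambda>x. u1' r x - u2' r x) + L2_inner (?b r) (\<lambda>x. b1' r x - b2' r x) + (\<theta>1' r (?t r) - \<theta>2' r (?t r))" for r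
  define E where "E t = (L2_norm (?u t))\<^sup>2 + (L2_norm (?b t))\<^sup>2 + (L2_norm (?t t))\<^sup>2" for t
  have iu: "AE x in torus. u1 0 x = u2 0 x" using s1(19) s2(19) by eventually_elim simp
  have ib: "AE x in torus. b1 0 x = b2 0 x" using s1(20) s2(20) by eventually_elim simp
  have it: "AE x in torus. \<theta>1 0 x = \<theta>2 0 x" using s1(21) s2(21) by eventually_elim simp
  note eu = energy_vector[OF T s1(1) s2(1) s1(2) s2(2) s1(10,11) s2(10,11) iu]
    and eb = energy_vector[OF T s1(4) s2(4) s1(5) s2(5) s1(12,13) s2(12,13) ib]
    and et = energy_scalar[OF T s1(7) s2(7) s1(8) s2(8) s1(14,15) s2(14,15) it]
  have Di: "integrable (time_interval T) D" unfolding D_def using eu(1) eb(1) et(1) by simp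
  note Di' = Di[unfolded time_interval_def] and ai' = ai[unfolded time_interval_def]
  have ED: "E t = 2 * (LINT r|lebesgue_on {0..t}. D r)" if t: "t \<in> {0..T}" for t
  proof -
    have sub: "{0..t} \<subseteq> {0..T}" using t by auto
    show ?thesis unfolding E_def D_def eu(2)[OF t] eb(2)[OF t] et(2)[OF t]
      using integrable_subinterval[OF eu(1)[unfolded time_interval_def] sub] integrable_subinterval[OF eb(1)[unfolded time_interval_def] sub]
        integrable_subinterval[OF et(1)[unfolded time_interval_def] sub]
      by simp
  qed
  \<comment> \<open>Continuity comes from the representation of \<open>E\<close> as a primitive, for
    all three norms at once.\<close>
  have Ec: "continuous_on {0..T} E"
    by (rule continuous_on_eq[of _ "\<lambda>t. 2 * (LINT r|lebesgue_on {0..t}. D r)"])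
      (auto intro!: continuous_intros indefinite_integral_continuous Di' simp: ED)
  have E0: "0 \<le> E t" for t by (simp add: E_def)
  have mem: "AE r in time_interval T. f r \<in> X" if "f \<in> L2_time T X n" for f :: "real \<Rightarrow> 'x \<Rightarrow> 'v::euclidean_space" and X n
    using that by (simp add: L2_time_def strongly_measurable_def)
  \<comment> \<open>Memberships and equations hold at almost every time, and so does the inequality.
    This suffices for \<open>Gronwall_zero\<close>, whose hypothesis is an integral
    inequality.\<close>
  have rate: "AE r in time_interval T. 2 * D r \<le> E r * a r"
    using mem[OF s1(3)] mem[OF s2(3)] mem[OF s1(6)] mem[OF s2(6)] mem[OF s1(9)] mem[OF s2(9)]
      mem[OF s1(10)] mem[OF s2(10)] mem[OF s1(12)] mem[OF s2(12)] s1(16) s2(16) s1(17) s2(17) s1(18) s2(18)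
  proof eventually_elim
    case (elim r)
    have S3: "u1 r \<in> sobolev 3" "u2 r \<in> sobolev 3" "b1 r \<in> sobolev 3" "b2 r \<in> sobolev 3" "\<theta>1 r \<in> sobolev 3" "\<theta>2 r \<in> sobolev 3"
      using elim(1-6) by auto
    \<comment> \<open>A single number above all six norms, so that \<open>sqrt 600 * S\<close> can
      serve as the one bound \<open>B\<close>.\<close>
    define S where "S = N (u1 r) + N (u2 r) + N (b1 r) + N (b2 r) + sobolev_norm 3 (\<theta>1 r) + sobolev_norm 3 (\<theta>2 r)"
    have NS: "sobolev_norm 3 (u1 r) \<le> S" "sobolev_norm 3 (u2 r) \<le> S" "sobolev_norm 3 (b1 r) \<le> S" "sobolev_norm 3 (b2 r) \<le> S"
      "sobolev_norm 3 (\<theta>1 r) \<le> S" "sobolev_norm 3 (\<theta>2 r) \<le> S"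
      by (auto simp: S_def N_def add_nonneg_nonneg)
    have S0: "0 \<le> sqrt 600 * S" by (auto simp: S_def N_def)
    have dims: "DIM(real^2) \<le> 2" "DIM(real) \<le> 2" by simp_all
    have D: "D r \<le> C * (1 + (sqrt 600 * S)\<^sup>2) * E r"
      unfolding D_def E_def C_def
    proof (rule rate_estimate[OF pos M L _ _ _ _ _ _ S0])
      show "u1 r \<in> sobolev 2 \<inter> V_space" "u2 r \<in> sobolev 2 \<inter> V_space" "b1 r \<in> sobolev 2 \<inter> V_space" "b2 r \<in> sobolev 2 \<inter> V_space"
        using elim(1-4) sobolev_mono[of 2 3] by auto
      show "\<theta>1 r \<in> sobolev 1" "\<theta>2 r \<in> sobolev 1" using elim(5,6) sobolev_mono[of 1 3] by auto
      show "u1' r \<in> L2" "u2' r \<in> L2" "b1' r \<in> L2" "b2' r \<in> L2" using elim(7-10) by (auto intro: H_space_L2)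
    qed (rule sobolev_3_bounds[OF S3(1) NS(1) dims(1)] sobolev_3_bounds[OF S3(2) NS(2) dims(1)] sobolev_3_bounds[OF S3(3) NS(3) dims(1)]
          sobolev_3_bounds[OF S3(4) NS(4) dims(1)] sobolev_3_bounds[OF S3(6) NS(6) dims(2)] elim(11-14)
          bspec[OF elim(15)] bspec[OF elim(16)] | assumption)+
    have "(sqrt 600 * S)\<^sup>2 = 600 * S\<^sup>2" by (simp add: power_mult_distrib)
    also have "\<dots> \<le> 600 * (6 * q r)" unfolding S_def q_def by (intro mult_left_mono sum_six_squares) simp
    finally have "1 + (sqrt 600 * S)\<^sup>2 \<le> 1 + 3600 * q r" by simp
    then have "C * (1 + (sqrt 600 * S)\<^sup>2) * E r \<le> C * (1 + 3600 * q r) * E r"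
      using C0 E0 by (intro mult_right_mono mult_left_mono) auto
    with D have "2 * D r \<le> 2 * (C * (1 + 3600 * q r) * E r)" by simp
    then show ?case by (simp add: a_def mult_ac)
  qed
  \<comment> \<open>The energy identity is valid at every time, so the conclusion is obtained for
    all \<open>t\<close> and not merely for almost all.\<close>
  have "E t = 0" if t: "t \<in> {0..T}" for t
  proof (rule Gronwall_zero[OF T Ec E0 ai' a0 _ t])
    fix t assume t: "t \<in> {0..T}"
    then have sub: "{0..t} \<subseteq> {0..T}" by auto
    have "E t = (LINT r|lebesgue_on {0..t}. 2 * D r)" using ED[OF t] by simp
    also have "\<dots> \<le> (LINT r|lebesgue_on {0..t}. E r * a r)"
    proof (rule integral_mono_AE)
      show "integrable (lebesgue_on {0..t}) (\<lambda>r. 2 * D r)" using integrable_subinterval[OF Di' sub] by simp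
      show "integrable (lebesgue_on {0..t}) (\<lambda>r. E r * a r)"
        by (rule integrable_subinterval[OF integrable_mult_continuous[OF ai' Ec] sub])
      have "AE r in lebesgue. r \<in> {0..T} \<longrightarrow> 2 * D r \<le> E r * a r"
        using rate unfolding time_interval_def by (subst (asm) AE_restrict_space_iff) auto
      then show "AE r in lebesgue_on {0..t}. 2 * D r \<le> E r * a r"
        using sub by (subst AE_restrict_space_iff) (auto elim!: eventually_mono)
    qed
    finally show "E t \<le> (LINT r|lebesgue_on {0..t}. E r * a r)" .
  qed
  then show ?thesis
  proof (intro ballI)
    fix t assume E: "\<And>t. t \<in> {0..T} \<Longrightarrow> E t = 0" and t: "t \<in> {0..T}"
    have "L2_norm (?u t) = 0" "L2_norm (?b t) = 0" "L2_norm (?t t) = 0"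
      using E[OF t] by (auto simp: E_def add_nonneg_eq_0_iff)
    moreover have "?u t \<in> L2" "?b t \<in> L2" "?t t \<in> L2"
    proof -
      have "u1 t \<in> V_space" "u2 t \<in> V_space" "b1 t \<in> V_space" "b2 t \<in> V_space" "\<theta>1 t \<in> L2" "\<theta>2 t \<in> L2"
        using s1(1,4,7) s2(1,4,7) t unfolding C_time_def by blast+
      then show "?u t \<in> L2" "?b t \<in> L2" "?t t \<in> L2"
        using H_space_L2[OF V_space_H_space] by (auto intro!: L2_diff)
    qed
    ultimately have "AE x in torus. ?u t x = 0" "AE x in torus. ?b t x = 0" "AE x in torus. ?t t x = 0"
      by (auto dest!: L2_norm_eq_0)
    then show "AE x in torus. u1 t x = u2 t x \<and> b1 t x = b2 t x \<and> \<theta>1 t x = \<theta>2 t x"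
      by eventually_elim simp
  qed
qed

end
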